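(* For $\pi$ uniform on $\mathrm{PF}_n$, the processes $\left\{\sqrt n\,(F^\pi(x)-x)\right\}_{0\le x\le1}$ converge weakly (as random elements of the Skorokhod space $D[0,1]$) to the standard Brownian excursion $\{E_x\}_{0\le x\le1}$ as $n\to\infty$.
   Context: A parking function of length $n$ is a sequence $(\pi_1,\dots,\pi_n)$ with $1\le\pi_i\le n$ such that $\#\{t:\pi_t\le i\}\ge i$ for all $1\le i\le n$; $\mathrm{PF}_n$ denotes the set of these. For $\pi\in\mathrm{PF}_n$ and $0\le x\le1$, $F^\pi(x)=\frac1n\#\{i:\pi_i\le nx\}$. Standard Brownian excursion: Brownian motion on $[0,1]$ conditioned to be positive on $(0,1)$ and to vanish at $0$ and $1$ (equivalently, the normalized excursion of Brownian motion). *)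

theory Defs
  imports "HOL-Probability.Probability"
begin

definition PF :: "nat \<Rightarrow> nat list set" where
  "PF n = {p. length p = n \<and> set p \<subseteq> {1..n} \<and>
              (\<forall>i\<in>{1..n}. card {t. t < n \<and> p ! t \<le> i} \<ge> i)}"

definition Fpi :: "nat \<Rightarrow> nat list \<Rightarrow> real \<Rightarrow> real" where
  "Fpi n p x = real (card {i. i < n \<and> real (p ! i) \<le> real n * x}) / real n"

definition PFproc :: "nat \<Rightarrow> nat list \<Rightarrow> real \<Rightarrow> real" where
  "PFproc n p x = (if x \<in> {0..1} then sqrt (real n) * (Fpi n p x - x) else 0)"

definition Dsp :: "(real \<Rightarrow> real) set" where
  "Dsp = {f. (\<forall>t\<in>{0..<1}. (f \<longlongrightarrow> f t) (at_right t)) \<and>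
             (\<forall>t\<in>{0<..1}. \<exists>l. (f \<longlongrightarrow> l) (at_left t)) \<and>
             (\<forall>t. t \<notin> {0..1} \<longrightarrow> f t = 0)}"

definition timechanges :: "(real \<Rightarrow> real) set" where
  "timechanges = {l. strict_mono_on {0..1} l \<and> continuous_on {0..1} l \<and> l 0 = 0 \<and> l 1 = 1}"

definition sk_dist :: "(real \<Rightarrow> real) \<Rightarrow> (real \<Rightarrow> real) \<Rightarrow> real" where
  "sk_dist f g = Inf {max (SUP t\<in>{0..1}. \<bar>l t - t\<bar>) (SUP t\<in>{0..1}. \<bar>f t - g (l t)\<bar>) | l. l \<in> timechanges}"

definition sk_continuous :: "((real \<Rightarrow> real) \<Rightarrow> real) \<Rightarrow> bool" where
  "sk_continuous h \<longleftrightarrow> (\<forall>f\<in>Dsp. \<forall>e>0. \<exists>d>0. \<forall>g\<in>Dsp. sk_dist f g < d \<longrightarrow> \<bar>h g - h f\<bar> < e)"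

text \<open>Borel sigma-algebra of D[0,1] = sigma-algebra generated by the coordinate projections.\<close>
definition D_sets :: "(real \<Rightarrow> real) set set" where
  "D_sets = sigma_sets Dsp {{f \<in> Dsp. f t \<in> B} | t B. B \<in> sets borel}"

definition exc_entr :: "real \<Rightarrow> real \<Rightarrow> real" where
  "exc_entr t y = y / sqrt (2 * pi * t ^ 3) * exp (- (y ^ 2) / (2 * t))"

definition exc_kill :: "real \<Rightarrow> real \<Rightarrow> real \<Rightarrow> real" where
  "exc_kill t x y = (exp (- ((x - y) ^ 2) / (2 * t)) - exp (- ((x + y) ^ 2) / (2 * t))) / sqrt (2 * pi * t)"

definition exc_dens :: "real list \<Rightarrow> (nat \<Rightarrow> real) \<Rightarrow> real" where
  "exc_dens ts x = (let k = length ts in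
     if (\<forall>i<k. x i > 0) then
       2 * sqrt (2 * pi) * exc_entr (ts ! 0) (x 0) *
       (\<Prod>i<k - 1. exc_kill (ts ! (i + 1) - ts ! i) (x i) (x (i + 1))) *
       exc_entr (1 - ts ! (k - 1)) (x (k - 1))
     else 0)"

definition brownian_excursion :: "(real \<Rightarrow> real) measure \<Rightarrow> bool" where
  "brownian_excursion M \<longleftrightarrow>
     prob_space M \<and> space M = Dsp \<and> sets M = D_sets \<and>
     (AE f in M. continuous_on {0..1} f \<and> f 0 = 0 \<and> f 1 = 0) \<and>
     (\<forall>ts A. ts \<noteq> [] \<and> sorted_wrt (<) ts \<and> set ts \<subseteq> {0<..<1} \<and>
             (\<forall>i<length ts. A i \<in> sets borel) \<longrightarrow>
        emeasure M {f \<in> space M. \<forall>i<length ts. f (ts ! i) \<in> A i} =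
        (\<integral>\<^sup>+ x. indicator (Pi\<^sub>E {..<length ts} A) x * ennreal (exc_dens ts x)
             \<partial>(Pi\<^sub>M {..<length ts} (\<lambda>_. lborel))))"

end

(* The number of cars preferring one of the first i spots, minus i, is a walk with steps
   Poisson(1) - 1, conditioned to stay nonnegative and to end at 0. The weight of the continuations
   of such a walk that reach 0 has a closed form, so multiplying by exp (- l X^2), where X is the
   rescaled position at the last of several times, only replaces the walk asymptotically by one of
   another length. By induction this gives the joint Laplace transform of the squares of the
   positions at finitely many times, and the excursion densities satisfy the same recursion.
   Stone-Weierstrass turns this into convergence of finite-dimensional distributions.

   A parking function of length n is one of the n+1 cyclic shifts of a uniform sequence in
   {1..n+1}, and a shift changes the modulus of continuity by at most a factor 2, so tightness
   follows from fourth moments and dyadic chaining for uniform sequences. A bounded continuous h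
   is the increasing limit of functions that are Lipschitz in the supremum norm; this yields
   liminf E h >= integral of h, and the same bound for -h finishes the proof. *)

theory Submission
  imports Defs "HOL-Real_Asymp.Real_Asymp"
begin


section \<open>Counting parking functions\<close>

text \<open>The ratio of the continuation weights for two horizons \<open>v < w\<close>, seen from
  height \<open>a\<close>, behaves like a constant times \<open>exp (- b * a^2 / 2)\<close> with
  \<open>b = 1/(v+1) - 1/(w+1)\<close>. A Gaussian tilt at the last time is therefore a change of
  horizon, and this ratio is all that has to be estimated: neither a local limit theorem nor the
  transition densities of the walk enter. The tilt sees squares only, which is enough because both
  the parking counts and the excursion are nonnegative. Two obstacles shape the rest. The map from
  \<open>X\<close> to \<open>exp (- X^2)\<close> has no continuous inverse at 0, so sampled paths
  are truncated at a height \<open>m\<close>, and the event that the truncation is active is charged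
  to the tightness bound. And a function that is Lipschitz in the supremum norm need not be
  measurable for the \<sigma>-algebra of the projections, so only its values on paths rebuilt from
  finitely many coordinates are integrated. Time changes other than the identity appear only in the
  proof that \<open>h\<close> is measurable.\<close>

definition cnt :: "nat \<Rightarrow> nat list \<Rightarrow> nat" where
  "cnt i p = length (filter (\<lambda>x. x \<le> i) p)"

definition lsts :: "nat \<Rightarrow> nat \<Rightarrow> nat list set" where
  "lsts k s = {p. length p = s \<and> set p \<subseteq> {1..k}}"

definition adm :: "nat \<Rightarrow> nat \<Rightarrow> nat list set" where
  "adm k s = {p \<in> lsts k s. \<forall>i\<le>k. i \<le> cnt i p}"

text \<open>$e^{-k}$ times the expectation of $G$ over $k$ steps of a walk with increments Poisson(1) $-$ 1 that
  starts at 0, stays nonnegative and ends at $s - k$.\<close>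
definition mu :: "nat \<Rightarrow> nat \<Rightarrow> (nat list \<Rightarrow> real) \<Rightarrow> real" where
  "mu k s G = (\<Sum>p\<in>adm k s. G p) / fact s"

text \<open>$e^{-v}$ times this is the probability that the walk started at $a$ stays nonnegative for $v$ steps and
  ends at 0.\<close>
definition qq :: "nat \<Rightarrow> nat \<Rightarrow> real" where
  "qq v a = (if a \<le> v then (real a + 1) * (real v + 1) ^ (v - a) / ((real v + 1) * fact (v - a)) else 0)"

lemma finite_lsts: "finite (lsts k s)"
  unfolding lsts_def using finite_lists_length_eq[of "{1..k}" s] by (simp add: conj_commute)

lemma finite_adm: "finite (adm k s)"
  unfolding adm_def using finite_lsts by simp

lemma cnt_eq_card: "length p = n \<Longrightarrow> card {t. t < n \<and> p ! t \<le> i} = cnt i p"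
  by (simp add: cnt_def length_filter_conv_card)

lemma PF_eq_adm: "PF n = adm n n"
proof -
  have "(\<forall>i\<in>{1..n}. card {t. t < n \<and> p ! t \<le> i} \<ge> i) = (\<forall>i\<le>n. i \<le> cnt i p)" if "length p = n" for p
    using that by (auto simp: cnt_eq_card)
  then show ?thesis by (auto simp: PF_def adm_def lsts_def)
qed

lemma cnt_top: "p \<in> lsts k s \<Longrightarrow> k \<le> i \<Longrightarrow> cnt i p = s"
proof -
  assume a: "p \<in> lsts k s" "k \<le> i"
  then have "filter (\<lambda>x. x \<le> i) p = p" by (auto simp: lsts_def filter_id_conv)
  then show ?thesis using a by (simp add: cnt_def lsts_def)
qed

lemma cnt_filter: "i \<le> k \<Longrightarrow> cnt i (filter (\<lambda>x. x \<le> k) p) = cnt i p"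
  unfolding cnt_def filter_filter
  by (rule arg_cong[where f=length], rule filter_cong) auto

lemma sum_lsts_Cons: "(\<Sum>p\<in>lsts k (Suc b). f p) = (\<Sum>x\<in>{1..k}. \<Sum>p\<in>lsts k b. f (x # p))"
proof -
  have eq: "lsts k (Suc b) = (\<lambda>(x,p). x # p) ` ({1..k} \<times> lsts k b)"
  proof (rule set_eqI)
    fix p show "p \<in> lsts k (Suc b) \<longleftrightarrow> p \<in> (\<lambda>(x,p). x # p) ` ({1..k} \<times> lsts k b)"
      by (cases p) (auto simp: lsts_def)
  qed
  have "(\<Sum>p\<in>lsts k (Suc b). f p) = (\<Sum>z\<in>{1..k} \<times> lsts k b. f (fst z # snd z))"
    unfolding eq by (subst sum.reindex) (auto simp: inj_on_def case_prod_unfold)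
  then show ?thesis by (simp add: sum.cartesian_product case_prod_unfold)
qed

text \<open>Choose the \<open>s\<close> positions whose entry is at most \<open>k\<close>; all other
  entries must be \<open>Suc k\<close>, in one way. The induction adds one entry in front, either in
  {1..k} or equal to \<open>Suc k\<close>, and Pascal's rule merges the two sums.\<close>

lemma sum_lsts_filter:
  fixes f :: "nat list \<Rightarrow> real"
  shows "(\<Sum>p\<in>lsts (Suc k) b. f (filter (\<lambda>x. x \<le> k) p)) =
         (\<Sum>s\<le>b. real (b choose s) * (\<Sum>p\<in>lsts k s. f p))"
proof (induction b arbitrary: f)
  case 0
  have "lsts k 0 = {[]}" for k by (auto simp: lsts_def)
  then show ?case by simp
next
  case (Suc b)
  let ?F = "\<lambda>s. \<Sum>p\<in>lsts k s. f p"
  let ?g = "\<lambda>p. \<Sum>x\<in>{1..k}. f (x # p)"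
  have g: "(\<Sum>p\<in>lsts k s. ?g p) = ?F (Suc s)" for s
    unfolding sum_lsts_Cons by (rule sum.swap)
  have "(\<Sum>p\<in>lsts (Suc k) (Suc b). f (filter (\<lambda>x. x \<le> k) p)) =
     (\<Sum>p\<in>lsts (Suc k) b. ?g (filter (\<lambda>x. x \<le> k) p)) + (\<Sum>p\<in>lsts (Suc k) b. f (filter (\<lambda>x. x \<le> k) p))"
  proof -
    have "(\<Sum>x\<in>{1..k}. \<Sum>p\<in>lsts (Suc k) b. f (filter (\<lambda>x. x \<le> k) (x # p))) =
       (\<Sum>p\<in>lsts (Suc k) b. ?g (filter (\<lambda>x. x \<le> k) p))"
      by (subst sum.swap) (auto intro!: sum.cong)
    then show ?thesis unfolding sum_lsts_Cons by simp
  qed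
  also have "\<dots> = (\<Sum>s\<le>b. real (b choose s) * ?F (Suc s)) + (\<Sum>s\<le>b. real (b choose s) * ?F s)"
    by (simp only: Suc.IH[of ?g] Suc.IH[of f] g)
  also have "(\<Sum>s\<le>b. real (b choose s) * ?F s) = ?F 0 + (\<Sum>s\<le>b. real (b choose Suc s) * ?F (Suc s))"
  proof -
    have "(\<Sum>s\<le>b. real (b choose s) * ?F s) = (\<Sum>s\<le>Suc b. real (b choose s) * ?F s)" by simp
    also have "\<dots> = ?F 0 + (\<Sum>s\<le>b. real (b choose Suc s) * ?F (Suc s))"
      by (subst sum.atMost_Suc_shift) simp
    finally show ?thesis .
  qed
  also have "(\<Sum>s\<le>b. real (b choose s) * ?F (Suc s)) + (?F 0 + (\<Sum>s\<le>b. real (b choose Suc s) * ?F (Suc s))) =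
     (\<Sum>s\<le>Suc b. real (Suc b choose s) * ?F s)"
  proof -
    have "(\<Sum>s\<le>Suc b. real (Suc b choose s) * ?F s) = ?F 0 + (\<Sum>s\<le>b. real (Suc b choose Suc s) * ?F (Suc s))"
      by (subst sum.atMost_Suc_shift) simp
    then show ?thesis by (simp add: sum.distrib algebra_simps)
  qed
  finally show ?case .
qed

lemma mu_less: "s < k \<Longrightarrow> mu k s G = 0"
proof -
  assume "s < k"
  then have "adm k s = {}" using cnt_top[of _ k s k] by (fastforce simp: adm_def)
  then show ?thesis by (simp add: mu_def)
qed

text \<open>This is adaptedness of \<open>G\<close> to the first \<open>k\<close> steps of the walk,
  expressed on the sequence of preferences.\<close>

definition upto_dep :: "nat \<Rightarrow> (nat list \<Rightarrow> real) \<Rightarrow> bool" where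
  "upto_dep k G \<longleftrightarrow> (\<forall>p. G p = G (filter (\<lambda>x. x \<le> k) p))"

lemma upto_dep_mono: assumes "upto_dep k G" "k \<le> l" shows "upto_dep l G"
  unfolding upto_dep_def
proof
  fix p
  have "filter (\<lambda>x. x \<le> k) (filter (\<lambda>x. x \<le> l) p) = filter (\<lambda>x. x \<le> k) p"
    unfolding filter_filter by (rule filter_cong) (use assms in auto)
  then show "G p = G (filter (\<lambda>x. x \<le> l) p)" using assms(1) unfolding upto_dep_def by metis
qed

text \<open>One step of the walk: \<open>b - s\<close> cars prefer spot \<open>Suc k\<close>, and
  \<open>1 / fact (b - s)\<close> is the Poisson weight without its exponential factor. Since
  \<open>Suc k \<le> b\<close>, the new constraint at \<open>Suc k\<close> holds automatically, and
  admissibility is decided by the entries up to \<open>k\<close>.\<close>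

lemma mu_Suc:
  assumes G: "upto_dep k G" and b: "Suc k \<le> b"
  shows "mu (Suc k) b G = (\<Sum>s\<le>b. mu k s G / fact (b - s))"
proof -
  define f where "f p = (if \<forall>i\<le>k. i \<le> cnt i p then G p else 0)" for p
  have adm: "p \<in> adm (Suc k) b \<longleftrightarrow> (\<forall>i\<le>k. i \<le> cnt i p)" if "p \<in> lsts (Suc k) b" for p
    using that cnt_top[OF that, of "Suc k"] b by (auto simp: adm_def le_Suc_eq)
  have "(\<Sum>p\<in>adm (Suc k) b. G p) = (\<Sum>p\<in>lsts (Suc k) b. if p \<in> adm (Suc k) b then G p else 0)"
    by (rule sum.mono_neutral_cong_left) (auto simp: finite_lsts adm_def)
  also have "\<dots> = (\<Sum>p\<in>lsts (Suc k) b. f (filter (\<lambda>x. x \<le> k) p))"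
  proof (rule sum.cong[OF refl])
    fix p assume p: "p \<in> lsts (Suc k) b"
    show "(if p \<in> adm (Suc k) b then G p else 0) = f (filter (\<lambda>x. x \<le> k) p)"
      unfolding adm[OF p] f_def using G by (simp add: cnt_filter upto_dep_def[symmetric]) (metis upto_dep_def)
  qed
  also have "\<dots> = (\<Sum>s\<le>b. real (b choose s) * (\<Sum>p\<in>lsts k s. f p))" by (rule sum_lsts_filter)
  also have "\<dots> = (\<Sum>s\<le>b. real (b choose s) * (\<Sum>p\<in>adm k s. G p))"
  proof -
    have "(\<Sum>p\<in>lsts k s. f p) = (\<Sum>p\<in>adm k s. G p)" for s
      by (rule sum.mono_neutral_cong_right) (auto simp: finite_lsts adm_def f_def)
    then show ?thesis by simp
  qed
  finally have "(\<Sum>p\<in>adm (Suc k) b. G p) = (\<Sum>s\<le>b. real (b choose s) * (\<Sum>p\<in>adm k s. G p))" .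
  then have "mu (Suc k) b G = (\<Sum>s\<le>b. real (b choose s) * (\<Sum>p\<in>adm k s. G p)) / fact b"
    by (simp add: mu_def)
  also have "\<dots> = (\<Sum>s\<le>b. mu k s G / fact (b - s))"
    unfolding sum_divide_distrib
    by (rule sum.cong) (auto simp: mu_def binomial_fact)
  finally show ?thesis .
qed

lemma binomial_first_moment:
  "(\<Sum>c\<le>m. real c * real (m choose c) * x ^ (m - c)) = real m * (x + 1) ^ (m - 1)"
proof (cases m)
  case (Suc l)
  have "(\<Sum>c\<le>m. real c * real (m choose c) * x ^ (m - c)) =
     (\<Sum>c\<le>l. real (Suc c) * real (Suc l choose Suc c) * x ^ (l - c))"
    unfolding Suc by (subst sum.atMost_Suc_shift) simp
  also have "\<dots> = (\<Sum>c\<le>l. real (Suc l) * (real (l choose c) * x ^ (l - c)))"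
  proof (rule sum.cong[OF refl])
    fix c
    have "real (Suc c) * real (Suc l choose Suc c) = real (Suc l) * real (l choose c)"
      using Suc_times_binomial_eq[of l c] by (metis of_nat_mult mult.commute)
    then show "real (Suc c) * real (Suc l choose Suc c) * x ^ (l - c) = real (Suc l) * (real (l choose c) * x ^ (l - c))"
      by (simp only: mult.assoc)
  qed
  also have "\<dots> = real (Suc l) * (1 + x) ^ l"
    unfolding binomial_ring[of 1 x l] sum_distrib_left[symmetric] by simp
  finally show ?thesis by (simp add: Suc add.commute)
qed simp

text \<open>Decomposition by the first step, which moves \<open>a\<close> to
  \<open>a + c - 1\<close>; the guard keeps the walk nonnegative. \<open>qq\<close> is Kemperman's
  hitting-time formula: staying nonnegative for \<open>v\<close> steps and ending at 0 means that
  one more step down makes \<open>v + 1\<close> the first time at -1. With \<open>N = v + 1\<close>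
  the sum is a combination of the binomial theorem and its first moment.\<close>

lemma qq_Suc:
  "qq (Suc v) a = (\<Sum>c\<le>Suc v - a. if 1 \<le> a + c then qq v (a + c - 1) / fact c else 0)"
proof (cases "a \<le> Suc v")
  case False
  then show ?thesis by (auto simp: qq_def)
next
  case True
  define m where "m = Suc v - a"
  define N where "N = real v + 1"
  have N: "N > 0" by (simp add: N_def)
  have mN: "real m = N - real a" using True by (simp add: m_def N_def)
  have trm: "(if 1 \<le> a + c then qq v (a + c - 1) / fact c else 0) =
      (real a * (real (m choose c) * N ^ (m - c)) + real c * real (m choose c) * N ^ (m - c)) / (N * fact m)"
    if c: "c \<le> m" for c
  proof (cases "1 \<le> a + c")
    case False
    then have "a = 0" "c = 0" by auto
    then show ?thesis by simp
  next
    case True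
    have le: "a + c - 1 \<le> v" and e: "v - (a + c - 1) = m - c" using True c \<open>a \<le> Suc v\<close> by (auto simp: m_def)
    have "real (a + c - 1) + 1 = real a + real c" using True by linarith
    then have e1: "qq v (a + c - 1) = (real a + real c) * N ^ (m - c) / (N * fact (m - c))"
      unfolding qq_def e using le by (simp add: N_def)
    have e2: "real (m choose c) = fact m / (fact c * fact (m - c))" using c by (rule binomial_fact)
    show ?thesis unfolding e1 e2 using True N by (simp add: field_simps)
  qed
  have "(\<Sum>c\<le>m. if 1 \<le> a + c then qq v (a + c - 1) / fact c else 0) =
    (\<Sum>c\<le>m. (real a * (real (m choose c) * N ^ (m - c)) + real c * real (m choose c) * N ^ (m - c)) / (N * fact m))"
    by (rule sum.cong) (use trm in auto)
  also have "\<dots> = (real a * (\<Sum>c\<le>m. real (m choose c) * N ^ (m - c)) + (\<Sum>c\<le>m. real c * real (m choose c) * N ^ (m - c))) / (N * fact m)"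
    by (simp only: sum_divide_distrib[symmetric] sum.distrib sum_distrib_left)
  also have "(\<Sum>c\<le>m. real (m choose c) * N ^ (m - c)) = (N + 1) ^ m"
    using binomial_ring[of 1 N m] by (simp add: add.commute)
  also have "(\<Sum>c\<le>m. real c * real (m choose c) * N ^ (m - c)) = real m * (N + 1) ^ (m - 1)"
    by (rule binomial_first_moment)
  also have "(real a * (N + 1) ^ m + real m * (N + 1) ^ (m - 1)) / (N * fact m) = (real a + 1) * (N + 1) ^ m / ((N + 1) * fact m)"
  proof (cases m)
    case 0
    then have "real a = N" using mN by simp
    then show ?thesis using 0 N by (simp add: field_simps)
  next
    case (Suc l)
    have "real a * (N + 1) ^ m + real m * (N + 1) ^ (m - 1) = (N + 1) ^ l * (real a * (N + 1) + real m)"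
      using Suc by (simp add: algebra_simps)
    also have "real a * (N + 1) + real m = (real a + 1) * N" unfolding mN by (simp add: algebra_simps)
    finally have e: "real a * (N + 1) ^ m + real m * (N + 1) ^ (m - 1) = (N + 1) ^ l * ((real a + 1) * N)" .
    show ?thesis unfolding e using N by (simp add: Suc del: fact_Suc of_nat_Suc)
  qed
  finally show ?thesis using True unfolding qq_def m_def N_def by (simp add: add.commute)
qed

section \<open>Splitting a path at an intermediate time\<close>

definition pair :: "nat \<Rightarrow> nat \<Rightarrow> (nat list \<Rightarrow> real) \<Rightarrow> real" where
  "pair k v G = (\<Sum>s\<in>{k..k+v}. mu k s G * qq v (s - k))"

lemma qq_Suc':
  assumes "k \<le> s"
  shows "qq (Suc v) (s - k) = (\<Sum>b\<in>{Suc k..Suc k + v}. if s \<le> b then qq v (b - Suc k) / fact (b - s) else 0)"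
proof -
  have "qq (Suc v) (s - k) = (\<Sum>c\<in>{c. c \<le> Suc v - (s-k) \<and> 1 \<le> s - k + c \<and> s - k \<le> Suc v}. qq v (s - k + c - 1) / fact c)"
    unfolding qq_Suc by (rule sum.mono_neutral_cong_right) (auto simp: qq_def)
  also have "\<dots> = (\<Sum>b\<in>{b\<in>{Suc k..Suc k + v}. s \<le> b}. qq v (b - Suc k) / fact (b - s))"
    by (rule sum.reindex_bij_witness[where i="\<lambda>b. b - s" and j="\<lambda>c. s + c"]) (use assms in auto)
  also have "\<dots> = (\<Sum>b\<in>{Suc k..Suc k + v}. if s \<le> b then qq v (b - Suc k) / fact (b - s) else 0)"
    by (rule sum.inter_filter) simp
  finally show ?thesis .
qed

text \<open>Chapman-Kolmogorov: the step from \<open>k\<close> to \<open>Suc k\<close> can be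
  charged to the past by \<open>mu_Suc\<close> or to the future by \<open>qq_Suc'\<close>, and
  exchanging the two sums identifies the results.\<close>

lemma pair_Suc:
  assumes G: "upto_dep k G"
  shows "pair (Suc k) v G = pair k (Suc v) G"
proof -
  have "pair (Suc k) v G = (\<Sum>b\<in>{Suc k..Suc k + v}. \<Sum>s\<in>{k..k + Suc v}. if s \<le> b then mu k s G * (qq v (b - Suc k) / fact (b - s)) else 0)"
    unfolding pair_def
  proof (rule sum.cong[OF refl])
    fix b assume b: "b \<in> {Suc k..Suc k + v}"
    have "mu (Suc k) b G = (\<Sum>s\<le>b. mu k s G / fact (b - s))" using mu_Suc[OF G] b by simp
    also have "\<dots> = (\<Sum>s\<in>{k..k + Suc v}. if s \<le> b then mu k s G / fact (b - s) else 0)"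
      by (rule sum.mono_neutral_cong) (use b in \<open>auto simp: mu_less\<close>)
    finally have eq: "mu (Suc k) b G = (\<Sum>s\<in>{k..k + Suc v}. if s \<le> b then mu k s G / fact (b - s) else 0)" .
    show "mu (Suc k) b G * qq v (b - Suc k) = (\<Sum>s\<in>{k..k + Suc v}. if s \<le> b then mu k s G * (qq v (b - Suc k) / fact (b - s)) else 0)"
      unfolding eq sum_distrib_right by (rule sum.cong) auto
  qed
  also have "\<dots> = (\<Sum>s\<in>{k..k + Suc v}. \<Sum>b\<in>{Suc k..Suc k + v}. if s \<le> b then mu k s G * (qq v (b - Suc k) / fact (b - s)) else 0)"
    by (rule sum.swap)
  also have "\<dots> = pair k (Suc v) G"
    unfolding pair_def
  proof (rule sum.cong[OF refl])
    fix s assume "s \<in> {k..k + Suc v}"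
    then have s: "k \<le> s" by simp
    show "(\<Sum>b\<in>{Suc k..Suc k + v}. if s \<le> b then mu k s G * (qq v (b - Suc k) / fact (b - s)) else 0) =
      mu k s G * qq (Suc v) (s - k)"
      unfolding qq_Suc'[OF s] sum_distrib_left by (rule sum.cong) auto
  qed
  finally show ?thesis .
qed

text \<open>At \<open>k = n\<close> no step is left and \<open>qq 0 0 = 1\<close>, so the identity
  is the definition of \<open>mu\<close>; \<open>pair_Suc\<close> carries it from
  \<open>Suc k\<close> down to \<open>k\<close>.\<close>

lemma sum_PF_eq_pair:
  assumes G: "upto_dep k G" and "k \<le> n"
  shows "(\<Sum>p\<in>PF n. G p) / fact n = pair k (n - k) G"
proof -
  have "k + d = n \<Longrightarrow> upto_dep k G \<Longrightarrow> (\<Sum>p\<in>PF n. G p) / fact n = pair k d G" for d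
  proof (induction d arbitrary: k)
    case 0
    then show ?case by (simp add: pair_def mu_def PF_eq_adm qq_def)
  next
    case (Suc d)
    have "pair (Suc k) d G = pair k (Suc d) G" using Suc.prems by (intro pair_Suc) 
    then show ?case using Suc.IH[of "Suc k"] Suc.prems upto_dep_mono[of k G "Suc k"] by auto
  qed
  from this[of "n - k"] show ?thesis using assms by simp
qed

lemma card_PF: "real (card (PF n)) = fact n * qq n 0"
proof -
  have "mu 0 s (\<lambda>_. 1) = (if s = 0 then 1 else 0)" for s
  proof -
    have "adm 0 s = (if s = 0 then {[]} else {})" by (auto simp: adm_def lsts_def)
    then show ?thesis by (simp add: mu_def)
  qed
  then have "pair 0 n (\<lambda>_. 1) = qq n 0" by (simp add: pair_def sum.delta if_distrib[of "\<lambda>x. x * _"] cong: if_cong)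
  moreover have "(\<Sum>p\<in>PF n. 1::real) / fact n = pair 0 n (\<lambda>_. 1)"
    using sum_PF_eq_pair[of 0 "\<lambda>_. 1" n] by (simp add: upto_dep_def)
  ultimately show ?thesis by (simp add: field_simps)
qed

lemma card_PF': "real (card (PF n)) * (real n + 1) = (real n + 1) ^ n"
  unfolding card_PF by (simp add: qq_def)

definition PE :: "nat \<Rightarrow> (nat list \<Rightarrow> real) \<Rightarrow> real" where
  "PE n G = (\<Sum>p\<in>PF n. G p) / real (card (PF n))"

lemma qq_pos: "a \<le> v \<Longrightarrow> qq v a > 0"
  unfolding qq_def by (auto intro!: divide_pos_pos mult_pos_pos)

lemma finite_PF: "finite (PF n)" by (simp add: PF_eq_adm finite_adm)

lemma card_PF_pos: "card (PF n) > 0"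
  using card_PF[of n] qq_pos[of 0 n] by (metis fact_gt_zero le0 mult_pos_pos of_nat_0_less_iff)

lemma PE_eq_pair:
  assumes "upto_dep k G" "k \<le> n"
  shows "PE n G = pair k (n - k) G / qq n 0"
  using sum_PF_eq_pair[OF assms] qq_pos[of 0 n] unfolding PE_def card_PF by (simp add: field_simps)

text \<open>Up to the factor \<open>a + 1\<close> this is \<open>qq v a / qq v 0\<close>: a falling
  factorial of \<open>v\<close> over a power of \<open>v + 1\<close>. In product form two horizons
  can be compared factor by factor, and the value is 0 by itself for \<open>a > v\<close>.\<close>

definition Rr :: "nat \<Rightarrow> nat \<Rightarrow> real" where
  "Rr v a = (\<Prod>i\<in>{1..a}. 1 - real i / (real v + 1))"

lemma qq_eq_Rr: "qq v a = (real a + 1) * qq v 0 * Rr v a"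
proof (cases "a \<le> v")
  case False
  then have "Rr v a = 0" unfolding Rr_def by (intro prod_zero) (auto intro!: bexI[of _ "Suc v"])
  then show ?thesis using False by (simp add: qq_def)
next
  case True
  have R: "a \<le> v \<Longrightarrow> Rr v a = fact v / (fact (v - a) * (real v + 1) ^ a)" for a
  proof (induction a)
    case 0 then show ?case by (simp add: Rr_def)
  next
    case (Suc a)
    have "Rr v (Suc a) = Rr v a * (1 - real (Suc a) / (real v + 1))"
      by (simp add: Rr_def atLeastAtMostSuc_conv mult.commute)
    also have "1 - real (Suc a) / (real v + 1) = real (v - a) / (real v + 1)"
      using Suc.prems by (simp add: field_simps of_nat_diff)
    also have "Rr v a = fact v / (fact (v - a) * (real v + 1) ^ a)" using Suc by simp
    also have "fact (v - a) = real (v - a) * fact (v - Suc a)"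
      using Suc.prems by (metis Suc_diff_Suc fact_Suc of_nat_mult of_nat_fact Suc_le_lessD)
    finally have "Rr v (Suc a) = fact v / (real (v - a) * fact (v - Suc a) * (real v + 1) ^ a) * (real (v - a) / (real v + 1))" .
    moreover have "real (v - a) \<noteq> 0" using Suc.prems by simp
    ultimately show ?case by (simp del: of_nat_diff)
  qed
  have "(real v + 1) ^ v = (real v + 1) ^ (v - a) * (real v + 1) ^ a"
    using True by (simp flip: power_add)
  moreover have "c * A / (X * F) = c * (A * B / (X * W)) * (W / (F * B))" if "B \<noteq> 0" "W \<noteq> 0" for c A B X W F :: real
    using that by (simp add: divide_simps)
  ultimately show ?thesis unfolding R[OF True] using True by (simp add: qq_def)
qed

lemma Rr_nonneg: "a \<le> v \<Longrightarrow> Rr v a \<ge> 0"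
  unfolding Rr_def by (intro prod_nonneg) (auto simp: field_simps)

lemma PE_abs_le:
  assumes "\<And>p. p \<in> PF n \<Longrightarrow> \<bar>G p\<bar> \<le> B" shows "\<bar>PE n G\<bar> \<le> B"
proof -
  have "\<bar>\<Sum>p\<in>PF n. G p\<bar> \<le> (\<Sum>p\<in>PF n. \<bar>G p\<bar>)" by (rule sum_abs)
  also have "\<dots> \<le> real (card (PF n)) * B" using assms by (intro sum_bounded_above) auto
  finally show ?thesis using card_PF_pos[of n] by (simp add: PE_def field_simps)
qed

text \<open>Splitting at \<open>k\<close> gives both expectations the same weights
  \<open>mu k s G * (s - k + 1)\<close>, up to normalizing constants, and leaves \<open>Rr v\<close>
  to be compared with \<open>g\<close> times \<open>Rr (n - k)\<close>. The hypothesis on the error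
  is relative to \<open>Rr (n - k)\<close>, so the errors add up to \<eta> times an expectation of
  \<open>\<bar>G\<bar>\<close>.\<close>

lemma PE_change:
  assumes G: "upto_dep k G" and "k \<le> n" and v: "v \<le> n - k"
    and B: "\<And>p. \<bar>G p\<bar> \<le> 1"
    and \<eta>: "\<And>a. a \<le> n - k \<Longrightarrow> \<bar>Rr v a - g a * Rr (n - k) a\<bar> \<le> \<eta> * Rr (n - k) a"
  shows "\<bar>PE n (\<lambda>p. G p * g (cnt k p - k)) - qq (n - k) 0 * qq (k + v) 0 / (qq v 0 * qq n 0) * PE (k + v) G\<bar> \<le> \<eta>"
proof -
  define w where "w = n - k"
  have \<eta>0: "\<eta> \<ge> 0" using \<eta>[of 0] by (simp add: Rr_def)
  have dep: "upto_dep k (\<lambda>p. G p * g (cnt k p - k))" "upto_dep k (\<lambda>p. \<bar>G p\<bar>)"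
    using G cnt_filter[of k k] by (auto simp: upto_dep_def)
  have pos: "qq n 0 > 0" "qq w 0 > 0" "qq v 0 > 0" "qq (k+v) 0 > 0" by (simp_all add: qq_pos)
  have mu_g: "mu k s (\<lambda>p. G p * g (cnt k p - k)) = mu k s G * g (s - k)" for s
  proof -
    have "(\<Sum>p\<in>adm k s. G p * g (cnt k p - k)) = (\<Sum>p\<in>adm k s. G p * g (s - k))"
      by (rule sum.cong) (auto simp: adm_def cnt_top)
    then show ?thesis by (simp add: mu_def sum_distrib_right)
  qed
  have 1: "PE n (\<lambda>p. G p * g (cnt k p - k)) =
     (\<Sum>s\<in>{k..k+w}. mu k s G * (g (s-k) * Rr w (s - k)) * (real (s-k) + 1) * (qq w 0 / qq n 0))"
    unfolding PE_eq_pair[OF dep(1) \<open>k \<le> n\<close>] pair_def mu_g w_def[symmetric] sum_divide_distrib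
    by (rule sum.cong[OF refl]) (subst qq_eq_Rr, simp)
  have "PE (k + v) G = pair k v G / qq (k + v) 0"
    using PE_eq_pair[OF G, of "k + v"] by simp
  \<comment> \<open>\<open>qq v a\<close> is 0 for \<open>a > v\<close>, so both sums may run over
    the larger range of the horizon \<open>w\<close>.\<close>
  also have "pair k v G = (\<Sum>s\<in>{k..k+w}. mu k s G * qq v (s - k))"
    unfolding pair_def by (rule sum.mono_neutral_left) (use v in \<open>auto simp: w_def qq_def\<close>)
  also have "\<dots> = qq v 0 * (\<Sum>s\<in>{k..k+w}. mu k s G * Rr v (s - k) * (real (s-k) + 1))"
    unfolding sum_distrib_left by (rule sum.cong[OF refl]) (subst qq_eq_Rr, simp)
  finally have "qq w 0 * qq (k + v) 0 / (qq v 0 * qq n 0) * PE (k + v) G =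
     (\<Sum>s\<in>{k..k+w}. mu k s G * Rr v (s - k) * (real (s-k) + 1)) * (qq w 0 / qq n 0)"
    using pos by (simp add: field_simps)
  then have 2: "qq w 0 * qq (k + v) 0 / (qq v 0 * qq n 0) * PE (k + v) G =
     (\<Sum>s\<in>{k..k+w}. mu k s G * Rr v (s - k) * (real (s-k) + 1) * (qq w 0 / qq n 0))"
    unfolding sum_distrib_right .
  have "\<bar>PE n (\<lambda>p. G p * g (cnt k p - k)) - qq w 0 * qq (k + v) 0 / (qq v 0 * qq n 0) * PE (k + v) G\<bar>
     = \<bar>\<Sum>s\<in>{k..k+w}. mu k s G * (g (s-k) * Rr w (s - k) - Rr v (s - k)) * ((real (s-k) + 1) * (qq w 0 / qq n 0))\<bar>"
    unfolding 1 2 sum_subtractf[symmetric]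
    by (rule arg_cong[where f=abs], rule sum.cong[OF refl])
      (simp only: left_diff_distrib right_diff_distrib mult.assoc)
  also have "\<dots> \<le> (\<Sum>s\<in>{k..k+w}. mu k s (\<lambda>p. \<bar>G p\<bar>) * (\<eta> * Rr w (s - k)) * ((real (s-k) + 1) * (qq w 0 / qq n 0)))"
  proof (rule order.trans[OF sum_abs], rule sum_mono)
    fix s assume s: "s \<in> {k..k+w}"
    have "\<bar>mu k s G\<bar> \<le> mu k s (\<lambda>p. \<bar>G p\<bar>)"
      by (simp add: mu_def divide_right_mono sum_abs)
    moreover have "\<bar>g (s-k) * Rr w (s - k) - Rr v (s - k)\<bar> \<le> \<eta> * Rr w (s - k)"
    proof -
      have "s - k \<le> w" using s by auto
      then show ?thesis using \<eta>[of "s - k"] by (simp add: w_def abs_minus_commute)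
    qed
    moreover have "mu k s (\<lambda>p. \<bar>G p\<bar>) \<ge> 0" by (simp add: mu_def sum_nonneg)
    ultimately show "\<bar>mu k s G * (g (s-k) * Rr w (s - k) - Rr v (s - k)) * ((real (s-k) + 1) * (qq w 0 / qq n 0))\<bar>
       \<le> mu k s (\<lambda>p. \<bar>G p\<bar>) * (\<eta> * Rr w (s - k)) * ((real (s-k) + 1) * (qq w 0 / qq n 0))"
      unfolding abs_mult using pos by (intro mult_mono) auto
  qed
  also have "\<dots> = \<eta> * PE n (\<lambda>p. \<bar>G p\<bar>)"
    unfolding PE_eq_pair[OF dep(2) \<open>k \<le> n\<close>] pair_def w_def[symmetric] sum_divide_distrib sum_distrib_left
    by (rule sum.cong[OF refl]) (subst qq_eq_Rr, simp)
  also have "\<dots> \<le> \<eta> * 1" using PE_abs_le[of n "\<lambda>p. \<bar>G p\<bar>" 1] B \<eta>0 by (intro mult_left_mono) auto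
  finally show ?thesis by (simp add: w_def)
qed

section \<open>Asymptotics of the weights\<close>

lemma Rr_Suc: "Rr v (Suc a) = Rr v a * (1 - real (Suc a) / (real v + 1))"
  by (simp add: Rr_def atLeastAtMostSuc_conv mult.commute)

text \<open>With \<open>x = i / (w + 1)\<close> and \<open>x' = i / (v + 1)\<close>, the quotient of
  the \<open>i\<close>-th factors is \<open>1 - (x' - x) / (1 - x)\<close>, at most
  \<open>exp (- (x' - x))\<close>. The exponents \<open>x' - x\<close> are \<open>i\<close> times
  the difference of the reciprocals and sum to the stated one. Nonnegativity is carried along so
  that the inequalities can be multiplied.\<close>

lemma Rr_upper:
  assumes "a \<le> w" "v \<le> w"
  shows "Rr v a \<le> exp (- (1 / (real v + 1) - 1 / (real w + 1)) * real a * (real a + 1) / 2) * Rr w a \<and> 0 \<le> Rr v a"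
  using assms(1)
proof (induction a)
  case 0 then show ?case by (simp add: Rr_def)
next
  case (Suc a)
  define x' where "x' = real (Suc a) / (real v + 1)"
  define x where "x = real (Suc a) / (real w + 1)"
  define b where "b = 1 / (real v + 1) - 1 / (real w + 1)"
  show ?case
  proof (cases "Suc a \<le> v")
    case False
    have "Rr v (Suc a) = 0" using False unfolding Rr_def by (intro prod_zero) (auto intro!: bexI[of _ "Suc v"])
    then show ?thesis using Rr_nonneg[OF Suc.prems] by simp
  next
    case True
    have x: "x < 1" "x \<le> x'" "x' \<le> 1" "0 \<le> x"
      using Suc.prems assms(2) True by (auto simp: x_def x'_def divide_simps)
    have "(1 - x') = (1 - x) * (1 - (x' - x) / (1 - x))" using x by (simp add: field_simps)
    also have "\<dots> \<le> (1 - x) * exp (- (x' - x))"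
    proof (rule mult_left_mono)
      have "(x' - x) * 1 \<le> (x' - x) * (1 / (1 - x))" using x by (intro mult_left_mono) (auto simp: field_simps)
      moreover have "1 + (- ((x' - x) / (1 - x))) \<le> exp (- ((x' - x) / (1 - x)))" by (rule exp_ge_add_one_self)
      ultimately have "1 - (x' - x) / (1 - x) \<le> exp (- ((x' - x) / (1 - x)))" by simp
      also have "\<dots> \<le> exp (- (x' - x))" using \<open>(x' - x) * 1 \<le> _\<close> by simp
      finally show "1 - (x' - x) / (1 - x) \<le> exp (- (x' - x))" .
    qed (use x in auto)
    finally have f: "1 - x' \<le> exp (- (x' - x)) * (1 - x)" by (simp add: mult.commute)
    have b: "x' - x = b * real (Suc a)" by (simp add: x'_def x_def b_def algebra_simps)
    have IH: "Rr v a \<le> exp (- b * real a * (real a + 1) / 2) * Rr w a" "0 \<le> Rr v a"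
      using Suc by (auto simp: b_def)
    have "Rr v (Suc a) \<le> (exp (- b * real a * (real a + 1) / 2) * Rr w a) * (exp (- (x' - x)) * (1 - x))"
      unfolding Rr_Suc x'_def[symmetric] using IH x f by (intro mult_mono) auto
    also have "\<dots> = (exp (- b * real a * (real a + 1) / 2) * exp (- (x' - x))) * Rr w (Suc a)"
      unfolding Rr_Suc x_def by simp
    also have "exp (- b * real a * (real a + 1) / 2) * exp (- (x' - x)) = exp (- b * real (Suc a) * (real (Suc a) + 1) / 2)"
      unfolding b exp_add[symmetric] by (rule arg_cong[where f=exp]) (simp add: field_simps)
    finally show ?thesis using IH(2) x unfolding b_def by (auto simp: Rr_Suc x'_def)
  qed
qed

text \<open>The reverse estimate uses \<open>1 / (1 - x') \<le> 1 + 2 * x'\<close>, which requires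
  \<open>x' \<le> 1/2\<close> and so restricts \<open>a\<close>. The corrections
  \<open>2 * x' * (x' - x)\<close> produce a sum of squares, bounded by the cube of
  \<open>a\<close>.\<close>

lemma Rr_lower:
  assumes "2 * a \<le> v + 1" "v \<le> w"
  shows "exp (- (1 / (real v + 1) - 1 / (real w + 1)) * (real a * (real a + 1) / 2 + 2 * real a ^ 3 / (real v + 1))) * Rr w a \<le> Rr v a"
  using assms(1)
proof (induction a)
  case 0 then show ?case by (simp add: Rr_def)
next
  case (Suc a)
  define x' where "x' = real (Suc a) / (real v + 1)"
  define x where "x = real (Suc a) / (real w + 1)"
  define b where "b = 1 / (real v + 1) - 1 / (real w + 1)"
  have b0: "b \<ge> 0" using assms(2) by (simp add: b_def field_simps)
  have "2 * real (Suc a) \<le> real v + 1" using Suc.prems by linarith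
  then have x: "x \<le> x'" "2 * x' \<le> 1" "0 \<le> x"
    using assms(2) by (auto simp: x_def x'_def divide_simps)
  have "(1 - x) = (1 - x') * (1 + (x' - x) / (1 - x'))" using x by (simp add: field_simps)
  also have "\<dots> \<le> (1 - x') * exp ((x' - x) * (1 + 2 * x'))"
  proof (rule mult_left_mono)
    have "x' * (2 * x') \<le> x' * 1" using x by (intro mult_left_mono) auto
    then have "1 \<le> (1 + 2 * x') * (1 - x')" by (simp add: algebra_simps)
    then have "1 / (1 - x') \<le> 1 + 2 * x'" using x by (simp add: field_simps)
    then have "(x' - x) * (1 / (1 - x')) \<le> (x' - x) * (1 + 2 * x')" using x by (intro mult_left_mono) auto
    moreover have "1 + (x' - x) / (1 - x') \<le> exp ((x' - x) / (1 - x'))" by (rule exp_ge_add_one_self)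
    moreover have "exp ((x' - x) / (1 - x')) \<le> exp ((x' - x) * (1 + 2 * x'))" using calculation(1) by simp
    ultimately show "1 + (x' - x) / (1 - x') \<le> exp ((x' - x) * (1 + 2 * x'))" by linarith
  qed (use x in auto)
  finally have f0: "1 - x \<le> (1 - x') * exp ((x' - x) * (1 + 2 * x'))" .
  have f: "exp (- ((x' - x) * (1 + 2 * x'))) * (1 - x) \<le> 1 - x'"
  proof -
    define D where "D = (x' - x) * (1 + 2 * x')"
    have "exp (- D) * (1 - x) \<le> exp (- D) * ((1 - x') * exp D)" using f0 by (intro mult_left_mono) (auto simp: D_def)
    also have "\<dots> = 1 - x'" by (simp add: exp_minus field_simps)
    finally show ?thesis by (simp add: D_def)
  qed
  have bb: "x' - x = b * real (Suc a)" by (simp add: x'_def x_def b_def algebra_simps)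
  let ?e = "\<lambda>a. exp (- b * (real a * (real a + 1) / 2 + 2 * real a ^ 3 / (real v + 1)))"
  have IH: "?e a * Rr w a \<le> Rr v a" using Suc by (auto simp: b_def)
  have a1: "a \<le> w" "a \<le> v" using Suc.prems assms(2) by auto
  have cube: "(real a)^3 + (real (Suc a))^2 \<le> real (Suc a) ^ 3"
    by (simp add: power3_eq_cube power2_eq_square algebra_simps)
  have "?e (Suc a) \<le> ?e a * exp (- ((x' - x) * (1 + 2 * x')))"
  proof -
    have "(x' - x) * (1 + 2 * x') = b * (real (Suc a) + 2 * real (Suc a) ^ 2 / (real v + 1))"
      unfolding bb by (simp add: x'_def power2_eq_square field_simps)
    then have "- b * (real a * (real a + 1) / 2 + 2 * real a ^ 3 / (real v + 1)) + - ((x' - x) * (1 + 2 * x'))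
      = - b * (real (Suc a) * (real (Suc a) + 1) / 2 + 2 * (real a ^ 3 + real (Suc a) ^ 2) / (real v + 1))"
      by (simp add: algebra_simps add_divide_distrib)
    moreover have "b * (real (Suc a) * (real (Suc a) + 1) / 2 + 2 * (real a ^ 3 + real (Suc a) ^ 2) / (real v + 1))
      \<le> b * (real (Suc a) * (real (Suc a) + 1) / 2 + 2 * real (Suc a) ^ 3 / (real v + 1))"
      using cube b0 by (intro mult_left_mono add_left_mono divide_right_mono) auto
    ultimately show ?thesis unfolding exp_add[symmetric] by simp
  qed
  then have "?e (Suc a) * Rr w (Suc a) \<le> (?e a * exp (- ((x' - x) * (1 + 2 * x')))) * Rr w (Suc a)"
    using Rr_nonneg[of "Suc a" w] Suc.prems assms(2) by (intro mult_right_mono) auto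
  also have "\<dots> = (?e a * Rr w a) * (exp (- ((x' - x) * (1 + 2 * x'))) * (1 - x))"
    unfolding Rr_Suc x_def by simp
  also have "\<dots> \<le> Rr v a * (1 - x')"
    using IH f x Rr_nonneg[OF a1(2)] Rr_nonneg[OF a1(1)] by (intro mult_mono) auto
  finally show ?case by (simp add: Rr_Suc x'_def b_def)
qed

lemma exp_neg_half_sq_le: "z \<ge> 0 \<Longrightarrow> z * exp (- z\<^sup>2 / 2) \<le> (1::real)" 
  "z \<ge> 0 \<Longrightarrow> z^3 * exp (- z\<^sup>2 / 2) \<le> (8::real)"
proof -
  assume z: "z \<ge> 0"
  have e1: "1 + z\<^sup>2 / 2 \<le> exp (z\<^sup>2 / 2)" by (rule exp_ge_add_one_self)
  have "z \<le> 1 + z\<^sup>2 / 2" using sum_squares_ge_zero[of "z - 1" 0] by (simp add: power2_eq_square algebra_simps)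
  then show "z * exp (- z\<^sup>2 / 2) \<le> 1" using e1 by (simp add: exp_minus field_simps)
  have "exp (z\<^sup>2 / 2) = exp (z\<^sup>2 / 4) * exp (z\<^sup>2 / 4)" by (simp flip: exp_add)
  moreover have "1 + z\<^sup>2 / 4 \<le> exp (z\<^sup>2 / 4)" by (rule exp_ge_add_one_self)
  ultimately have e2: "(1 + z\<^sup>2 / 4) * (1 + z\<^sup>2 / 4) \<le> exp (z\<^sup>2 / 2)"
    using mult_mono[of "1 + z\<^sup>2 / 4" "exp (z\<^sup>2 / 4)" "1 + z\<^sup>2 / 4" "exp (z\<^sup>2 / 4)"] by simp
  have "8 * ((1 + z\<^sup>2 / 4) * (1 + z\<^sup>2 / 4)) - z^3 = 8 + 3 * z\<^sup>2 + z^2 * ((z - 1)\<^sup>2 + 1) / 2"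
    by (simp add: power2_eq_square power3_eq_cube field_simps)
  moreover have "8 + 3 * z\<^sup>2 + z^2 * ((z - 1)\<^sup>2 + 1) / 2 \<ge> 0" by (intro add_nonneg_nonneg) auto
  ultimately have "z^3 \<le> 8 * ((1 + z\<^sup>2 / 4) * (1 + z\<^sup>2 / 4))" by linarith
  with e2 show "z^3 * exp (- z\<^sup>2 / 2) \<le> 8" by (simp add: exp_minus field_simps)
qed

text \<open>In the scaled height \<open>z = sqrt b * a\<close> the exact bounds lose terms of order
  \<open>sqrt b * z\<close> and \<open>z^3 / (sqrt b * (v + 1))\<close> in the exponent. Powers of
  \<open>z\<close> times \<open>exp (- z^2 / 2)\<close> are bounded, so the relative error is
  uniform in \<open>a\<close>; it is small when \<open>v\<close> is large and \<open>b\<close> is of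
  order \<open>1 / v\<close>.\<close>

lemma Rr_compare:
  assumes "a \<le> w" "v < w"
  defines "b \<equiv> 1 / (real v + 1) - 1 / (real w + 1)"
  shows "\<bar>Rr v a - exp (- b * (real a)\<^sup>2 / 2) * Rr w a\<bar> \<le> (sqrt b + 18 / (sqrt b * (real v + 1))) * Rr w a"
proof -
  have "1 / (real w + 1) < 1 / (real v + 1)" using assms(2) by (intro divide_strict_left_mono) auto
  then have b0: "b > 0" by (simp add: b_def)
  define z where "z = sqrt b * real a"
  have z: "z \<ge> 0" "z\<^sup>2 = b * (real a)\<^sup>2" using b0 by (auto simp: z_def power_mult_distrib)
  have R: "Rr w a \<ge> 0" using Rr_nonneg assms(1) .
  let ?E = "exp (- z\<^sup>2 / 2)"
  let ?V = "real v + 1"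
  have E: "exp (- b * (real a)\<^sup>2 / 2) = ?E" by (simp add: z)
  have up: "Rr v a \<le> ?E * Rr w a" "0 \<le> Rr v a"
  proof -
    have "exp (- b * real a * (real a + 1) / 2) \<le> ?E" unfolding z(2) using b0 by (simp add: power2_eq_square field_simps)
    then have "exp (- b * real a * (real a + 1) / 2) * Rr w a \<le> ?E * Rr w a" using R by (intro mult_right_mono)
    then show "Rr v a \<le> ?E * Rr w a" "0 \<le> Rr v a" using Rr_upper[of a w v] assms(1,2) by (auto simp: b_def)
  qed
  have sb: "sqrt b > 0" using b0 by simp
  have "?E * Rr w a - Rr v a \<le> (sqrt b + 18 / (sqrt b * ?V)) * Rr w a"
  proof (cases "2 * a \<le> v + 1")
    case True
    define d where "d = b * (real a / 2 + 2 * real a ^ 3 / ?V)"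
    have "exp (- b * (real a * (real a + 1) / 2 + 2 * real a ^ 3 / ?V)) = ?E * exp (- d)"
      unfolding z d_def exp_add[symmetric] by (rule arg_cong[where f=exp]) (simp add: field_simps power2_eq_square)
    then have "?E * exp (-d) * Rr w a \<le> Rr v a" using Rr_lower[OF True, of w] assms(2) by (simp add: b_def)
    moreover have "?E * (1 - d) * Rr w a \<le> ?E * exp (-d) * Rr w a"
      using exp_ge_add_one_self[of "-d"] R by (intro mult_right_mono mult_left_mono) auto
    ultimately have "?E * Rr w a - Rr v a \<le> (?E * d) * Rr w a" by (simp add: algebra_simps)
    \<comment> \<open>The bounds 1 and 8 of \<open>exp_neg_half_sq_le\<close> give the constant 16
      here, and the other case gives 2; 18 covers both.\<close>
    also have "?E * d \<le> sqrt b + 18 / (sqrt b * ?V)"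
    proof -
      have "(r * r) * (x / 2 + 2 * x ^ 3 / V) = r * (r * x) / 2 + 2 / (r * V) * (r * x) ^ 3" if "r \<noteq> 0" "V \<noteq> 0" for r x V :: real
        using that by (simp add: field_simps power3_eq_cube)
      from this[of "sqrt b" ?V "real a"] have d: "d = sqrt b * z / 2 + 2 / (sqrt b * ?V) * z ^ 3"
        using b0 by (simp add: d_def z_def)
      have "?E * d = sqrt b / 2 * (z * ?E) + 2 / (sqrt b * ?V) * (z^3 * ?E)" unfolding d by (simp add: algebra_simps)
      also have "\<dots> \<le> sqrt b / 2 * 1 + 2 / (sqrt b * ?V) * 8"
        using exp_neg_half_sq_le(1)[OF z(1)] exp_neg_half_sq_le(2)[OF z(1)] sb by (intro add_mono mult_left_mono) auto
      also have "\<dots> \<le> sqrt b + 18 / (sqrt b * ?V)" using sb by (intro add_mono) (auto intro!: divide_right_mono)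
      finally show ?thesis .
    qed
    finally show ?thesis using R by (simp add: mult_right_mono)
  next
    \<comment> \<open>For large \<open>a\<close> the bound \<open>0 \<le> Rr v a\<close> suffices:
      \<open>z\<close> is at least half of \<open>sqrt b * (v + 1)\<close>, so the Gaussian term
      itself is below the error.\<close>
    case False
    have "?V < 2 * real a" using False by linarith
    then have za: "sqrt b * ?V \<le> 2 * z" using sb by (simp add: z_def)
    have Vp: "sqrt b * ?V > 0" using sb by simp
    have "?E * (sqrt b * ?V) \<le> ?E * (2 * z)" using za by (intro mult_left_mono) auto
    also have "\<dots> \<le> 2" using exp_neg_half_sq_le(1)[OF z(1)] by (simp add: mult.commute)
    finally have "?E \<le> 2 / (sqrt b * ?V)" using Vp by (simp add: field_simps)
    also have "\<dots> \<le> sqrt b + 18 / (sqrt b * ?V)" using sb Vp divide_right_mono[of 2 18 "sqrt b * ?V"] by linarith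
    finally have "?E * Rr w a \<le> (sqrt b + 18 / (sqrt b * ?V)) * Rr w a" using R by (intro mult_right_mono)
    then show ?thesis using up by linarith
  qed
  then show ?thesis unfolding E using up by (simp add: abs_if)
qed

text \<open>Uniformity in \<open>x\<close> comes from \<open>a * x * exp (- a * x) \<le> 1\<close>.
  It allows the rate for finite \<open>N\<close> to be replaced by its limit at all heights
  simultaneously.\<close>

lemma exp_diff_le:
  assumes "x \<ge> 0" "a > 0" "b > (0::real)"
  shows "\<bar>exp (- a * x) - exp (- b * x)\<bar> \<le> \<bar>a - b\<bar> / min a b"
proof -
  have *: "\<bar>exp (- a * x) - exp (- b * x)\<bar> \<le> (b - a) / a" if "a \<le> b" "a > 0" for a b
  proof -
    have "exp (- b * x) = exp (- a * x) * exp (- (b - a) * x)" by (simp flip: exp_add add: algebra_simps)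
    then have "exp (- a * x) - exp (- b * x) = exp (- a * x) * (1 - exp (- (b - a) * x))" by (simp add: algebra_simps)
    also have "\<dots> \<le> exp (- a * x) * ((b - a) * x)" using exp_ge_add_one_self[of "(a-b)*x"] by (intro mult_left_mono) (auto simp: algebra_simps)
    also have "\<dots> = (b - a) / a * (a * x * exp (- a * x))" using that by simp
    also have "\<dots> \<le> (b - a) / a * 1"
    proof (rule mult_left_mono)
      have "a * x \<le> exp (a * x)" using exp_ge_add_one_self[of "a*x"] by linarith
      then show "a * x * exp (- a * x) \<le> 1" by (simp add: exp_minus field_simps)
    qed (use that in auto)
    finally show ?thesis using that assms(1) by (simp add: mult_right_mono)
  qed
  show ?thesis
  proof (cases "a \<le> b")
    case True then show ?thesis using *[of a b] assms by (simp add: min_def)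
  next
    case False then show ?thesis using *[of b a] assms by (simp add: min_def abs_minus_commute)
  qed
qed

text \<open>After multiplication by \<open>N\<close> the rate \<open>b\<close> of
  \<open>Rr_compare\<close> tends to \<open>2 * kappa\<close>, and both of its error terms are then
  of order \<open>1 / sqrt N\<close>.\<close>

lemma Rr_asymp:
  fixes v w :: "nat \<Rightarrow> nat"
  assumes v: "(\<lambda>N. real (v N) / real N) \<longlonglongrightarrow> \<sigma>" and w: "(\<lambda>N. real (w N) / real N) \<longlonglongrightarrow> \<tau>"
    and "0 < \<sigma>" "\<sigma> < \<tau>" and "\<eta> > 0"
  defines "kappa \<equiv> 1 / (2 * \<sigma>) - 1 / (2 * \<tau>)"
  shows "\<forall>\<^sub>F N in sequentially. v N \<le> w N \<and>
    (\<forall>a\<le>w N. \<bar>Rr (v N) a - exp (- kappa * (real a)\<^sup>2 / N) * Rr (w N) a\<bar> \<le> \<eta> * Rr (w N) a)"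
proof -
  define b where "b N = 1 / (real (v N) + 1) - 1 / (real (w N) + 1)" for N
  have "kappa > 0" using assms by (simp add: kappa_def field_simps)
  have inv0: "(\<lambda>N. 1 / real N) \<longlonglongrightarrow> 0" by real_asymp
  have v1: "(\<lambda>N. (real (v N) + 1) / real N) \<longlonglongrightarrow> \<sigma>"
    using tendsto_add[OF v inv0] by (simp add: add_divide_distrib)
  have w1: "(\<lambda>N. (real (w N) + 1) / real N) \<longlonglongrightarrow> \<tau>"
    using tendsto_add[OF w inv0] by (simp add: add_divide_distrib)
  have Nb: "(\<lambda>N. real N * b N) \<longlonglongrightarrow> 2 * kappa"
  proof -
    have "(\<lambda>N. inverse ((real (v N) + 1) / real N) - inverse ((real (w N) + 1) / real N)) \<longlonglongrightarrow> inverse \<sigma> - inverse \<tau>"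
      using assms by (intro tendsto_intros v1 w1) auto
    moreover have "inverse \<sigma> - inverse \<tau> = 2 * kappa" using assms(3,4) by (simp add: kappa_def field_simps)
    moreover have "inverse ((real (v N) + 1) / real N) - inverse ((real (w N) + 1) / real N) = real N * b N" for N
      by (simp add: b_def field_simps)
    ultimately show ?thesis by simp
  qed
  have e1: "(\<lambda>N. sqrt (b N)) \<longlonglongrightarrow> 0"
  proof -
    have "(\<lambda>N. sqrt (real N * b N * (1 / real N))) \<longlonglongrightarrow> sqrt (2 * kappa * 0)" by (intro tendsto_intros Nb inv0)
    moreover have "\<forall>\<^sub>F N in sequentially. sqrt (real N * b N * (1 / real N)) = sqrt (b N)"
      using eventually_gt_at_top[of 0] by eventually_elim simp
    ultimately have "(\<lambda>N. sqrt (b N)) \<longlonglongrightarrow> sqrt (2 * kappa * 0)" by (rule Lim_transform_eventually)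
    then show ?thesis by simp
  qed
  have e2: "(\<lambda>N. 18 / (sqrt (b N) * (real (v N) + 1))) \<longlonglongrightarrow> 0"
  proof -
    have "(\<lambda>N. 18 * (sqrt (1 / real N)) / (sqrt (real N * b N) * ((real (v N) + 1) / real N))) \<longlonglongrightarrow> 18 * sqrt 0 / (sqrt (2 * kappa) * \<sigma>)"
      using assms(3) \<open>kappa > 0\<close> by (intro tendsto_intros Nb inv0 v1) auto
    moreover have "\<forall>\<^sub>F N in sequentially. 18 * (sqrt (1 / real N)) / (sqrt (real N * b N) * ((real (v N) + 1) / real N)) = 18 / (sqrt (b N) * (real (v N) + 1))"
      using eventually_gt_at_top[of 0]
    proof eventually_elim
      case (elim N)
      obtain s where s: "s > 0" "s * s = real N" "sqrt (real N) = s" using elim by (metis of_nat_0_less_iff real_sqrt_gt_zero real_sqrt_mult_self abs_of_nat)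
      have h: "sqrt (1 / real N) = 1 / s" "sqrt (real N * b N) = s * sqrt (b N)" using s by (auto simp: real_sqrt_divide real_sqrt_mult)
      show ?case unfolding h unfolding s(2)[symmetric] using s(1) by simp
    qed
    ultimately show ?thesis by (simp add: tendsto_cong)
  qed
  have e3: "(\<lambda>N. \<bar>real N * b N / 2 - kappa\<bar> / min (real N * b N / 2) kappa) \<longlonglongrightarrow> 0"
  proof -
    have "(\<lambda>N. \<bar>real N * b N / 2 - kappa\<bar> / min (real N * b N / 2) kappa) \<longlonglongrightarrow> \<bar>2 * kappa / 2 - kappa\<bar> / min (2 * kappa / 2) kappa"
      using \<open>kappa > 0\<close> by (intro tendsto_intros Nb) auto
    then show ?thesis by simp
  qed
  have "(\<lambda>N. sqrt (b N) + 18 / (sqrt (b N) * (real (v N) + 1)) + \<bar>real N * b N / 2 - kappa\<bar> / min (real N * b N / 2) kappa) \<longlonglongrightarrow> 0 + 0 + 0"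
    by (intro tendsto_add e1 e2 e3)
  then have ev1: "\<forall>\<^sub>F N in sequentially. sqrt (b N) + 18 / (sqrt (b N) * (real (v N) + 1)) + \<bar>real N * b N / 2 - kappa\<bar> / min (real N * b N / 2) kappa < \<eta>"
    using \<open>\<eta> > 0\<close> by (intro order_tendstoD(2)) auto
  have ev2: "\<forall>\<^sub>F N in sequentially. real N * b N > 0"
    using order_tendstoD(1)[OF Nb, of 0] \<open>kappa > 0\<close> by simp
  show ?thesis using ev1 ev2 eventually_gt_at_top[of 0]
  proof eventually_elim
    case (elim N)
    have bN: "b N > 0" using elim by (simp add: zero_less_mult_iff)
    have vw: "v N < w N"
    proof (rule ccontr)
      assume "\<not> v N < w N"
      then have "1 / (real (v N) + 1) \<le> 1 / (real (w N) + 1)" by (intro divide_left_mono) auto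
      then show False using bN by (simp add: b_def)
    qed
    show ?case
    proof (intro conjI allI impI)
      fix a assume a: "a \<le> w N"
      have R: "Rr (w N) a \<ge> 0" using a by (rule Rr_nonneg)
      have 1: "\<bar>Rr (v N) a - exp (- b N * (real a)\<^sup>2 / 2) * Rr (w N) a\<bar> \<le> (sqrt (b N) + 18 / (sqrt (b N) * (real (v N) + 1))) * Rr (w N) a"
        using Rr_compare[OF a vw] by (simp add: b_def)
      have h1: "\<bar>exp (- (real N * b N / 2) * ((real a)\<^sup>2 / N)) - exp (- kappa * ((real a)\<^sup>2 / N))\<bar> \<le> \<bar>real N * b N / 2 - kappa\<bar> / min (real N * b N / 2) kappa"
        using elim \<open>kappa > 0\<close> by (intro exp_diff_le) auto
      have eqx: "- (real N * b N / 2) * ((real a)\<^sup>2 / N) = - b N * (real a)\<^sup>2 / 2" using elim by simp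
      have "\<bar>exp (- b N * (real a)\<^sup>2 / 2) - exp (- kappa * (real a)\<^sup>2 / N)\<bar> * Rr (w N) a \<le> \<bar>real N * b N / 2 - kappa\<bar> / min (real N * b N / 2) kappa * Rr (w N) a"
        using mult_right_mono[OF h1[unfolded eqx] R] by simp
      moreover have "\<bar>exp (- b N * (real a)\<^sup>2 / 2) - exp (- kappa * (real a)\<^sup>2 / N)\<bar> * Rr (w N) a = \<bar>exp (- b N * (real a)\<^sup>2 / 2) * Rr (w N) a - exp (- kappa * (real a)\<^sup>2 / N) * Rr (w N) a\<bar>"
        using R by (simp add: abs_mult flip: left_diff_distrib)
      ultimately have "\<bar>Rr (v N) a - exp (- kappa * (real a)\<^sup>2 / N) * Rr (w N) a\<bar> \<le>
        (sqrt (b N) + 18 / (sqrt (b N) * (real (v N) + 1)) + \<bar>real N * b N / 2 - kappa\<bar> / min (real N * b N / 2) kappa) * Rr (w N) a"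
        using 1 by (simp add: algebra_simps)
      also have "\<dots> \<le> \<eta> * Rr (w N) a" using elim R by (intro mult_right_mono) auto
      finally show "\<bar>Rr (v N) a - exp (- kappa * (real a)\<^sup>2 / N) * Rr (w N) a\<bar> \<le> \<eta> * Rr (w N) a" .
    qed (use vw in auto)
  qed
qed


text \<open>\<open>d\<close> is the logarithm of the normalized weight. Its increments are of order
  \<open>1 / n^2\<close>, so it converges; the value of the limit cancels in
  \<open>qq_ratio_limit\<close>. The power 3/2 is the one that appears in
  \<open>Lap\<close>.\<close>

lemma qq_normalized_limit:
  obtains c where "c > 0" "(\<lambda>n. qq n 0 * exp (- real n) * (real n + 1) powr (3/2)) \<longlonglongrightarrow> c"
proof -
  define d where "d n = (real n + 1/2) * ln (real n + 1) - real n - ln (fact n)" for n :: nat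
  have step: "d (Suc n) - d n = (real n + 3/2) * (ln (real n + 2) - ln (real n + 1)) - 1" for n
  proof -
    have f: "ln (fact (Suc n)) = ln (real n + 1) + ln (fact n :: real)"
      using ln_mult[of "real n + 1" "fact n :: real"] by (simp add: algebra_simps)
    show ?thesis by (simp add: d_def f algebra_simps del: fact_Suc)
  qed
  have O: "(\<lambda>n. (real n + 3/2) * (ln (real n + 2) - ln (real n + 1)) - 1) \<in> O(\<lambda>n. 1 / real n ^ 2)"
    by real_asymp
  have "summable (\<lambda>n. 1 / real n ^ 2)" using inverse_power_summable[of 2, where 'a=real] by (simp add: inverse_eq_divide)
  then have "summable (\<lambda>n. d (Suc n) - d n)"
    unfolding step by (intro summable_comparison_test_bigo[OF _ O]) simp
  then obtain l where l: "(\<lambda>n. \<Sum>k<n. d (Suc k) - d k) \<longlonglongrightarrow> l" using summable_LIMSEQ by blast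
  have "(\<lambda>n. \<Sum>k<n. d (Suc k) - d k) = (\<lambda>n. d n - d 0)" by (simp add: sum_lessThan_telescope)
  with l have "(\<lambda>n. d n - d 0 + d 0) \<longlonglongrightarrow> l + d 0" by (intro tendsto_add) auto
  then have "(\<lambda>n. exp (d n)) \<longlonglongrightarrow> exp (l + d 0)" by (intro tendsto_exp) simp
  moreover have "exp (d n) = qq n 0 * exp (- real n) * (real n + 1) powr (3/2)" for n
  proof -
    have "qq n 0 = exp (real n * ln (real n + 1) - ln (real n + 1) - ln (fact n))"
      by (simp add: qq_def exp_diff exp_of_nat_mult)
    moreover have "(real n + 1) powr (3/2) = exp (3/2 * ln (real n + 1))" by (simp add: powr_def)
    ultimately have "qq n 0 * exp (- real n) * (real n + 1) powr (3/2) =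
       exp ((real n * ln (real n + 1) - ln (real n + 1) - ln (fact n)) + (- real n) + 3/2 * ln (real n + 1))"
      by (simp only: exp_add)
    also have "(real n * ln (real n + 1) - ln (real n + 1) - ln (fact n)) + (- real n) + 3/2 * ln (real n + 1) = d n"
      by (simp add: d_def algebra_simps)
    finally show ?thesis by simp
  qed
  ultimately show ?thesis using that[of "exp (l + d 0)"] by simp
qed

text \<open>The exponential factors cancel because the four sizes balance.\<close>
lemma qq_ratio_limit:
  fixes a b c d :: "nat \<Rightarrow> nat"
  assumes lim: "(\<lambda>N. real (a N) / N) \<longlonglongrightarrow> A" "(\<lambda>N. real (b N) / N) \<longlonglongrightarrow> B" "(\<lambda>N. real (c N) / N) \<longlonglongrightarrow> C" "(\<lambda>N. real (d N) / N) \<longlonglongrightarrow> D"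
    and pos: "A > 0" "B > 0" "C > 0" "D > 0" and bal: "\<forall>\<^sub>F N in sequentially. a N + b N = c N + d N"
  shows "(\<lambda>N. qq (a N) 0 * qq (b N) 0 / (qq (c N) 0 * qq (d N) 0)) \<longlonglongrightarrow> (C * D / (A * B)) powr (3/2)"
proof -
  obtain k where k: "k > 0" "(\<lambda>n. qq n 0 * exp (- real n) * (real n + 1) powr (3/2)) \<longlonglongrightarrow> k"
    by (rule qq_normalized_limit)
  define e where "e n = qq n 0 * exp (- real n) * (real n + 1) powr (3/2)" for n
  have e: "e \<longlonglongrightarrow> k" using k(2) by (simp add: e_def[abs_def])
  have inv0: "(\<lambda>N. 1 / real N) \<longlonglongrightarrow> 0" by real_asymp
  have 1: "(\<lambda>N. (real (f N) + 1) / N) \<longlonglongrightarrow> F" if "(\<lambda>N. real (f N) / N) \<longlonglongrightarrow> F" for f :: "nat \<Rightarrow> nat" and F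
    using tendsto_add[OF that inv0] by (simp add: add_divide_distrib)
  have top: "filterlim f at_top sequentially" if f: "(\<lambda>N. real (f N) / N) \<longlonglongrightarrow> F" and "F > 0" for f :: "nat \<Rightarrow> nat" and F
  proof -
    have "filterlim (\<lambda>N. real (f N) / N * real N) at_top sequentially"
      by (rule filterlim_tendsto_pos_mult_at_top[OF f \<open>F > 0\<close> filterlim_real_sequentially])
    moreover have "\<forall>\<^sub>F N in sequentially. real (f N) / N * real N = real (f N)"
      using eventually_gt_at_top[of 0] by eventually_elim simp
    ultimately have "filterlim (\<lambda>N. real (f N)) at_top sequentially"
      by (simp cong: filterlim_cong)
    then show ?thesis by (simp add: filterlim_sequentially_iff_filterlim_real)
  qed
  have ee: "(\<lambda>N. e (f N)) \<longlonglongrightarrow> k" if "(\<lambda>N. real (f N) / N) \<longlonglongrightarrow> F" "F > 0" for f :: "nat \<Rightarrow> nat" and F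
    using filterlim_compose[OF e top[OF that]] .
  let ?r = "\<lambda>f N. (real (f N) + 1) / real N"
  have "(\<lambda>N. e (a N) * e (b N) / (e (c N) * e (d N)) * (?r c N * ?r d N / (?r a N * ?r b N)) powr (3/2))
     \<longlonglongrightarrow> k * k / (k * k) * (C * D / (A * B)) powr (3/2)"
    using k(1) pos by (intro tendsto_intros ee[OF lim(1)] ee[OF lim(2)] ee[OF lim(3)] ee[OF lim(4)]
       1[OF lim(1)] 1[OF lim(2)] 1[OF lim(3)] 1[OF lim(4)]) auto
  then have lim': "(\<lambda>N. e (a N) * e (b N) / (e (c N) * e (d N)) * (?r c N * ?r d N / (?r a N * ?r b N)) powr (3/2))
     \<longlonglongrightarrow> (C * D / (A * B)) powr (3/2)" using k(1) by simp
  have "\<forall>\<^sub>F N in sequentially. e (a N) * e (b N) / (e (c N) * e (d N)) * (?r c N * ?r d N / (?r a N * ?r b N)) powr (3/2)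
     = qq (a N) 0 * qq (b N) 0 / (qq (c N) 0 * qq (d N) 0)"
    using bal eventually_gt_at_top[of 0]
  proof eventually_elim
    case (elim N)
    let ?p = "\<lambda>f. (real (f N) + 1) powr (3/2)"
    have "?r c N * ?r d N / (?r a N * ?r b N) = (real (c N) + 1) * (real (d N) + 1) / ((real (a N) + 1) * (real (b N) + 1))"
      using elim by simp
    then have p: "(?r c N * ?r d N / (?r a N * ?r b N)) powr (3/2) = ?p c * ?p d / (?p a * ?p b)"
      by (simp add: powr_mult powr_divide)
    have ex: "exp (- real (a N)) * exp (- real (b N)) = exp (- real (c N)) * exp (- real (d N))"
      using elim(1) by (simp flip: exp_add of_nat_add)
    have "e (a N) * e (b N) = (qq (a N) 0 * qq (b N) 0) * (exp (- real (a N)) * exp (- real (b N))) * (?p a * ?p b)"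
      by (simp add: e_def)
    moreover have "e (c N) * e (d N) = (qq (c N) 0 * qq (d N) 0) * (exp (- real (c N)) * exp (- real (d N))) * (?p c * ?p d)"
      by (simp add: e_def)
    moreover have "?p a \<noteq> 0" "?p b \<noteq> 0" "?p c \<noteq> 0" "?p d \<noteq> 0"
      by (smt (verit) of_nat_0_le_iff powr_eq_0_iff)+
    ultimately show ?case unfolding p ex by simp
  qed
  with lim' show ?thesis by (rule Lim_transform_eventually)
qed

text \<open>Tilting by $e^{-l x^2}$ at time $t_m$ replaces the remaining duration $T - t_m$ by $\<sigma>$.\<close>
primrec Lap :: "nat \<Rightarrow> (nat \<Rightarrow> real) \<Rightarrow> (nat \<Rightarrow> real) \<Rightarrow> real \<Rightarrow> real" where
  "Lap 0 t l T = 1"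
| "Lap (Suc m) t l T = (let \<sigma> = 1 / (1 / (T - t m) + 2 * l m) in
     (T * \<sigma> / ((T - t m) * (t m + \<sigma>))) powr (3/2) * Lap m t l (t m + \<sigma>))"

lemma upto_dep_lap:
  assumes "\<And>j. j < m \<Longrightarrow> k j \<le> K"
  shows "upto_dep K (\<lambda>p. exp (- (\<Sum>j<m. l j * (real (cnt (k j) p - k j))\<^sup>2 / x)))"
  unfolding upto_dep_def using assms by (auto simp: cnt_filter intro!: sum.cong)

text \<open>\<open>\<sigma> = 1 / (1 / u + 2 * l)\<close> is the horizon for which the constant
  \<open>kappa\<close> of \<open>Rr_asymp\<close> equals the prescribed tilt
  \<open>l\<close>.\<close>

lemma tilted_time:
  assumes "u > 0" "l > (0::real)"
  shows "0 < 1 / (1 / u + 2 * l)" "1 / (1 / u + 2 * l) < u" "1 / (2 * (1 / (1 / u + 2 * l))) - 1 / (2 * u) = l"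
proof -
  have p: "1 + 2 * l * u > 0" using assms by (simp add: add_pos_pos)
  have e: "1 / (1 / u + 2 * l) = u / (1 + 2 * l * u)" using assms p by (simp add: divide_simps)
  show "0 < 1 / (1 / u + 2 * l)" using assms by (simp add: add_pos_pos)
  show "1 / (1 / u + 2 * l) < u" unfolding e using assms p by (simp add: divide_simps)
  show "1 / (2 * (1 / (1 / u + 2 * l))) - 1 / (2 * u) = l" unfolding e using assms p by (simp add: divide_simps)
qed

text \<open>Induction on the number of times with length and horizon left arbitrary, because
  \<open>PE_change\<close> removes the last time at the price of the new length
  \<open>k m N + v N\<close>. The quotient \<open>C N\<close> of the normalizations tends to the
  factor in the recursion of \<open>Lap\<close>.\<close>

theorem PE_Laplace:
  fixes k :: "nat \<Rightarrow> nat \<Rightarrow> nat" and n :: "nat \<Rightarrow> nat"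
  assumes "(\<lambda>N. real (n N) / N) \<longlonglongrightarrow> T" "T > 0"
    and "\<And>j. j < m \<Longrightarrow> (\<lambda>N. real (k j N) / N) \<longlonglongrightarrow> t j"
    and "\<And>j. j < m \<Longrightarrow> 0 < t j" "\<And>j. j < m \<Longrightarrow> t j < T" "\<And>i j. i < j \<Longrightarrow> j < m \<Longrightarrow> t i < t j"
    and "\<And>j. j < m \<Longrightarrow> l j \<ge> 0"
  shows "(\<lambda>N. PE (n N) (\<lambda>p. exp (- (\<Sum>j<m. l j * (real (cnt (k j N) p - k j N))\<^sup>2 / N)))) \<longlonglongrightarrow> Lap m t l T"
  using assms
proof (induction m arbitrary: n T)
  case 0
  have "PE n (\<lambda>_. 1) = 1" for n using card_PF_pos[of n] by (simp add: PE_def)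
  then show ?case by simp
next
  case (Suc m)
  define G where "G N p = exp (- (\<Sum>j<m. l j * (real (cnt (k j N) p - k j N))\<^sup>2 / real N))" for N p
  have split: "exp (- (\<Sum>j<Suc m. l j * (real (cnt (k j N) p - k j N))\<^sup>2 / real N)) =
     G N p * exp (- l m * (real (cnt (k m N) p - k m N))\<^sup>2 / N)" for N p
    by (simp add: G_def flip: exp_add)
  have t: "0 < t m" "t m < T" using Suc.prems by auto
  have kk: "\<forall>\<^sub>F N in sequentially. k j N \<le> k m N" if "j < m" for j
  proof -
    have "(\<lambda>N. real (k m N) / N - real (k j N) / N) \<longlonglongrightarrow> t m - t j"
      using Suc.prems(3) that by (intro tendsto_diff) auto
    from order_tendstoD(1)[OF this, of 0]
    have "\<forall>\<^sub>F N in sequentially. real (k m N) / N - real (k j N) / N > 0"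
      using Suc.prems(6)[of j m] that by simp
    then show ?thesis using eventually_gt_at_top[of 0]
      by eventually_elim (simp add: divide_simps)
  qed
  have ev_k: "\<forall>\<^sub>F N in sequentially. \<forall>j<m. k j N \<le> k m N"
  proof -
    have "\<forall>\<^sub>F N in sequentially. \<forall>j\<in>{..<m}. k j N \<le> k m N"
      by (rule eventually_ball_finite) (use kk in auto)
    then show ?thesis by (rule eventually_mono) simp
  qed
  have km: "(\<lambda>N. real (k m N) / N) \<longlonglongrightarrow> t m" using Suc.prems(3) by auto
  have ev_n: "\<forall>\<^sub>F N in sequentially. k m N \<le> n N"
  proof -
    have "(\<lambda>N. real (n N) / N - real (k m N) / N) \<longlonglongrightarrow> T - t m"
      using Suc.prems(1) km by (intro tendsto_diff) auto
    from order_tendstoD(1)[OF this, of 0]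
    have "\<forall>\<^sub>F N in sequentially. real (n N) / N - real (k m N) / N > 0" using t by simp
    then show ?thesis using eventually_gt_at_top[of 0]
      by eventually_elim (simp add: divide_simps)
  qed
  show ?case
  proof (cases "l m = 0")
    \<comment> \<open>Without a tilt \<sigma> is \<open>T - t m\<close>, so the horizon stays and
      the factor is 1. This is separate because \<open>Rr_asymp\<close> compares with a strictly
      shorter horizon.\<close>
    case True
    have "(\<lambda>N. PE (n N) (G N)) \<longlonglongrightarrow> Lap m t l T"
      unfolding G_def using Suc.prems by (intro Suc.IH) auto
    moreover have "Lap (Suc m) t l T = Lap m t l T"
      using t True Suc.prems(2) by (simp add: Let_def)
    ultimately show ?thesis unfolding split using True by simp
  next
    case False
    then have lm: "l m > 0" using Suc.prems(7)[of m] by simp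
    define \<sigma> where "\<sigma> = 1 / (1 / (T - t m) + 2 * l m)"
    have \<sigma>: "0 < \<sigma>" "\<sigma> < T - t m" and lm_eq: "1 / (2 * \<sigma>) - 1 / (2 * (T - t m)) = l m"
      using tilted_time[of "T - t m" "l m"] t lm by (auto simp: \<sigma>_def)
    define v where "v N = nat \<lfloor>\<sigma> * real N\<rfloor>" for N
    have v: "(\<lambda>N. real (v N) / N) \<longlonglongrightarrow> \<sigma>" unfolding v_def using \<sigma>(1) by real_asymp
    have w: "(\<lambda>N. real (n N - k m N) / N) \<longlonglongrightarrow> T - t m"
    proof -
      have "(\<lambda>N. real (n N) / N - real (k m N) / N) \<longlonglongrightarrow> T - t m"
        using Suc.prems(1) km by (intro tendsto_diff) auto
      moreover have "\<forall>\<^sub>F N in sequentially. real (n N) / N - real (k m N) / N = real (n N - k m N) / N"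
        using ev_n by eventually_elim (simp add: of_nat_diff diff_divide_distrib)
      ultimately show ?thesis by (rule Lim_transform_eventually)
    qed
    have kv: "(\<lambda>N. real (k m N + v N) / N) \<longlonglongrightarrow> t m + \<sigma>"
      using tendsto_add[OF km v] by (simp add: add_divide_distrib)
    define C where "C N = qq (n N - k m N) 0 * qq (k m N + v N) 0 / (qq (v N) 0 * qq (n N) 0)" for N
    have C: "C \<longlonglongrightarrow> (\<sigma> * T / ((T - t m) * (t m + \<sigma>))) powr (3/2)"
      unfolding C_def by (rule qq_ratio_limit[OF w kv v Suc.prems(1)])
        (use t \<sigma> Suc.prems(2) ev_n in \<open>auto elim!: eventually_mono\<close>)
    have tj: "t j < t m + \<sigma>" if "j < m" for j using Suc.prems(6)[of j m] \<sigma> that by simp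
    have "0 < t m + \<sigma>" using t \<sigma> by simp
    then have IH: "(\<lambda>N. PE (k m N + v N) (G N)) \<longlonglongrightarrow> Lap m t l (t m + \<sigma>)"
      unfolding G_def by (rule Suc.IH[OF kv]) (use Suc.prems tj in auto)
    have "(\<lambda>N. PE (n N) (\<lambda>p. G N p * exp (- l m * (real (cnt (k m N) p - k m N))\<^sup>2 / N)) - C N * PE (k m N + v N) (G N)) \<longlonglongrightarrow> 0"
    proof (rule tendstoI)
      fix \<epsilon> :: real assume "\<epsilon> > 0"
      then have "\<epsilon> / 2 > 0" by simp
      show "\<forall>\<^sub>F N in sequentially. dist (PE (n N) (\<lambda>p. G N p * exp (- l m * (real (cnt (k m N) p - k m N))\<^sup>2 / N)) - C N * PE (k m N + v N) (G N)) 0 < \<epsilon>"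
        using Rr_asymp[OF v w \<sigma> \<open>\<epsilon> / 2 > 0\<close>, unfolded lm_eq] ev_k ev_n
      proof eventually_elim
        case (elim N)
        have "\<bar>PE (n N) (\<lambda>p. G N p * exp (- l m * (real (cnt (k m N) p - k m N))\<^sup>2 / N)) - C N * PE (k m N + v N) (G N)\<bar> \<le> \<epsilon> / 2"
          unfolding C_def
        proof (rule PE_change[where g="\<lambda>a. exp (- l m * (real a)\<^sup>2 / N)"])
          show "upto_dep (k m N) (G N)" unfolding G_def using elim by (intro upto_dep_lap) auto
          show "\<bar>G N p\<bar> \<le> 1" for p unfolding G_def
            using Suc.prems(7) by (auto intro!: sum_nonneg divide_nonneg_nonneg)
        qed (use elim in auto)
        then show ?case using \<open>\<epsilon> > 0\<close> by (simp add: dist_real_def)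
      qed
    qed
    from tendsto_add[OF this tendsto_mult[OF C IH]]
    show ?thesis unfolding split by (simp add: Let_def \<sigma>_def mult.commute)
  qed
qed

section \<open>Gaussian integrals for the excursion densities\<close>

text \<open>Completing the square. The second factor on the right is the law at time
  \<open>s\<close> of a Brownian bridge from \<open>x\<close> to 0 of duration
  \<open>s + v\<close>.\<close>

lemma normal_density_mult:
  assumes "s > 0" "v > 0"
  shows "normal_density x (sqrt s) y * normal_density 0 (sqrt v) y =
    normal_density 0 (sqrt (s + v)) x * normal_density (x * v / (s + v)) (sqrt (s * v / (s + v))) y"
proof -
  have pos: "s + v > 0" using assms by simp
  have e: "- (y - x)\<^sup>2 / (2 * s) + - y\<^sup>2 / (2 * v) = - x\<^sup>2 / (2 * (s + v)) + - (y - x * v / (s + v))\<^sup>2 / (2 * (s * v / (s + v)))"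
  proof -
    define u where "u = s + v"
    have u: "u > 0" using pos by (simp add: u_def)
    have poly: "u * (v * (y - x)\<^sup>2 + s * y\<^sup>2) = s * v * x\<^sup>2 + (y * u - x * v)\<^sup>2"
      by (simp add: u_def power2_eq_square algebra_simps)
    have "A / (2 * s) + B / (2 * v) = u * (v * A + s * B) / (2 * s * v * u)" for A B
      using assms u by (simp add: field_simps)
    then have "(y - x)\<^sup>2 / (2 * s) + y\<^sup>2 / (2 * v) = (s * v * x\<^sup>2 + (y * u - x * v)\<^sup>2) / (2 * s * v * u)"
      unfolding poly[symmetric] .
    also have "\<dots> = x\<^sup>2 / (2 * u) + ((y * u - x * v) / u)\<^sup>2 / (2 * (s * v / u))"
    proof -
      have "(s * v * C + D) / (2 * s * v * u) = C / (2 * u) + D / u\<^sup>2 / (2 * (s * v / u))" for C D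
        using assms u by (simp add: field_simps power2_eq_square)
      then show ?thesis by (simp add: power_divide)
    qed
    also have "(y * u - x * v) / u = y - x * v / u" using u by (simp add: field_simps)
    finally show ?thesis unfolding u_def by simp
  qed
  have r: "sqrt (2 * pi * s) * sqrt (2 * pi * v) = sqrt (2 * pi * (s + v)) * sqrt (2 * pi * (s * v / (s + v)))"
    unfolding real_sqrt_mult[symmetric] using pos by (intro arg_cong[where f=sqrt]) simp
  have "normal_density x (sqrt s) y * normal_density 0 (sqrt v) y =
     (1 / (sqrt (2 * pi * s) * sqrt (2 * pi * v))) * exp (- (y - x)\<^sup>2 / (2 * s) + - y\<^sup>2 / (2 * v))"
    using assms by (simp only: exp_add) (simp add: normal_density_def)
  also have "\<dots> = normal_density 0 (sqrt (s + v)) x * normal_density (x * v / (s + v)) (sqrt (s * v / (s + v))) y"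
    unfolding e r exp_add using assms pos by (simp add: normal_density_def)
  finally show ?thesis .
qed

lemma exc_entr_eq: "t > 0 \<Longrightarrow> exc_entr t y = y / t * normal_density 0 (sqrt t) y"
  by (simp add: exc_entr_def normal_density_def real_sqrt_mult power3_eq_cube)

lemma exc_kill_eq: "t > 0 \<Longrightarrow> exc_kill t x y = normal_density x (sqrt t) y - normal_density x (sqrt t) (- y)"
proof -
  assume "t > 0"
  moreover have "(x - y)\<^sup>2 = (y - x)\<^sup>2" "(x + y)\<^sup>2 = (- y - x)\<^sup>2" by (simp_all add: power2_eq_square algebra_simps)
  ultimately show ?thesis unfolding exc_kill_def normal_density_def by (simp add: diff_divide_distrib)
qed

lemma exc_entr_nonneg: "t > 0 \<Longrightarrow> y \<ge> 0 \<Longrightarrow> exc_entr t y \<ge> 0"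
  by (simp add: exc_entr_def)

lemma exc_kill_nonneg: "t > 0 \<Longrightarrow> x \<ge> 0 \<Longrightarrow> y \<ge> 0 \<Longrightarrow> exc_kill t x y \<ge> 0"
  unfolding exc_kill_def by (auto intro!: divide_nonneg_nonneg divide_right_mono simp: power2_eq_square algebra_simps)

text \<open>Integral form of the reflection principle: \<open>exc_kill\<close> is a difference of
  two reflected Gaussian kernels and \<open>exc_entr\<close> is odd in the space variable, so a
  half-line integral of their product unfolds to an integral over the whole line.\<close>

lemma half_line_integral:
  fixes f :: "real \<Rightarrow> real"
  assumes f: "has_bochner_integral lborel f I"
  shows "has_bochner_integral lborel (\<lambda>y. if y > 0 then f y + f (- y) else 0) I"
proof -
  have i: "integrable lborel f" and I: "integral\<^sup>L lborel f = I" using f by (auto simp: has_bochner_integral_iff)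
  have i': "integrable lborel (\<lambda>y. f (- y))"
    using lborel_integrable_real_affine[OF i, of "-1" 0] by simp
  let ?p = "\<lambda>y. indicator {0<..} y *\<^sub>R f y" and ?q = "\<lambda>y. indicator {0<..} y *\<^sub>R f (- y)"
  have p: "integrable lborel ?p" using i by (intro integrable_mult_indicator) auto
  have q: "integrable lborel ?q" using i' by (intro integrable_mult_indicator) auto
  have q': "integral\<^sup>L lborel ?q = (\<integral>y. indicator {..<0} y *\<^sub>R f y \<partial>lborel)"
    by (subst lborel_integral_real_affine[of "-1" _ 0]) (auto simp: indicator_def intro!: Bochner_Integration.integral_cong)
  have "integral\<^sup>L lborel f = (\<integral>y. ?p y + indicator {..<0} y *\<^sub>R f y \<partial>lborel)"
    by (rule integral_cong_AE) (use i in \<open>auto intro!: AE_I[of _ _ "{0}"] simp: indicator_def\<close>)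
  also have "\<dots> = integral\<^sup>L lborel ?p + integral\<^sup>L lborel ?q"
    unfolding q' using p i by (intro Bochner_Integration.integral_add integrable_mult_indicator) auto
  also have "\<dots> = (\<integral>y. ?p y + ?q y \<partial>lborel)" using p q by simp
  finally have eq: "(\<integral>y. ?p y + ?q y \<partial>lborel) = I" using I by simp
  have "(\<lambda>y. if y > 0 then f y + f (- y) else 0) = (\<lambda>y. ?p y + ?q y)" by (auto simp: indicator_def)
  then show ?thesis using eq p q by (simp add: has_bochner_integral_iff)
qed

lemma nn_integral_of_hbi:
  assumes "has_bochner_integral M f I" "\<And>x. f x \<ge> 0"
  shows "(\<integral>\<^sup>+x. ennreal (f x) \<partial>M) = ennreal I"
  using assms by (simp add: has_bochner_integral_iff nn_integral_eq_integral)

lemma exc_entr_minus: "exc_entr t (- y) = - exc_entr t y"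
  by (simp add: exc_entr_def)

text \<open>\<open>exc_entr t y\<close> is the density at time \<open>t\<close> of the first passage
  from \<open>y\<close> to 0, so this is the Markov property of killed Brownian motion. After
  unfolding, the integral is the mean of the bridge law in
  \<open>normal_density_mult\<close>.\<close>

lemma exc_kill_entr:
  assumes "s > 0" "v > 0" "x > 0"
  shows "(\<integral>\<^sup>+y. ennreal (if y > 0 then exc_kill s x y * exc_entr v y else 0) \<partial>lborel) = ennreal (exc_entr (s + v) x)"
proof -
  let ?f = "\<lambda>y. normal_density x (sqrt s) y * exc_entr v y"
  let ?m = "x * v / (s + v)" and ?d = "sqrt (s * v / (s + v))"
  have "has_bochner_integral lborel (\<lambda>y. (1 / v * normal_density 0 (sqrt (s + v)) x) * (normal_density ?m ?d y * y)) ((1 / v * normal_density 0 (sqrt (s + v)) x) * ?m)"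
    using assms by (intro has_bochner_integral_mult_right normal_moment_nz_1) (auto intro!: divide_pos_pos mult_pos_pos)
  moreover have "(1 / v * normal_density 0 (sqrt (s + v)) x) * (normal_density ?m ?d y * y) = ?f y" for y
    using normal_density_mult[OF assms(1,2), of x y] assms by (simp add: exc_entr_eq algebra_simps)
  moreover have "(1 / v * normal_density 0 (sqrt (s + v)) x) * ?m = exc_entr (s + v) x"
    using assms by (simp add: exc_entr_eq)
  ultimately have "has_bochner_integral lborel ?f (exc_entr (s + v) x)" by simp
  from half_line_integral[OF this]
  moreover have "(\<lambda>y. if y > 0 then ?f y + ?f (- y) else 0) = (\<lambda>y. if y > 0 then exc_kill s x y * exc_entr v y else 0)"
    using assms by (intro ext) (simp add: exc_kill_eq exc_entr_minus left_diff_distrib)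
  ultimately have "has_bochner_integral lborel (\<lambda>y. if y > 0 then exc_kill s x y * exc_entr v y else 0) (exc_entr (s + v) x)"
    by simp
  then show ?thesis using assms by (intro nn_integral_of_hbi) (auto intro!: mult_nonneg_nonneg exc_kill_nonneg exc_entr_nonneg)
qed

text \<open>Here the unfolded integral is a second moment. For total time 1 the value is the
  reciprocal of \<open>2 * sqrt (2 * pi)\<close>, which explains the normalizing factor in
  \<open>exc_dens\<close>.\<close>

lemma exc_entr_entr:
  assumes "s > 0" "v > 0"
  shows "(\<integral>\<^sup>+y. ennreal (if y > 0 then exc_entr s y * exc_entr v y else 0) \<partial>lborel) = ennreal (1 / (2 * sqrt (2 * pi)) * (s + v) powr (- 3/2))"
proof -
  let ?f = "\<lambda>y. exc_entr s y * exc_entr v y / 2"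
  let ?d = "sqrt (s * v / (s + v))"
  have dp: "?d > 0" using assms by (auto intro!: divide_pos_pos mult_pos_pos)
  define c where "c = 1 / (2 * s * v) * normal_density 0 (sqrt (s + v)) 0"
  have hb: "has_bochner_integral lborel (\<lambda>y. c * (normal_density 0 ?d y * (y - 0) ^ (2 * 1))) (c * (fact (2 * 1) / ((2 / ?d\<^sup>2) ^ 1 * fact 1)))"
    using dp by (intro has_bochner_integral_mult_right normal_moment_even)
  have fy: "c * (normal_density 0 ?d y * (y - 0) ^ (2 * 1)) = ?f y" for y
    using normal_density_mult[OF assms(1,2), of 0 y] assms by (simp add: exc_entr_eq c_def power2_eq_square) (simp add: algebra_simps)
  have cc: "c * (fact (2 * 1) / ((2 / ?d\<^sup>2) ^ 1 * fact 1)) = 1 / (2 * sqrt (2 * pi)) * (s + v) powr (- 3/2)"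
  proof -
    have "(s + v) powr (- 3/2) = 1 / ((s + v) * sqrt (s + v))"
    proof -
      have "(s + v) powr (- 3/2) = (s + v) powr (- 1 + - (1/2))" by simp
      also have "\<dots> = (s + v) powr (-1) * (s + v) powr (- (1/2))" by (rule powr_add)
      finally show ?thesis using assms by (simp add: powr_minus powr_half_sqrt divide_simps)
    qed
    moreover have "?d\<^sup>2 = s * v / (s + v)" using assms by simp
    moreover have "normal_density 0 (sqrt (s + v)) 0 = 1 / (sqrt (2 * pi) * sqrt (s + v))"
      using assms by (simp add: normal_density_def real_sqrt_mult)
    moreover have "1 / (2 * s * v) * (1 / (q * r)) * (s * v / u) = 1 / (2 * q) * (1 / (u * r))" for q r u :: real
      using assms by simp
    ultimately show ?thesis using assms by (simp add: c_def)
  qed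
  have "has_bochner_integral lborel ?f (1 / (2 * sqrt (2 * pi)) * (s + v) powr (- 3/2))"
    using hb unfolding fy cc .
  from half_line_integral[OF this]
  have "has_bochner_integral lborel (\<lambda>y. if y > 0 then exc_entr s y * exc_entr v y else 0) (1 / (2 * sqrt (2 * pi)) * (s + v) powr (- 3/2))"
    by (simp add: exc_entr_minus cong: if_cong)
  then show ?thesis using assms by (intro nn_integral_of_hbi) (auto intro!: mult_nonneg_nonneg exc_entr_nonneg)
qed

text \<open>\<open>exc_dens\<close> without its normalizing constant and with final time
  \<open>T\<close> instead of 1, since the horizon changes in the induction of
  \<open>edens_Laplace\<close>.\<close>

definition edens :: "nat \<Rightarrow> (nat \<Rightarrow> real) \<Rightarrow> real \<Rightarrow> (nat \<Rightarrow> real) \<Rightarrow> real" where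
  "edens m t T x = (if \<forall>i<m. x i > 0 then exc_entr (t 0) (x 0) *
     (\<Prod>i<m - 1. exc_kill (t (i+1) - t i) (x i) (x (i+1))) * exc_entr (T - t (m-1)) (x (m-1)) else 0)"

text \<open>The two Gaussian exponents add up to one with duration \<sigma>. This is the exact
  counterpart of the asymptotic change of horizon in \<open>PE_change\<close>.\<close>

lemma exc_entr_tilt:
  assumes "u > 0" "l \<ge> 0" 
  defines "\<sigma> \<equiv> 1 / (1 / u + 2 * l)"
  shows "exc_entr u y * exp (- l * y\<^sup>2) = (\<sigma> / u) powr (3/2) * exc_entr \<sigma> y"
proof -
  have \<sigma>: "\<sigma> > 0" using assms by (auto simp: add_pos_nonneg)
  have e: "- (y\<^sup>2) / (2 * u) + - l * y\<^sup>2 = - (y\<^sup>2) / (2 * \<sigma>)"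
    using assms by (simp add: \<sigma>_def algebra_simps)
  have p: "(\<sigma> / u) powr (3/2) = sqrt (\<sigma>^3) / sqrt (u^3)"
  proof -
    have "(\<sigma> / u) powr (3/2) = ((\<sigma> / u) powr 3) powr (1/2)" by (simp add: powr_powr)
    also have "(\<sigma> / u) powr 3 = (\<sigma> / u) ^ 3" using \<sigma> assms(1) powr_realpow[of "\<sigma>/u" 3] by simp
    also have "((\<sigma> / u) ^ 3) powr (1/2) = sqrt ((\<sigma> / u) ^ 3)" using \<sigma> assms(1) by (intro powr_half_sqrt) simp
    finally show ?thesis by (simp add: power_divide real_sqrt_divide)
  qed
  have "exc_entr u y * exp (- l * y\<^sup>2) = y / sqrt (2 * pi * u^3) * exp (- (y\<^sup>2) / (2 * u) + - l * y\<^sup>2)"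
    by (simp only: exc_entr_def exp_add mult.assoc)
  also have "\<dots> = (\<sigma> / u) powr (3/2) * exc_entr \<sigma> y"
    unfolding e p exc_entr_def using \<sigma> assms(1) by (simp add: real_sqrt_mult)
  finally show ?thesis .
qed

lemma measurable_exc [measurable]:
  assumes [measurable]: "f \<in> borel_measurable M" "g \<in> borel_measurable M"
  shows "(\<lambda>x. exc_entr t (f x)) \<in> borel_measurable M"
    and "(\<lambda>x. exc_kill t (f x) (g x)) \<in> borel_measurable M"
  unfolding exc_entr_def exc_kill_def by measurable

lemma measurable_edens [measurable]:
  "m \<ge> 1 \<Longrightarrow> edens m t T \<in> borel_measurable (Pi\<^sub>M {..<m} (\<lambda>_. lborel))"
  unfolding edens_def[abs_def] by measurable

lemma edens_nonneg:
  assumes "m \<ge> 1" "0 < t 0" "\<And>i. Suc i < m \<Longrightarrow> t i < t (Suc i)" "t (m - 1) < T"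
  shows "edens m t T x \<ge> 0"
proof (cases "\<forall>i<m. x i > 0")
  case True
  have "(\<Prod>i<m - 1. exc_kill (t (i+1) - t i) (x i) (x (i+1))) \<ge> 0"
    using assms True by (intro prod_nonneg) (auto intro!: exc_kill_nonneg simp: less_imp_le)
  moreover have "exc_entr (t 0) (x 0) \<ge> 0" "exc_entr (T - t (m-1)) (x (m-1)) \<ge> 0"
    using assms True by (auto intro!: exc_entr_nonneg simp: less_imp_le)
  ultimately show ?thesis using True by (simp add: edens_def)
next
  case False
  then show ?thesis unfolding edens_def by (subst if_not_P) auto
qed

lemma Lap_const:
  assumes "T > 0" "\<sigma> > 0" "u > 0" "w > (0::real)"
  shows "(T * \<sigma> / (u * w)) powr (3/2) * L * T powr (- 3/2) = (\<sigma> / u) powr (3/2) * (L * w powr (- 3/2))"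
proof -
  have "T powr (3/2) * T powr (- 3/2) = 1" using assms by (simp flip: powr_add)
  moreover have "w powr (- 3/2) = 1 / w powr (3/2)" using powr_minus_divide[of w "3/2"] by simp
  ultimately show ?thesis using assms by (simp add: powr_mult powr_divide)
qed

text \<open>Integrate out the last coordinate: the tilt turns the final passage density into that of
  duration \<sigma>, \<open>exc_kill_entr\<close> absorbs the last kernel, and the density with
  horizon \<open>t m + \<sigma>\<close> remains, exactly as in \<open>Lap\<close>. At
  \<open>m = 1\<close> the recursion is closed by \<open>exc_entr_entr\<close>.\<close>

lemma edens_Laplace:
  assumes "m \<ge> 1" "0 < t 0" "\<And>i. Suc i < m \<Longrightarrow> t i < t (Suc i)" "t (m - 1) < T" "\<And>i. i < m \<Longrightarrow> l i \<ge> 0"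
  shows "(\<integral>\<^sup>+x. ennreal (edens m t T x * exp (- (\<Sum>i<m. l i * (x i)\<^sup>2))) \<partial>(Pi\<^sub>M {..<m} (\<lambda>_. lborel))) =
    ennreal (Lap m t l T * T powr (- 3/2) / (2 * sqrt (2 * pi)))"
  using assms
proof (induction m arbitrary: T rule: nat_induct_at_least)
  case base
  define \<sigma> where "\<sigma> = 1 / (1 / (T - t 0) + 2 * l 0)"
  have t: "t 0 > 0" "T - t 0 > 0" using base by auto
  have l: "l 0 \<ge> 0" using base by auto
  have \<sigma>: "\<sigma> > 0" using t l by (auto simp: \<sigma>_def add_pos_nonneg)
  interpret product_sigma_finite "\<lambda>_::nat. lborel :: real measure" ..
  have I: "{..<1} = {0::nat}" by auto
  have "(\<integral>\<^sup>+x. ennreal (edens 1 t T x * exp (- (\<Sum>i<1. l i * (x i)\<^sup>2))) \<partial>(Pi\<^sub>M {..<1} (\<lambda>_. lborel))) =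
     (\<integral>\<^sup>+x. (\<lambda>y. ennreal ((\<sigma> / (T - t 0)) powr (3/2)) * ennreal (if y > 0 then exc_entr (t 0) y * exc_entr \<sigma> y else 0)) (x 0) \<partial>(Pi\<^sub>M {0::nat} (\<lambda>_. lborel)))"
    unfolding I
  proof (rule nn_integral_cong)
    fix x :: "nat \<Rightarrow> real"
    show "ennreal (edens 1 t T x * exp (- (\<Sum>i\<in>{0}. l i * (x i)\<^sup>2))) =
      ennreal ((\<sigma> / (T - t 0)) powr (3/2)) * ennreal (if x 0 > 0 then exc_entr (t 0) (x 0) * exc_entr \<sigma> (x 0) else 0)"
      using exc_entr_tilt[OF t(2) l, of "x 0"]
      by (simp add: edens_def \<sigma>_def[symmetric] mult.assoc mult.left_commute flip: ennreal_mult')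
  qed
  also have "\<dots> = (\<integral>\<^sup>+y. ennreal ((\<sigma> / (T - t 0)) powr (3/2)) * ennreal (if y > 0 then exc_entr (t 0) y * exc_entr \<sigma> y else 0) \<partial>lborel)"
    by (rule product_nn_integral_singleton) measurable
  also have "\<dots> = ennreal ((\<sigma> / (T - t 0)) powr (3/2)) * ennreal (1 / (2 * sqrt (2 * pi)) * (t 0 + \<sigma>) powr (- 3/2))"
    by (subst nn_integral_cmult) (simp_all add: exc_entr_entr[OF t(1) \<sigma>])
  also have "\<dots> = ennreal (Lap 1 t l T * T powr (- 3/2) / (2 * sqrt (2 * pi)))"
    using Lap_const[of T \<sigma> "T - t 0" "t 0 + \<sigma>" 1] t \<sigma>
    by (simp add: Let_def \<sigma>_def[symmetric] flip: ennreal_mult')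
  finally show ?case .
next
  case (Suc m)
  define \<sigma> where "\<sigma> = 1 / (1 / (T - t m) + 2 * l m)"
  obtain m' where m': "m = Suc m'" using Suc.hyps by (cases m) auto
  have t: "t m' < t m" "T - t m > 0" using Suc.prems(2)[of m'] Suc.prems(3) m' by auto
  have l: "l m \<ge> 0" using Suc.prems by auto
  have \<sigma>: "\<sigma> > 0" using t l by (auto simp: \<sigma>_def add_pos_nonneg)
  interpret product_sigma_finite "\<lambda>_::nat. lborel :: real measure" ..
  let ?c = "(\<sigma> / (T - t m)) powr (3/2)"
  have I: "{..<Suc m} = insert m {..<m}" by auto
  have "(\<integral>\<^sup>+x. ennreal (edens (Suc m) t T x * exp (- (\<Sum>i<Suc m. l i * (x i)\<^sup>2))) \<partial>(Pi\<^sub>M {..<Suc m} (\<lambda>_. lborel))) =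
     (\<integral>\<^sup>+x. (\<integral>\<^sup>+y. ennreal (edens (Suc m) t T (x(m := y)) * exp (- (\<Sum>i<Suc m. l i * ((x(m := y)) i)\<^sup>2))) \<partial>lborel) \<partial>(Pi\<^sub>M {..<m} (\<lambda>_. lborel)))"
    unfolding I by (subst product_nn_integral_insert) (auto simp flip: I)
  also have "\<dots> = (\<integral>\<^sup>+x. ennreal ?c * ennreal (edens m t (t m + \<sigma>) x * exp (- (\<Sum>i<m. l i * (x i)\<^sup>2))) \<partial>(Pi\<^sub>M {..<m} (\<lambda>_. lborel)))"
  proof (rule nn_integral_cong)
    fix x :: "nat \<Rightarrow> real"
    let ?E = "exp (- (\<Sum>i<m. l i * (x i)\<^sup>2))"
    show "(\<integral>\<^sup>+y. ennreal (edens (Suc m) t T (x(m := y)) * exp (- (\<Sum>i<Suc m. l i * ((x(m := y)) i)\<^sup>2))) \<partial>lborel)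
      = ennreal ?c * ennreal (edens m t (t m + \<sigma>) x * ?E)"
    proof (cases "\<forall>i<m. x i > 0")
      case False
      then have "edens (Suc m) t T (x(m := y)) = 0" "edens m t (t m + \<sigma>) x = 0" for y
        by (auto simp: edens_def less_Suc_eq)
      then show ?thesis by simp
    next
      case True
      define P where "P = exc_entr (t 0) (x 0) * (\<Prod>i<m'. exc_kill (t (i+1) - t i) (x i) (x (i+1))) * ?E"
      have P: "P \<ge> 0" unfolding P_def using True Suc.prems m'
        by (auto intro!: mult_nonneg_nonneg prod_nonneg exc_entr_nonneg exc_kill_nonneg simp: less_imp_le)
      have xm: "x m' > 0" using True m' by simp
      have pos: "(\<forall>i<Suc m. (x(m := y)) i > 0) = (y > 0)" for y using True by (auto simp: less_Suc_eq)
      have "edens (Suc m) t T (x(m := y)) * exp (- (\<Sum>i<Suc m. l i * ((x(m := y)) i)\<^sup>2)) =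
         (P * ?c) * (if y > 0 then exc_kill (t m - t m') (x m') y * exc_entr \<sigma> y else 0)" for y
      proof -
        have "(\<Prod>i<m. exc_kill (t (i+1) - t i) ((x(m := y)) i) ((x(m := y)) (i+1))) =
          (\<Prod>i<m'. exc_kill (t (i+1) - t i) (x i) (x (i+1))) * exc_kill (t m - t m') (x m') y"
          by (simp add: m')
        moreover have "exp (- (\<Sum>i<Suc m. l i * ((x(m := y)) i)\<^sup>2)) = ?E * exp (- l m * y\<^sup>2)"
          by (simp flip: exp_add)
        moreover have "exc_entr (T - t m) y * exp (- l m * y\<^sup>2) = ?c * exc_entr \<sigma> y"
          using exc_entr_tilt[OF t(2) l, of y] by (simp add: \<sigma>_def)
        ultimately show ?thesis unfolding edens_def pos P_def using m' by (simp add: mult_ac)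
      qed
      then have "(\<integral>\<^sup>+y. ennreal (edens (Suc m) t T (x(m := y)) * exp (- (\<Sum>i<Suc m. l i * ((x(m := y)) i)\<^sup>2))) \<partial>lborel)
         = (\<integral>\<^sup>+y. ennreal (P * ?c) * ennreal (if y > 0 then exc_kill (t m - t m') (x m') y * exc_entr \<sigma> y else 0) \<partial>lborel)"
        using P by (simp add: ennreal_mult')
      also have "\<dots> = ennreal (P * ?c) * ennreal (exc_entr (t m - t m' + \<sigma>) (x m'))"
        using t \<sigma> xm by (subst nn_integral_cmult) (simp_all add: exc_kill_entr)
      also have "\<dots> = ennreal ?c * ennreal (edens m t (t m + \<sigma>) x * ?E)"
      proof -
        have "edens m t (t m + \<sigma>) x * ?E = P * exc_entr (t m - t m' + \<sigma>) (x m')"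
          using True m' by (simp add: edens_def P_def algebra_simps)
        then show ?thesis using P by (simp add: ennreal_mult' mult_ac)
      qed
      finally show ?thesis .
    qed
  qed
  also have "\<dots> = ennreal ?c * ennreal (Lap m t l (t m + \<sigma>) * (t m + \<sigma>) powr (- 3/2) / (2 * sqrt (2 * pi)))"
  proof -
    have IH: "(\<integral>\<^sup>+x. ennreal (edens m t (t m + \<sigma>) x * exp (- (\<Sum>i<m. l i * (x i)\<^sup>2))) \<partial>(Pi\<^sub>M {..<m} (\<lambda>_. lborel))) =
      ennreal (Lap m t l (t m + \<sigma>) * (t m + \<sigma>) powr (- 3/2) / (2 * sqrt (2 * pi)))"
    proof (rule Suc.IH)
      show "t (m - 1) < t m + \<sigma>" using t \<sigma> m' by simp
    qed (use Suc.prems in auto)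
    have [measurable]: "edens m t (t m + \<sigma>) \<in> borel_measurable (Pi\<^sub>M {..<m} (\<lambda>_. lborel))"
      using Suc.hyps by (rule measurable_edens)
    show ?thesis by (subst nn_integral_cmult) (measurable, simp only: IH)
  qed
  also have "\<dots> = ennreal (Lap (Suc m) t l T * T powr (- 3/2) / (2 * sqrt (2 * pi)))"
  proof -
    have "t m > 0"
    proof -
      have inc: "t i \<le> t (Suc i)" if "Suc i \<le> m" for i using Suc.prems(2)[of i] that by simp
      have "i \<le> m \<Longrightarrow> t 0 \<le> t i" for i
        by (induction i) (use inc in \<open>auto intro: order.trans\<close>)
      then show ?thesis using Suc.prems(1) by (meson le_refl order_less_le_trans)
    qed
    then have h: "(T * \<sigma> / ((T - t m) * (t m + \<sigma>))) powr (3/2) * Lap m t l (t m + \<sigma>) * T powr (- 3/2)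
      = (\<sigma> / (T - t m)) powr (3/2) * (Lap m t l (t m + \<sigma>) * (t m + \<sigma>) powr (- 3/2))"
      using t \<sigma> by (intro Lap_const) auto
    show ?thesis unfolding Lap.simps Let_def \<sigma>_def[symmetric] h by (simp flip: ennreal_mult')
  qed
  finally show ?case .
qed

section \<open>Finite-dimensional convergence\<close>

lemma exc_dens_eq:
  "m \<ge> 1 \<Longrightarrow> exc_dens (map t [0..<m]) x = 2 * sqrt (2 * pi) * edens m t 1 x"
  by (simp add: exc_dens_def edens_def Let_def) blast

lemma Lap_nonneg: "Lap m t l T \<ge> 0"
  by (induction m arbitrary: T) (simp_all add: Let_def)

lemma measurable_coord:
  assumes "space M = Dsp" "sets M = D_sets"
  shows "(\<lambda>f. f t) \<in> borel_measurable M"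
proof (rule measurableI)
  fix B :: "real set" assume "B \<in> sets borel"
  then have "{f \<in> Dsp. f t \<in> B} \<in> D_sets" unfolding D_sets_def by (intro sigma_sets.Basic) auto
  moreover have "(\<lambda>f. f t) -` B \<inter> space M = {f \<in> Dsp. f t \<in> B}" using assms by auto
  ultimately show "(\<lambda>f. f t) -` B \<inter> space M \<in> sets M" using assms by simp
qed simp

lemma brownian_excursionD:
  assumes "brownian_excursion M"
  shows "prob_space M" "space M = Dsp" "sets M = D_sets"
    "AE f in M. continuous_on {0..1} f \<and> f 0 = 0 \<and> f 1 = 0"
  using assms by (auto simp: brownian_excursion_def)

lemma excursion_fidi:
  assumes M: "brownian_excursion M" and m: "m \<ge> 1"
    and t: "\<And>i. i < m \<Longrightarrow> 0 < t i \<and> t i < 1" "\<And>i j. i < j \<Longrightarrow> j < m \<Longrightarrow> t i < t j"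
    and A: "\<And>i. i < m \<Longrightarrow> A i \<in> sets borel"
  shows "emeasure M {f \<in> space M. \<forall>i<m. f (t i) \<in> A i} =
    (\<integral>\<^sup>+ x. indicator (Pi\<^sub>E {..<m} A) x * ennreal (2 * sqrt (2 * pi) * edens m t 1 x) \<partial>(Pi\<^sub>M {..<m} (\<lambda>_. lborel)))"
proof -
  define ts where "ts = map t [0..<m]"
  have len: "length ts = m" and nth: "\<And>i. i < m \<Longrightarrow> ts ! i = t i" by (simp_all add: ts_def)
  have "ts \<noteq> []" using m len by auto
  moreover have "sorted_wrt (<) ts" unfolding sorted_wrt_iff_nth_less using t(2) by (simp add: len nth)
  moreover have "set ts \<subseteq> {0<..<1}" using t(1) by (auto simp: ts_def)
  ultimately have "emeasure M {f \<in> space M. \<forall>i<length ts. f (ts ! i) \<in> A i} =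
        (\<integral>\<^sup>+ x. indicator (Pi\<^sub>E {..<length ts} A) x * ennreal (exc_dens ts x) \<partial>(Pi\<^sub>M {..<length ts} (\<lambda>_. lborel)))"
    using M A len unfolding brownian_excursion_def by blast
  moreover have "{f \<in> space M. \<forall>i<length ts. f (ts ! i) \<in> A i} = {f \<in> space M. \<forall>i<m. f (t i) \<in> A i}"
    using len nth by auto
  ultimately show ?thesis using len exc_dens_eq[OF m, of t] by (simp add: ts_def)
qed

text \<open>\<open>brownian_excursion\<close> prescribes the measure of products of Borel sets, and
  these generate the product \<sigma>-algebra.\<close>

lemma excursion_distr:
  assumes M: "brownian_excursion M" and m: "m \<ge> 1"
    and t: "\<And>i. i < m \<Longrightarrow> 0 < t i \<and> t i < 1" "\<And>i j. i < j \<Longrightarrow> j < m \<Longrightarrow> t i < t j"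
  shows "distr M (Pi\<^sub>M {..<m} (\<lambda>_. lborel)) (\<lambda>f. \<lambda>i\<in>{..<m}. f (t i)) =
    density (Pi\<^sub>M {..<m} (\<lambda>_. lborel)) (\<lambda>x. ennreal (2 * sqrt (2 * pi) * edens m t 1 x))"
    (is "?P = ?Q")
proof -
  interpret prob_space M using brownian_excursionD[OF M] by simp
  have [measurable]: "(\<lambda>f. f s) \<in> borel_measurable M" for s
    using measurable_coord brownian_excursionD[OF M] by blast
  have [measurable]: "(\<lambda>f. \<lambda>i\<in>{..<m}. f (t i)) \<in> measurable M (Pi\<^sub>M {..<m} (\<lambda>_. lborel))"
    by (intro measurable_restrict) simp
  have [measurable]: "edens m t 1 \<in> borel_measurable (Pi\<^sub>M {..<m} (\<lambda>_. lborel))"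
    using m by (rule measurable_edens)
  show ?thesis
  proof (rule measure_eqI_PiM_finite[where I="{..<m}" and M="\<lambda>_. lborel" and A="\<lambda>_. Pi\<^sub>E {..<m} (\<lambda>_. UNIV)"])
    fix A :: "nat \<Rightarrow> real set" assume A: "\<And>i. i \<in> {..<m} \<Longrightarrow> A i \<in> sets lborel"
    have S: "Pi\<^sub>E {..<m} A \<in> sets (Pi\<^sub>M {..<m} (\<lambda>_. lborel))" using A by (intro sets_PiM_I_finite) auto
    have pre: "(\<lambda>f. \<lambda>i\<in>{..<m}. f (t i)) -` Pi\<^sub>E {..<m} A \<inter> space M = {f \<in> space M. \<forall>i<m. f (t i) \<in> A i}"
      by (rule set_eqI) (simp add: Pi_iff, metis lessThan_iff)
    have "emeasure ?P (Pi\<^sub>E {..<m} A) = emeasure M {f \<in> space M. \<forall>i<m. f (t i) \<in> A i}"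
      by (subst emeasure_distr[OF _ S]) (measurable, simp only: pre)
    also have "\<dots> = (\<integral>\<^sup>+ x. indicator (Pi\<^sub>E {..<m} A) x * ennreal (2 * sqrt (2 * pi) * edens m t 1 x) \<partial>(Pi\<^sub>M {..<m} (\<lambda>_. lborel)))"
      by (rule excursion_fidi[OF M m]) (use t A in simp_all)
    also have "\<dots> = emeasure ?Q (Pi\<^sub>E {..<m} A)"
      by (subst emeasure_density[OF _ S]) (measurable, simp only: mult.commute)
    finally show "emeasure ?P (Pi\<^sub>E {..<m} A) = emeasure ?Q (Pi\<^sub>E {..<m} A)" .
  next
    show "range (\<lambda>_. Pi\<^sub>E {..<m} (\<lambda>_. UNIV)) \<subseteq> prod_algebra {..<m} (\<lambda>_. lborel :: real measure)"
      by (auto intro!: prod_algebraI_finite)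
  next
    fix i :: nat
    interpret P: prob_space ?P by (rule prob_space_distr) measurable
    show "emeasure ?P (Pi\<^sub>E {..<m} (\<lambda>_. UNIV)) \<noteq> \<infinity>" by simp
  qed (simp_all add: space_PiM)
qed

lemma excursion_Laplace:
  assumes M: "brownian_excursion M" and m: "m \<ge> 1"
    and t: "\<And>i. i < m \<Longrightarrow> 0 < t i \<and> t i < 1" "\<And>i j. i < j \<Longrightarrow> j < m \<Longrightarrow> t i < t j"
    and l: "\<And>i. i < m \<Longrightarrow> l i \<ge> 0"
  shows "(\<integral>f. exp (- (\<Sum>i<m. l i * (f (t i))\<^sup>2)) \<partial>M) = Lap m t l 1"
proof -
  interpret prob_space M using brownian_excursionD[OF M] by simp
  have [measurable]: "(\<lambda>f. \<lambda>i\<in>{..<m}. f (t i)) \<in> measurable M (Pi\<^sub>M {..<m} (\<lambda>_. lborel))"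
    by (intro measurable_restrict) (use measurable_coord brownian_excursionD[OF M] in simp)
  have [measurable]: "edens m t 1 \<in> borel_measurable (Pi\<^sub>M {..<m} (\<lambda>_. lborel))"
    using m by (rule measurable_edens)
  have coord: "(\<lambda>f. f s) \<in> borel_measurable M" for s
    using measurable_coord brownian_excursionD[OF M] by blast
  let ?g = "\<lambda>x. exp (- (\<Sum>i<m. l i * (x i)\<^sup>2))"
  have [measurable]: "?g \<in> borel_measurable (Pi\<^sub>M {..<m} (\<lambda>_. lborel))" by measurable
  have nonneg: "edens m t 1 x \<ge> 0" for x using m t by (intro edens_nonneg) auto
  have "(\<integral>\<^sup>+f. ennreal (exp (- (\<Sum>i<m. l i * (f (t i))\<^sup>2))) \<partial>M) =
     (\<integral>\<^sup>+x. ennreal (?g x) \<partial>distr M (Pi\<^sub>M {..<m} (\<lambda>_. lborel)) (\<lambda>f. \<lambda>i\<in>{..<m}. f (t i)))"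
    by (subst nn_integral_distr) (auto intro!: nn_integral_cong)
  also have "\<dots> = (\<integral>\<^sup>+x. ennreal (2 * sqrt (2 * pi) * edens m t 1 x) * ennreal (?g x) \<partial>(Pi\<^sub>M {..<m} (\<lambda>_. lborel)))"
  proof -
    have d: "distr M (Pi\<^sub>M {..<m} (\<lambda>_. lborel)) (\<lambda>f. \<lambda>i\<in>{..<m}. f (t i)) =
      density (Pi\<^sub>M {..<m} (\<lambda>_. lborel)) (\<lambda>x. ennreal (2 * sqrt (2 * pi) * edens m t 1 x))"
      by (rule excursion_distr[OF M m]) (use t in auto)
    show ?thesis unfolding d by (subst nn_integral_density) auto
  qed
  also have "\<dots> = (\<integral>\<^sup>+x. ennreal (2 * sqrt (2 * pi)) * ennreal (edens m t 1 x * ?g x) \<partial>(Pi\<^sub>M {..<m} (\<lambda>_. lborel)))"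
    by (intro nn_integral_cong) (simp add: nonneg mult.assoc flip: ennreal_mult')
  also have "\<dots> = ennreal (2 * sqrt (2 * pi)) * ennreal (Lap m t l 1 * 1 powr (- 3/2) / (2 * sqrt (2 * pi)))"
    using m t l by (subst nn_integral_cmult) (measurable, subst edens_Laplace, auto)
  also have "\<dots> = ennreal (Lap m t l 1)" by (simp flip: ennreal_mult')
  finally have eq: "(\<integral>\<^sup>+f. ennreal (exp (- (\<Sum>i<m. l i * (f (t i))\<^sup>2))) \<partial>M) = ennreal (Lap m t l 1)" .
  show ?thesis
  proof -
    note coord[measurable]
    have "(\<lambda>f. exp (- (\<Sum>i<m. l i * (f (t i))\<^sup>2))) \<in> borel_measurable M" by measurable
    then show ?thesis by (subst integral_eq_nn_integral) (auto simp: eq Lap_nonneg)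
  qed
qed

section \<open>Sign of the excursion paths\<close>

lemma excursion_pos:
  assumes M: "brownian_excursion M" and t: "0 < t" "t < 1"
  shows "AE f in M. f t > 0"
proof -
  have [measurable]: "(\<lambda>f. f s) \<in> borel_measurable M" for s
    using measurable_coord brownian_excursionD[OF M] by blast
  have "emeasure M {f \<in> space M. \<forall>i<1::nat. f ((\<lambda>_. t) i) \<in> {..0}} =
    (\<integral>\<^sup>+ x. indicator (Pi\<^sub>E {..<1} (\<lambda>_. {..0})) x * ennreal (2 * sqrt (2 * pi) * edens 1 (\<lambda>_. t) 1 x) \<partial>(Pi\<^sub>M {..<1::nat} (\<lambda>_. lborel)))"
    using t by (intro excursion_fidi[OF M]) auto
  also have "\<dots> = (\<integral>\<^sup>+ x. 0 \<partial>(Pi\<^sub>M {..<1::nat} (\<lambda>_. lborel :: real measure)))"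
    by (intro nn_integral_cong) (auto simp: edens_def indicator_def PiE_iff)
  finally have "emeasure M {f \<in> space M. f t \<in> {..0}} = 0" by simp
  then show ?thesis
    by (intro AE_I[where N="{f \<in> space M. f t \<in> {..0}}"]) auto
qed

text \<open>Positivity at a fixed time extends to all rational times at once, and continuity fills
  the gaps. The Laplace transforms above determine only squares; the sign comes from here.\<close>

lemma excursion_nonneg:
  assumes M: "brownian_excursion M"
  shows "AE f in M. continuous_on {0..1} f \<and> f 0 = 0 \<and> f 1 = 0 \<and> (\<forall>t\<in>{0..1}. f t \<ge> 0)"
proof -
  have "AE f in M. \<forall>q\<in>\<rat> \<inter> {0<..<1}. f q > 0"
    by (subst AE_ball_countable) (auto intro!: excursion_pos[OF M] countable_rat countable_Int1)
  then show ?thesis using brownian_excursionD(4)[OF M]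
  proof eventually_elim
    case (elim f)
    have "f t \<ge> 0" if t: "0 < t" "t < 1" for t
    proof (rule ccontr)
      assume "\<not> f t \<ge> 0"
      then have "f t < 0" by simp
      have "isCont f t" using elim(2) t by (auto intro!: continuous_on_interior[of "{0..1}" f t])
      then have "(f \<longlongrightarrow> f t) (at t)" by (simp add: isCont_def)
      from order_tendstoD(2)[OF this \<open>f t < 0\<close>] obtain d where d: "d > 0" "\<And>s. s \<noteq> t \<Longrightarrow> dist s t < d \<Longrightarrow> f s < 0"
        unfolding eventually_at by auto
      define e where "e = min d (1 - t)"
      have "t < t + e" using d t by (simp add: e_def)
      then obtain q where q: "q \<in> \<rat>" "t < q" "q < t + e" using Rats_dense_in_real by blast
      then have "f q < 0" using d(2)[of q] by (auto simp: e_def dist_real_def)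
      moreover have "f q > 0" using elim(1) q t by (auto simp: e_def)
      ultimately show False by simp
    qed
    moreover have "f 0 \<ge> 0" "f 1 \<ge> 0" using elim(2) by auto
    ultimately have "f t \<ge> 0" if "t \<in> {0..1}" for t using that
      by (cases "t = 0 \<or> t = 1") auto
    then show ?case using elim(2) by auto
  qed
qed

section \<open>Polynomials on a compact cube\<close>

inductive_set polys :: "nat \<Rightarrow> ((nat \<Rightarrow> real) \<Rightarrow> real) set" for m where
  mono: "(\<lambda>u. c * (\<Prod>i<m. u i ^ a i)) \<in> polys m"
| add: "f \<in> polys m \<Longrightarrow> g \<in> polys m \<Longrightarrow> (\<lambda>u. f u + g u) \<in> polys m"

text \<open>Coordinates from \<open>m\<close> on are frozen at 0, so that polynomials in the first
  \<open>m\<close> variables separate points; as a product of compact sets the cube is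
  compact.\<close>

definition cube :: "nat \<Rightarrow> (nat \<Rightarrow> real) set" where
  "cube m = Pi\<^sub>E UNIV (\<lambda>j. if j < m then {0..1} else {0})"

lemma polys_mult: "f \<in> polys m \<Longrightarrow> g \<in> polys m \<Longrightarrow> (\<lambda>u. f u * g u) \<in> polys m"
proof (induction rule: polys.induct)
  case (mono c a)
  from mono show ?case
  proof (induction rule: polys.induct)
    case (mono d b)
    have "(\<lambda>u. (c * (\<Prod>i<m. u i ^ a i)) * (d * (\<Prod>i<m. u i ^ b i))) = (\<lambda>u. (c * d) * (\<Prod>i<m. u i ^ (a i + b i)))"
      by (auto simp: power_add prod.distrib)
    then show ?case using polys.mono[of "c * d"] by simp
  next
    case (add f g)
    then show ?case using polys.add by (force simp: distrib_left)
  qed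
next
  case (add f g)
  then show ?case using polys.add by (force simp: distrib_right)
qed

lemma compact_cube: "compact (cube m)"
proof -
  have "compactin (product_topology (\<lambda>_. euclidean) UNIV) (Pi\<^sub>E UNIV (\<lambda>j. if j < m then {0..1} else {0::real}))"
    unfolding compactin_PiE by auto
  then show ?thesis by (simp add: cube_def euclidean_product_topology)
qed

lemma function_ring_polys: "function_ring_on (polys m) (cube m)"
proof
  show "compact (cube m)" by (rule compact_cube)
  show "continuous_on (cube m) f" if "f \<in> polys m" for f
    using that
  proof induction
    case (mono c a)
    show ?case by (intro continuous_intros continuous_on_subset[OF continuous_on_product_coordinates]) auto
  qed (intro continuous_intros)
  show "(\<lambda>x. f x + g x) \<in> polys m" if "f \<in> polys m" "g \<in> polys m" for f g using that by (rule polys.add)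
  show "(\<lambda>x. f x * g x) \<in> polys m" if "f \<in> polys m" "g \<in> polys m" for f g using that by (rule polys_mult)
  show "(\<lambda>_. c) \<in> polys m" for c using polys.mono[of c "\<lambda>_. 0" m] by simp
  show "\<exists>f\<in>polys m. f x \<noteq> f y" if xy: "x \<in> cube m" "y \<in> cube m" "x \<noteq> y" for x y
  proof -
    obtain j where j: "x j \<noteq> y j" using xy(3) by auto
    have jm: "j < m"
    proof (rule ccontr)
      assume "\<not> j < m"
      then have "x j = 0" "y j = 0" using xy(1,2) unfolding cube_def PiE_iff by (metis UNIV_I singletonD)+
      then show False using j by simp
    qed
    let ?f = "\<lambda>u :: nat \<Rightarrow> real. 1 * (\<Prod>i<m. u i ^ (if i = j then 1 else 0))"
    have "?f u = u j" for u :: "nat \<Rightarrow> real"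
    proof -
      have "(\<Prod>i<m. u i ^ (if i = j then 1 else 0)) = (\<Prod>i<m. if i = j then u i else 1)" by (rule prod.cong) auto
      then show ?thesis using jm by (simp add: prod.delta)
    qed
    then show ?thesis using j polys.mono[of 1 "\<lambda>i. if i = j then 1 else 0" m] by metis
  qed
qed

lemma PE_add: "PE n (\<lambda>p. f p + g p) = PE n f + PE n g"
  by (simp add: PE_def sum.distrib add_divide_distrib)

lemma PE_diff: "PE n (\<lambda>p. f p - g p) = PE n f - PE n g"
  by (simp add: PE_def sum_subtractf diff_divide_distrib)

lemma PE_cmult: "PE n (\<lambda>p. c * f p) = c * PE n f"
  by (simp add: PE_def sum_distrib_left)

text \<open>The truncated subtraction is harmless: on \<open>PF n\<close> with
  \<open>k \<le> n\<close> the count is at least \<open>k\<close>.\<close>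

definition Yv :: "nat \<Rightarrow> nat list \<Rightarrow> nat \<Rightarrow> real" where
  "Yv n p k = real (cnt k p - k) / sqrt (real n)"

text \<open>Continuous functions of the variables $e^{-Y^2}$ are uniform limits of polynomials on the
  cube, and the expectation of a monomial is a joint Laplace transform of squares.\<close>
lemma fidi_convergence:
  assumes M: "brownian_excursion M" and m: "m \<ge> 1"
    and t: "\<And>i. i < m \<Longrightarrow> 0 < t i \<and> t i < 1" "\<And>i j. i < j \<Longrightarrow> j < m \<Longrightarrow> t i < t j"
    and \<phi>: "continuous_on (cube m) \<phi>"
  defines "U \<equiv> \<lambda>n p j. if j < m then exp (- (Yv n p (nat \<lfloor>t j * real n\<rfloor>))\<^sup>2) else 0"
  defines "V \<equiv> \<lambda>f j. if j < m then exp (- (f (t j))\<^sup>2) else 0"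
  shows "(\<lambda>f. \<phi> (V f)) \<in> borel_measurable M"
    and "(\<lambda>n. PE n (\<lambda>p. \<phi> (U n p))) \<longlonglongrightarrow> (\<integral>f. \<phi> (V f) \<partial>M)"
proof -
  interpret prob_space M using brownian_excursionD[OF M] by simp
  have coord[measurable]: "(\<lambda>f. f s) \<in> borel_measurable M" for s
    using measurable_coord brownian_excursionD[OF M] by blast
  have U: "U n p \<in> cube m" for n p by (auto simp: U_def cube_def)
  have V: "V f \<in> cube m" for f by (auto simp: V_def cube_def)
  have bounded: "\<exists>B. \<forall>u\<in>cube m. \<bar>F u\<bar> \<le> B" if "continuous_on (cube m) F" for F :: "(nat \<Rightarrow> real) \<Rightarrow> real"
    using compact_imp_bounded[OF compact_continuous_image[OF that compact_cube]] by (auto simp: bounded_iff)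
  have poly: "(\<lambda>f. F (V f)) \<in> borel_measurable M \<and> (\<lambda>n. PE n (\<lambda>p. F (U n p))) \<longlonglongrightarrow> (\<integral>f. F (V f) \<partial>M)"
    if F: "F \<in> polys m" for F
    using F
  proof induction
    case (mono c a)
    have e: "(\<Prod>i<m. exp (- (y i)\<^sup>2) ^ a i) = exp (- (\<Sum>i<m. real (a i) * (y i)\<^sup>2))" for y :: "nat \<Rightarrow> real"
      by (simp add: exp_sum exp_of_nat_mult[symmetric] flip: sum_negf)
    have eV: "(\<Prod>i<m. V f i ^ a i) = exp (- (\<Sum>i<m. real (a i) * (f (t i))\<^sup>2))" for f
      unfolding e[symmetric] by (rule prod.cong) (auto simp: V_def)
    have eU: "(\<Prod>i<m. U n p i ^ a i) = exp (- (\<Sum>i<m. real (a i) * (real (cnt (nat \<lfloor>t i * real n\<rfloor>) p - nat \<lfloor>t i * real n\<rfloor>))\<^sup>2 / real n))" for n p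
    proof -
      have "(\<Prod>i<m. U n p i ^ a i) = exp (- (\<Sum>i<m. real (a i) * (Yv n p (nat \<lfloor>t i * real n\<rfloor>))\<^sup>2))"
        unfolding e[symmetric] by (rule prod.cong) (auto simp: U_def)
      then show ?thesis by (simp add: Yv_def power_divide)
    qed
    have "(\<lambda>n. PE n (\<lambda>p. exp (- (\<Sum>i<m. real (a i) * (real (cnt (nat \<lfloor>t i * real n\<rfloor>) p - nat \<lfloor>t i * real n\<rfloor>))\<^sup>2 / real n)))) \<longlonglongrightarrow> Lap m t (\<lambda>i. real (a i)) 1"
    proof (rule PE_Laplace[where n="\<lambda>n. n" and k="\<lambda>i n. nat \<lfloor>t i * real n\<rfloor>"])
      show "(\<lambda>N. real N / real N) \<longlonglongrightarrow> 1" by real_asymp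
      show "(\<lambda>N. real (nat \<lfloor>t j * real N\<rfloor>) / real N) \<longlonglongrightarrow> t j" if "j < m" for j
      proof -
        have "t j > 0" using t that by auto
        then show ?thesis by real_asymp
      qed
    qed (use t in auto)
    moreover have "(\<integral>f. exp (- (\<Sum>i<m. real (a i) * (f (t i))\<^sup>2)) \<partial>M) = Lap m t (\<lambda>i. real (a i)) 1"
      by (rule excursion_Laplace[OF M m t]) auto
    ultimately show ?case by (auto simp: eU eV PE_cmult intro!: tendsto_mult)
  next
    case (add f g)
    have "integrable M (\<lambda>x. F (V x))" if F: "F \<in> polys m" "(\<lambda>x. F (V x)) \<in> borel_measurable M" for F
    proof -
      obtain B where "\<forall>u\<in>cube m. \<bar>F u\<bar> \<le> B"
        using bounded function_ring_on.continuous[OF function_ring_polys F(1)] by blast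
      then show ?thesis using F(2) V by (intro integrable_const_bound[of _ B]) auto
    qed
    from this[OF add.hyps(1)] this[OF add.hyps(2)] add.IH
    have "integrable M (\<lambda>x. f (V x))" "integrable M (\<lambda>x. g (V x))" by blast+
    then have "(\<integral>x. f (V x) + g (V x) \<partial>M) = (\<integral>x. f (V x) \<partial>M) + (\<integral>x. g (V x) \<partial>M)"
      by (rule Bochner_Integration.integral_add)
    then show ?case using add.IH by (simp only: PE_add) (intro conjI borel_measurable_add tendsto_add; blast)
  qed
  obtain F where F: "F \<in> UNIV \<rightarrow> polys m" "uniform_limit (cube m) F \<phi> sequentially"
    using function_ring_on.Stone_Weierstrass[OF function_ring_polys \<phi>] by auto
  show meas: "(\<lambda>f. \<phi> (V f)) \<in> borel_measurable M"
  proof (rule borel_measurable_LIMSEQ_real)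
    show "(\<lambda>i. F i (V f)) \<longlonglongrightarrow> \<phi> (V f)" for f using tendsto_uniform_limitI[OF F(2) V] .
    show "(\<lambda>f. F i (V f)) \<in> borel_measurable M" for i using conjunct1[OF poly[of "F i"]] F(1) by blast
  qed
  have int: "integrable M (\<lambda>f. G (V f))" if G: "continuous_on (cube m) G" "(\<lambda>f. G (V f)) \<in> borel_measurable M" for G :: "(nat \<Rightarrow> real) \<Rightarrow> real"
  proof -
    obtain B where "\<forall>u\<in>cube m. \<bar>G u\<bar> \<le> B" using bounded[OF G(1)] by blast
    then show ?thesis using G(2) V by (intro integrable_const_bound[of _ B]) auto
  qed
  show "(\<lambda>n. PE n (\<lambda>p. \<phi> (U n p))) \<longlonglongrightarrow> (\<integral>f. \<phi> (V f) \<partial>M)"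
  proof (rule tendstoI)
    fix e :: real assume "e > 0"
    then have "e / 3 > 0" by simp
    from uniform_limitD[OF F(2) this] obtain i where i: "\<forall>u\<in>cube m. dist (F i u) (\<phi> u) < e / 3"
      unfolding eventually_sequentially by blast
    have Fi: "F i \<in> polys m" using F(1) by auto
    have c: "continuous_on (cube m) (F i)" using function_ring_on.continuous[OF function_ring_polys Fi] .
    have 1: "\<bar>PE n (\<lambda>p. F i (U n p)) - PE n (\<lambda>p. \<phi> (U n p))\<bar> \<le> e / 3" for n
      unfolding PE_diff[symmetric] using i U by (intro PE_abs_le) (auto simp: dist_real_def less_imp_le)
    have 2: "\<bar>(\<integral>f. F i (V f) \<partial>M) - (\<integral>f. \<phi> (V f) \<partial>M)\<bar> \<le> e / 3"
    proof -
      have "(\<integral>f. F i (V f) \<partial>M) - (\<integral>f. \<phi> (V f) \<partial>M) = (\<integral>f. F i (V f) - \<phi> (V f) \<partial>M)"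
        using int[OF c] int[OF \<phi> meas] poly[OF Fi] by simp
      also have "\<bar>\<dots>\<bar> \<le> (\<integral>f. \<bar>F i (V f) - \<phi> (V f)\<bar> \<partial>M)" by (rule integral_abs_bound)
      also have "\<dots> \<le> (\<integral>f. e / 3 \<partial>M)"
        using int[OF c] int[OF \<phi> meas] poly[OF Fi] i V
        by (intro integral_mono) (auto simp: dist_real_def less_imp_le)
      finally show ?thesis by (simp add: prob_space)
    qed
    have "\<forall>\<^sub>F n in sequentially. dist (PE n (\<lambda>p. F i (U n p))) (\<integral>f. F i (V f) \<partial>M) < e / 3"
      using poly[OF Fi] \<open>e / 3 > 0\<close> by (intro tendstoD) auto
    then show "\<forall>\<^sub>F n in sequentially. dist (PE n (\<lambda>p. \<phi> (U n p))) (\<integral>f. \<phi> (V f) \<partial>M) < e"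
    proof eventually_elim
      case (elim n)
      then show ?case using 1[of n] 2 unfolding dist_real_def by linarith
    qed
  qed
qed

section \<open>Tightness via cyclic shifts\<close>

definition rot :: "nat \<Rightarrow> nat \<Rightarrow> nat \<Rightarrow> nat" where
  "rot N c x = (if x + c \<le> N then x + c else x + c - N)"

definition Dv :: "nat list \<Rightarrow> nat \<Rightarrow> real" where
  "Dv p k = real (cnt k p) - real k"

lemma cnt_diff:
  assumes "a \<le> b"
  shows "cnt b p - cnt a p = length (filter (\<lambda>x. a < x \<and> x \<le> b) p)" "cnt a p \<le> cnt b p"
proof -
  have "cnt b p = cnt a p + length (filter (\<lambda>x. a < x \<and> x \<le> b) p)"
    using assms unfolding cnt_def by (induction p) auto
  then show "cnt b p - cnt a p = length (filter (\<lambda>x. a < x \<and> x \<le> b) p)" "cnt a p \<le> cnt b p" by auto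
qed

lemma real_cnt_diff:
  "a \<le> b \<Longrightarrow> real (cnt b p) - real (cnt a p) = real (length (filter (\<lambda>x. a < x \<and> x \<le> b) p))"
  using cnt_diff[of a b p] by linarith

lemma PF_lsts: "q \<in> PF n \<Longrightarrow> q \<in> lsts n n" "q \<in> PF n \<Longrightarrow> q \<in> lsts (Suc n) n"
  by (auto simp: PF_eq_adm adm_def lsts_def)

lemma rot_lsts: "q \<in> PF n \<Longrightarrow> c \<le> n \<Longrightarrow> map (rot (Suc n) c) q \<in> lsts (Suc n) n"
proof -
  assume A: "q \<in> PF n" "c \<le> n"
  have "rot (Suc n) c x \<in> {1..Suc n}" if "1 \<le> x" "x \<le> n" for x
    using that A(2) by (simp add: rot_def; arith)
  then show ?thesis using PF_lsts(1)[OF A(1)] by (force simp: lsts_def)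
qed

lemma PF_cnt_ge: "q \<in> PF n \<Longrightarrow> i \<le> n \<Longrightarrow> i \<le> cnt i q"
  by (auto simp: PF_eq_adm adm_def)

text \<open>An interval of spots may wrap around after the shift and then splits into two, hence the factor 2.\<close>
lemma rot_modulus:
  assumes q: "q \<in> PF n" and c: "c \<le> n" and ab: "a \<le> b" "b \<le> n"
    and w: "\<And>i j. i \<le> j \<Longrightarrow> j \<le> Suc n \<Longrightarrow> j - i \<le> b - a \<Longrightarrow> \<bar>Dv (map (rot (Suc n) c) q) j - Dv (map (rot (Suc n) c) q) i\<bar> \<le> w"
  shows "\<bar>Dv q b - Dv q a\<bar> \<le> 2 * w"
proof -
  let ?p = "map (rot (Suc n) c) q"
  let ?N = "Suc n"
  have q1: "1 \<le> x \<and> x \<le> n" if "x \<in> set q" for x using PF_lsts(1)[OF q] that by (auto simp: lsts_def)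
  have w0: "w \<ge> 0" using w[of 0 0] by simp
  have D: "Dv p j - Dv p i = real (length (filter (\<lambda>x. i < x \<and> x \<le> j) p)) - real (j - i)" if "i \<le> j" for p i j
    using real_cnt_diff[OF that, of p] that by (simp add: Dv_def of_nat_diff)
  have R: "rot ?N c x = (if x + c \<le> ?N then x + c else x + c - ?N)" for x by (simp add: rot_def)
  consider "b + c \<le> ?N" | "a + c \<ge> ?N" | "a + c < ?N" "b + c > ?N" by linarith
  then show ?thesis
  proof cases
    case 1
    have "filter (\<lambda>x. a + c < rot ?N c x \<and> rot ?N c x \<le> b + c) q = filter (\<lambda>x. a < x \<and> x \<le> b) q"
      by (rule filter_cong[OF refl], drule q1) (use 1 c ab in \<open>simp add: R; arith\<close>)
    then have "Dv ?p (b + c) - Dv ?p (a + c) = Dv q b - Dv q a"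
      using ab by (simp add: D filter_map o_def)
    then show ?thesis using w[of "a + c" "b + c"] 1 ab w0 by simp
  next
    case 2
    have "filter (\<lambda>x. a + c - ?N < rot ?N c x \<and> rot ?N c x \<le> b + c - ?N) q = filter (\<lambda>x. a < x \<and> x \<le> b) q"
      by (rule filter_cong[OF refl], drule q1) (use 2 c ab in \<open>simp add: R; arith\<close>)
    then have "Dv ?p (b + c - ?N) - Dv ?p (a + c - ?N) = Dv q b - Dv q a"
      using ab 2 by (simp add: D filter_map o_def)
    moreover have "a + c - ?N \<le> b + c - ?N" "b + c - ?N \<le> ?N" "(b + c - ?N) - (a + c - ?N) \<le> b - a"
      using 2 ab c by linarith+
    from w[OF this] have "\<bar>Dv ?p (b + c - ?N) - Dv ?p (a + c - ?N)\<bar> \<le> w" .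
    ultimately show ?thesis using w0 by simp
  next
    case 3
    have 31: "filter (\<lambda>x. a + c < rot ?N c x \<and> rot ?N c x \<le> ?N) q = filter (\<lambda>x. a < x \<and> x \<le> ?N - c) q"
      by (rule filter_cong[OF refl], drule q1) (use 3 c ab in \<open>simp add: R; arith\<close>)
    have 32: "filter (\<lambda>x. 0 < rot ?N c x \<and> rot ?N c x \<le> b + c - ?N) q = filter (\<lambda>x. ?N - c < x \<and> x \<le> b) q"
      by (rule filter_cong[OF refl], drule q1) (use 3 c ab in \<open>simp add: R; arith\<close>)
    have "length (filter (\<lambda>x. a < x \<and> x \<le> b) xs) = length (filter (\<lambda>x. a < x \<and> x \<le> ?N - c) xs) + length (filter (\<lambda>x. ?N - c < x \<and> x \<le> b) xs)" for xs
      using 3 by (induction xs) auto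
    from this[of q] have "Dv q b - Dv q a = (Dv ?p ?N - Dv ?p (a + c)) + (Dv ?p (b + c - ?N) - Dv ?p 0)"
      using 3 ab 31 32 by (simp add: D filter_map o_def of_nat_diff)
    moreover have "\<bar>Dv ?p ?N - Dv ?p (a + c)\<bar> \<le> w" using 3 ab by (intro w) auto
    moreover have "\<bar>Dv ?p (b + c - ?N) - Dv ?p 0\<bar> \<le> w" using 3 ab c by (intro w) auto
    ultimately show ?thesis by linarith
  qed
qed

text \<open>The first \<open>Suc n - d\<close> spots attract at least that many cars, and the shift
  moves all of these beyond spot \<open>d\<close>. At most \<open>d - 1\<close> cars remain for the
  first \<open>d\<close> spots, one too few.\<close>

lemma rot_no_PF:
  assumes q: "q \<in> PF n" "map (rot (Suc n) d) q \<in> PF n" and d: "1 \<le> d" "d \<le> n"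
  shows False
proof -
  have q1: "1 \<le> x \<and> x \<le> n" if "x \<in> set q" for x using PF_lsts(1)[OF q(1)] that by (auto simp: lsts_def)
  have "cnt d (map (rot (Suc n) d) q) = length (filter (\<lambda>x. \<not> x \<le> Suc n - d) q)"
  proof -
    have "filter (\<lambda>x. rot (Suc n) d x \<le> d) q = filter (\<lambda>x. \<not> x \<le> Suc n - d) q"
      by (rule filter_cong[OF refl], drule q1) (use d in \<open>simp add: rot_def; arith\<close>)
    then show ?thesis by (simp add: cnt_def filter_map o_def)
  qed
  moreover have "length (filter (\<lambda>x. x \<le> Suc n - d) q) + length (filter (\<lambda>x. \<not> x \<le> Suc n - d) q) = length q"
    by (rule sum_length_filter_compl)
  moreover have "length q = n" using PF_lsts(1)[OF q(1)] by (simp add: lsts_def)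
  moreover have "Suc n - d \<le> length (filter (\<lambda>x. x \<le> Suc n - d) q)"
    using PF_cnt_ge[OF q(1), of "Suc n - d"] d by (simp add: cnt_def)
  moreover have "d \<le> cnt d (map (rot (Suc n) d) q)" using PF_cnt_ge[OF q(2)] d by simp
  ultimately show False using d by linarith
qed

text \<open>Pollak's circle argument: if two shifted parking functions agree, one of the originals
  is a shift of the other by the difference of the amounts, and \<open>rot_no_PF\<close> forces this
  difference to be 0.\<close>

lemma rot_inj:
  "inj_on (\<lambda>(c, q). map (rot (Suc n) c) q) ({..n} \<times> PF n)"
proof -
  have *: "c = c' \<and> q = q'" if A: "c \<le> n" "c' \<le> n" "c \<le> c'" "q \<in> PF n" "q' \<in> PF n"
    "map (rot (Suc n) c) q = map (rot (Suc n) c') q'" for c c' q q'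
  proof -
    have q1: "1 \<le> x \<and> x \<le> n" if "x \<in> set q" for x using PF_lsts(1)[OF A(4)] that by (auto simp: lsts_def)
    have q1': "1 \<le> x \<and> x \<le> n" if "x \<in> set q'" for x using PF_lsts(1)[OF A(5)] that by (auto simp: lsts_def)
    have len: "length q = length q'" using A(6) by (metis length_map)
    have "q ! i = rot (Suc n) (c' - c) (q' ! i)" if i: "i < length q" for i
    proof -
      have "rot (Suc n) c (q ! i) = rot (Suc n) c' (q' ! i)" using A(6) i len by (metis nth_map)
      moreover have "1 \<le> q ! i \<and> q ! i \<le> n" "1 \<le> q' ! i \<and> q' ! i \<le> n" using q1 q1' i len by auto
      ultimately show ?thesis using A(1-3) by (auto simp: rot_def split: if_splits)
    qed
    then have qq: "q = map (rot (Suc n) (c' - c)) q'" using len by (auto intro!: nth_equalityI)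
    have "c = c'"
    proof (rule ccontr)
      assume "c \<noteq> c'"
      moreover have "map (rot (Suc n) (c' - c)) q' \<in> PF n" using A(4) qq by simp
      moreover have "1 \<le> c' - c" "c' - c \<le> n" using \<open>c \<noteq> c'\<close> A(2,3) by auto
      ultimately show False using rot_no_PF[OF A(5)] by blast
    qed
    moreover have "map (rot (Suc n) 0) q' = q'" using q1' by (intro map_idI) (drule q1', simp add: rot_def)
    ultimately show ?thesis using qq by simp
  qed
  show ?thesis
  proof (rule inj_onI)
    fix x y assume xy: "x \<in> {..n} \<times> PF n" "y \<in> {..n} \<times> PF n"
      "(\<lambda>(c, q). map (rot (Suc n) c) q) x = (\<lambda>(c, q). map (rot (Suc n) c) q) y"
    obtain c q c' q' where e: "x = (c, q)" "y = (c', q')" by (cases x, cases y)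
    have A: "c \<le> n" "q \<in> PF n" "c' \<le> n" "q' \<in> PF n" "map (rot (Suc n) c) q = map (rot (Suc n) c') q'"
      using xy by (simp_all add: e)
    have "c = c' \<and> q = q'"
    proof (cases "c \<le> c'")
      case True
      then show ?thesis by (intro *[OF A(1,3) _ A(2,4,5)])
    next
      case False
      then have "c' = c \<and> q' = q" by (intro *[OF A(3,1) _ A(4,2) A(5)[symmetric]]) simp
      then show ?thesis by simp
    qed
    then show "x = y" by (simp add: e)
  qed
qed

section \<open>Uniform sequences: comparison, fourth moments, chaining\<close>

lemma card_lsts: "card (lsts k s) = k ^ s"
  using card_lists_length_eq[of "{1..k}" s] by (simp add: lsts_def conj_commute)

text \<open>By \<open>rot_inj\<close> every bad parking function yields \<open>n + 1\<close>
  distinct bad sequences, and by \<open>card_PF'\<close> the number of all sequences is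
  \<open>n + 1\<close> times the number of parking functions.\<close>

lemma PF_prob_le:
  assumes "\<And>q c. q \<in> PF n \<Longrightarrow> c \<le> n \<Longrightarrow> B' q \<Longrightarrow> B (map (rot (Suc n) c) q)"
  shows "real (card {q \<in> PF n. B' q}) / real (card (PF n)) \<le> real (card {p \<in> lsts (Suc n) n. B p}) / real (Suc n) ^ n"
proof -
  let ?f = "\<lambda>(c, q). map (rot (Suc n) c) q"
  have "card ({..n} \<times> {q \<in> PF n. B' q}) \<le> card {p \<in> lsts (Suc n) n. B p}"
  proof (rule card_inj_on_le[of ?f])
    show "inj_on ?f ({..n} \<times> {q \<in> PF n. B' q})" by (rule inj_on_subset[OF rot_inj]) auto
    show "?f ` ({..n} \<times> {q \<in> PF n. B' q}) \<subseteq> {p \<in> lsts (Suc n) n. B p}" using assms rot_lsts by auto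
  qed (simp add: finite_lsts)
  then have "real (Suc n) * real (card {q \<in> PF n. B' q}) \<le> real (card {p \<in> lsts (Suc n) n. B p})"
  proof -
    assume "card ({..n} \<times> {q \<in> PF n. B' q}) \<le> card {p \<in> lsts (Suc n) n. B p}"
    then have "real (Suc n * card {q \<in> PF n. B' q}) \<le> real (card {p \<in> lsts (Suc n) n. B p})"
      by (simp only: card_cartesian_product card_atMost of_nat_le_iff)
    then show ?thesis by (simp only: of_nat_mult)
  qed
  moreover have "real (Suc n) ^ n = real (card (PF n)) * real (Suc n)"
    using card_PF'[of n] by (simp add: add.commute)
  ultimately show ?thesis using card_PF_pos[of n]
    by (simp add: field_simps del: of_nat_Suc)
qed

text \<open>Expand the fourth power over a new first entry. The term linear in \<open>W\<close>
  vanishes by \<open>A1\<close>, the term linear in \<xi> because \<xi> is centered, and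
  \<open>A2\<close> bounds the mixed squares. One bound \<open>r\<close> serves both moments because
  the intended \<xi> is a centered indicator, of absolute value at most 1.\<close>

lemma list_moments:
  fixes \<xi> :: "nat \<Rightarrow> real"
  assumes m1: "(\<Sum>x\<in>{1..N}. \<xi> x) = 0" and m2: "(\<Sum>x\<in>{1..N}. (\<xi> x)^2) \<le> real N * r"
    and m4: "(\<Sum>x\<in>{1..N}. (\<xi> x)^4) \<le> real N * r" and r: "r \<ge> 0"
  defines "W \<equiv> \<lambda>p. sum_list (map \<xi> p)"
  shows "(\<Sum>p\<in>lsts N b. (W p)^4) \<le> real N ^ b * (real b * r + 3 * (real b)^2 * r^2)"
proof -
  have c: "real (card (lsts N b)) = real N ^ b" for b by (simp add: card_lsts)
  have A1: "(\<Sum>p\<in>lsts N b. W p) = 0" for b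
  proof (induction b)
    case 0 then show ?case by (simp add: lsts_def W_def) 
  next
    case (Suc b)
    have "(\<Sum>p\<in>lsts N (Suc b). W p) = (\<Sum>x\<in>{1..N}. \<Sum>p\<in>lsts N b. \<xi> x + W p)"
      unfolding sum_lsts_Cons by (simp add: W_def)
    also have "\<dots> = 0" using Suc m1 by (simp add: sum.distrib flip: sum_distrib_left)
    finally show ?case .
  qed
  have A2: "(\<Sum>p\<in>lsts N b. (W p)^2) \<le> real N ^ b * (real b * r)" for b
  proof (induction b)
    case 0
    have "lsts N 0 = {[]}" by (auto simp: lsts_def)
    then show ?case by (simp add: W_def)
  next
    case (Suc b)
    have "(\<Sum>p\<in>lsts N (Suc b). (W p)^2) = (\<Sum>x\<in>{1..N}. \<Sum>p\<in>lsts N b. (\<xi> x)^2 + 2 * \<xi> x * W p + (W p)^2)"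
      unfolding sum_lsts_Cons by (simp add: W_def power2_sum algebra_simps)
    also have "\<dots> = real N ^ b * (\<Sum>x\<in>{1..N}. (\<xi> x)^2) + real N * (\<Sum>p\<in>lsts N b. (W p)^2)"
      by (simp add: sum.distrib c A1 flip: sum_distrib_left)
    also have "\<dots> \<le> real N ^ b * (real N * r) + real N * (real N ^ b * (real b * r))"
      using m2 Suc by (intro add_mono mult_left_mono) auto
    also have "\<dots> = real N ^ Suc b * (real (Suc b) * r)" by (simp add: algebra_simps)
    finally show ?case .
  qed
  show ?thesis
  proof (induction b)
    case 0
    have "lsts N 0 = {[]}" by (auto simp: lsts_def)
    then show ?case by (simp add: W_def)
  next
    case (Suc b)
    have e: "(x + w)^4 = x^4 + 4 * x^3 * w + 6 * x^2 * w^2 + 4 * x * w^3 + w^4" for x w :: real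
      by (simp add: power4_eq_xxxx power3_eq_cube power2_eq_square algebra_simps)
    have "(\<Sum>p\<in>lsts N (Suc b). (W p)^4) = (\<Sum>x\<in>{1..N}. \<Sum>p\<in>lsts N b. (\<xi> x + W p)^4)"
      unfolding sum_lsts_Cons by (simp add: W_def)
    also have "\<dots> = (\<Sum>x\<in>{1..N}. real N ^ b * (\<xi> x)^4 + 4 * (\<xi> x)^3 * (\<Sum>p\<in>lsts N b. W p) + 6 * (\<xi> x)^2 * (\<Sum>p\<in>lsts N b. (W p)^2)
        + 4 * \<xi> x * (\<Sum>p\<in>lsts N b. (W p)^3) + (\<Sum>p\<in>lsts N b. (W p)^4))"
      unfolding e by (simp add: sum.distrib c sum_distrib_left)
    also have "\<dots> = real N ^ b * (\<Sum>x\<in>{1..N}. (\<xi> x)^4) + 6 * ((\<Sum>x\<in>{1..N}. (\<xi> x)^2) * (\<Sum>p\<in>lsts N b. (W p)^2))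
        + 4 * ((\<Sum>x\<in>{1..N}. \<xi> x) * (\<Sum>p\<in>lsts N b. (W p)^3)) + real N * (\<Sum>p\<in>lsts N b. (W p)^4)"
    proof -
      have "(\<Sum>x\<in>X. c * f x + 4 * g x * 0 + 6 * h x * s + 4 * k x * t + u) =
          c * (\<Sum>x\<in>X. f x) + 6 * ((\<Sum>x\<in>X. h x) * s) + 4 * ((\<Sum>x\<in>X. k x) * t) + real (card X) * u"
        for X :: "nat set" and c s t u :: real and f g h k
        by (simp add: sum.distrib sum_distrib_left sum_distrib_right mult.assoc)
      from this[of _ "\<lambda>x. (\<xi> x)^4" "\<lambda>x. (\<xi> x)^3" "\<lambda>x. (\<xi> x)^2" _ \<xi> _ _ "{1..N}"]
      show ?thesis unfolding A1 by simp
    qed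
    also have "\<dots> \<le> real N ^ b * (real N * r) + 6 * ((real N * r) * (real N ^ b * (real b * r)))
        + 0 + real N * (real N ^ b * (real b * r + 3 * (real b)^2 * r^2))"
      unfolding m1 using m2 m4 A2 Suc r by (intro add_mono mult_left_mono mult_mono) (auto intro!: sum_nonneg)
    also have "\<dots> = real N ^ Suc b * (r + 6 * real b * r^2 + (real b * r + 3 * (real b)^2 * r^2))"
      by (simp add: algebra_simps power2_eq_square)
    also have "\<dots> \<le> real N ^ Suc b * (real (Suc b) * r + 3 * (real (Suc b))^2 * r^2)"
      by (intro mult_left_mono) (auto simp: power2_eq_square algebra_simps)
    finally show ?case .
  qed
qed

lemma increment_moment:
  assumes ab: "a \<le> b" "b \<le> Suc n"
  shows "(\<Sum>p\<in>lsts (Suc n) n. (Dv p b - Dv p a)^4) \<le> 40 * (real (b - a))^2 * real (Suc n) ^ n"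
proof (cases "a = b")
  case True then show ?thesis by simp
next
  case False
  define d where "d = real (b - a)"
  define N where "N = Suc n"
  define r where "r = d / real N"
  define \<xi> where "\<xi> x = (if a < x \<and> x \<le> b then 1 else 0) - r" for x
  define W where "W p = sum_list (map \<xi> p)" for p
  have d1: "d \<ge> 1" using False ab by (simp add: d_def)
  have dN: "d \<le> real N" using ab by (simp add: d_def N_def)
  have N0: "real N > 0" by (simp add: N_def)
  have r: "0 \<le> r" "r \<le> 1" using d1 dN N0 by (auto simp: r_def)
  have Nr: "real N * r = d" using N0 by (simp add: r_def)
  have ind: "(\<Sum>x\<in>{1..N}. if a < x \<and> x \<le> b then 1 else 0 :: real) = d"
  proof -
    have "{x \<in> {1..N}. a < x \<and> x \<le> b} = {a<..b}" using ab by (auto simp: N_def)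
    then show ?thesis by (simp add: sum.inter_filter[symmetric] d_def)
  qed
  have m1: "(\<Sum>x\<in>{1..N}. \<xi> x) = 0" unfolding \<xi>_def sum_subtractf ind using Nr by simp
  have m2: "(\<Sum>x\<in>{1..N}. (\<xi> x)^2) \<le> real N * r"
  proof -
    have "(\<xi> x)^2 = (1 - 2 * r) * (if a < x \<and> x \<le> b then 1 else 0) + r^2" for x
      by (simp add: \<xi>_def power2_eq_square algebra_simps)
    then have "(\<Sum>x\<in>{1..N}. (\<xi> x)^2) = (\<Sum>x\<in>{1..N}. (1 - 2 * r) * (if a < x \<and> x \<le> b then 1 else 0) + r^2)"
      by (intro sum.cong refl)
    also have "\<dots> = (1 - 2 * r) * (\<Sum>x\<in>{1..N}. if a < x \<and> x \<le> b then 1 else 0) + real N * r^2"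
      by (subst sum.distrib, subst sum_distrib_left[symmetric]) simp
    also note ind
    also have "real N * r^2 = (real N * r) * r" by (simp add: power2_eq_square)
    also have "(1 - 2 * r) * d + real N * r * r = d - r * d" unfolding Nr by (simp add: algebra_simps)
    also have "\<dots> \<le> real N * r" using Nr r d1 by simp
    finally show ?thesis .
  qed
  have m4: "(\<Sum>x\<in>{1..N}. (\<xi> x)^4) \<le> real N * r"
  proof -
    have "(\<xi> x)^4 \<le> (\<xi> x)^2" for x
    proof -
      have "\<bar>\<xi> x\<bar> \<le> 1" using r by (auto simp: \<xi>_def)
      then have "(\<xi> x)^2 \<le> 1" by (simp add: abs_square_le_1)
      then have "(\<xi> x)^2 * (\<xi> x)^2 \<le> (\<xi> x)^2 * 1" by (intro mult_left_mono) auto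
      then show ?thesis by (simp flip: power_add)
    qed
    then show ?thesis using m2 sum_mono[of "{1..N}" "\<lambda>x. (\<xi> x)^4" "\<lambda>x. (\<xi> x)^2"] by force
  qed
  have nr: "real n * r \<le> d" using r Nr by (auto simp: N_def algebra_simps)
  \<comment> \<open>A list has only \<open>n = N - 1\<close> entries, so the mean count is
    \<open>d - r\<close> instead of \<open>d\<close>. The shift by \<open>r \<le> 1\<close> costs
    the additive 8 in \<open>four\<close>, and 40 is 8 times 4 plus 8.\<close>
  have DW: "Dv p b - Dv p a = W p - r" if "p \<in> lsts N n" for p
  proof -
    have "W p = real (length (filter (\<lambda>x. a < x \<and> x \<le> b) p)) - r * real (length p)"
      unfolding W_def by (induction p) (auto simp: \<xi>_def algebra_simps)
    moreover have "length p = n" using that by (simp add: lsts_def)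
    moreover have "r * real n = d - r" using Nr by (simp add: N_def algebra_simps)
    ultimately show ?thesis using real_cnt_diff[OF ab(1), of p] ab(1) by (simp add: Dv_def d_def of_nat_diff)
  qed
  have four: "(x - r)^4 \<le> 8 * x^4 + 8" for x
  proof -
    have "(x - r)^2 \<le> 2 * x^2 + 2"
    proof -
      have "(x - r)^2 + (x + r)^2 = 2 * x^2 + 2 * r^2" by (simp add: power2_eq_square algebra_simps)
      moreover have "r^2 \<le> 1" using r by (simp add: abs_square_le_1)
      moreover have "(x + r)^2 \<ge> 0" by simp
      ultimately show ?thesis by linarith
    qed
    then have "((x - r)^2)^2 \<le> (2 * x^2 + 2)^2" by (intro power_mono) auto
    then have "(x - r)^4 \<le> (2 * x^2 + 2)^2" by (simp flip: power_mult)
    moreover have "(2 * x^2 + 2)^2 + (2 * x^2 - 2)^2 = 8 * x^4 + 8"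
      by (simp add: power2_eq_square power4_eq_xxxx algebra_simps)
    moreover have "(2 * x^2 - 2)^2 \<ge> 0" by (rule zero_le_power2)
    ultimately show ?thesis by linarith
  qed
  have "(\<Sum>p\<in>lsts N n. (Dv p b - Dv p a)^4) \<le> (\<Sum>p\<in>lsts N n. 8 * (W p)^4 + 8)"
    by (intro sum_mono) (simp add: DW four)
  also have "\<dots> = 8 * (\<Sum>p\<in>lsts N n. (W p)^4) + 8 * real N ^ n"
    by (simp add: sum.distrib card_lsts flip: sum_distrib_left)
  also have "(\<Sum>p\<in>lsts N n. (W p)^4) \<le> real N ^ n * (real n * r + 3 * (real n)^2 * r^2)"
    unfolding W_def by (rule list_moments[OF m1 m2 m4 r(1)])
  also have "\<dots> \<le> real N ^ n * (d^2 + 3 * d^2)"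
  proof (intro mult_left_mono add_mono)
    have "d * 1 \<le> d * d" using d1 by (intro mult_left_mono) auto
    then show "real n * r \<le> d\<^sup>2" using nr by (simp add: power2_eq_square)
    have "(real n * r)^2 \<le> d^2" using nr r by (intro power_mono) auto
    then show "3 * (real n)\<^sup>2 * r\<^sup>2 \<le> 3 * d\<^sup>2" by (simp add: power_mult_distrib)
  qed auto
  finally have "(\<Sum>p\<in>lsts N n. (Dv p b - Dv p a)^4) \<le> 8 * (real N ^ n * (4 * d^2)) + 8 * real N ^ n * 1"
    by simp
  also have "\<dots> \<le> 8 * (real N ^ n * (4 * d^2)) + 8 * real N ^ n * d^2"
    using d1 by (intro add_left_mono mult_left_mono) auto
  finally show ?thesis by (simp add: N_def d_def algebra_simps)
qed

lemma increment_prob: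
  assumes ab: "a \<le> b" "b \<le> Suc n" and l: "l > 0"
  shows "real (card {p \<in> lsts (Suc n) n. \<bar>Dv p b - Dv p a\<bar> > l}) \<le> 40 * (real (b - a))^2 / l^4 * real (Suc n) ^ n"
proof -
  let ?S = "{p \<in> lsts (Suc n) n. \<bar>Dv p b - Dv p a\<bar> > l}"
  have "real (card ?S) * l^4 = (\<Sum>p\<in>?S. l^4)" by simp
  also have "\<dots> \<le> (\<Sum>p\<in>?S. (Dv p b - Dv p a)^4)"
  proof (rule sum_mono)
    fix p assume "p \<in> ?S"
    then have "l^4 \<le> \<bar>Dv p b - Dv p a\<bar>^4" using l by (intro power_mono) auto
    then show "l^4 \<le> (Dv p b - Dv p a)^4" by simp
  qed
  also have "\<dots> \<le> (\<Sum>p\<in>lsts (Suc n) n. (Dv p b - Dv p a)^4)"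
    by (rule sum_mono2) (auto simp: finite_lsts)
  also have "\<dots> \<le> 40 * (real (b - a))^2 * real (Suc n) ^ n" by (rule increment_moment[OF ab])
  finally show ?thesis using l by (simp add: field_simps)
qed

text \<open>Clear the binary digits of \<open>i\<close> from the lowest on: passing from level
  \<open>J\<close> to \<open>Suc J\<close> either leaves the rounded point fixed or crosses a single
  block of length \<open>2^J\<close>.\<close>

lemma dyadic_chain:
  fixes D :: "nat \<Rightarrow> real"
  assumes "\<And>j m. j < J \<Longrightarrow> 2^j * Suc m \<le> N \<Longrightarrow> \<bar>D (2^j * Suc m) - D (2^j * m)\<bar> \<le> e j"
    and "i \<le> N" and e: "\<And>j. e j \<ge> 0"
  shows "\<bar>D i - D (2^J * (i div 2^J))\<bar> \<le> (\<Sum>j<J. e j)"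
  using assms(1)
proof (induction J)
  case 0 then show ?case by simp
next
  case (Suc J)
  let ?m = "i div 2^J"
  have IH: "\<bar>D i - D (2^J * ?m)\<bar> \<le> (\<Sum>j<J. e j)" using Suc by auto
  have e0: "\<bar>D (2^J * ?m) - D (2^Suc J * (i div 2^Suc J))\<bar> \<le> e J"
  proof -
    have d: "i div 2^Suc J = ?m div 2" by (simp only: power_Suc2 div_mult2_eq)
    have mN: "2^J * ?m \<le> N" using assms(2) by (meson order.trans times_div_less_eq_dividend)
    show ?thesis
    proof (cases "even ?m")
      case True
      then have eq: "2^Suc J * (i div 2^Suc J) = 2^J * ?m" unfolding d by (simp add: mult.assoc)
      show ?thesis unfolding eq using e[of J] by simp
    next
      case False
      then have m: "?m = Suc (2 * (?m div 2))" using odd_two_times_div_two_succ[of ?m] by simp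
      have "\<bar>D (2^J * Suc (2 * (?m div 2))) - D (2^J * (2 * (?m div 2)))\<bar> \<le> e J"
        using Suc.prems[of J "2 * (?m div 2)"] mN m by simp
      then show ?thesis unfolding d using m by (simp add: mult.assoc mult.left_commute)
    qed
  qed
  have "\<bar>D i - D (2^Suc J * (i div 2^Suc J))\<bar> \<le> (\<Sum>j<J. e j) + e J" using IH e0 by linarith
  then show ?case by simp
qed

text \<open>The 3 counts one chain from each endpoint down to the grid of level \<open>J\<close> and
  at most one block between the rounded points, which are neighbours or equal since
  \<open>b - a \<le> 2^J\<close>.\<close>

lemma dyadic_modulus:
  fixes D :: "nat \<Rightarrow> real"
  assumes lev: "\<And>j m. j \<le> J \<Longrightarrow> 2^j * Suc m \<le> N \<Longrightarrow> \<bar>D (2^j * Suc m) - D (2^j * m)\<bar> \<le> e j"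
    and e: "\<And>j. e j \<ge> 0" "(\<Sum>j<J. e j) \<le> E" "e J \<le> E"
    and ab: "a \<le> b" "b \<le> N" "b - a \<le> 2^J"
  shows "\<bar>D b - D a\<bar> \<le> 3 * E"
proof -
  let ?a = "a div 2^J" and ?b = "b div 2^J"
  have 1: "\<bar>D b - D (2^J * ?b)\<bar> \<le> E" using dyadic_chain[of J N D e b] lev e ab by force
  have 2: "\<bar>D a - D (2^J * ?a)\<bar> \<le> E" using dyadic_chain[of J N D e a] lev e ab by force
  have "?a \<le> ?b" using ab(1) by (rule div_le_mono)
  moreover have "?b \<le> Suc ?a"
  proof -
    have "?b \<le> (a + 2^J) div 2^J" using ab by (intro div_le_mono) auto
    then show ?thesis by simp
  qed
  ultimately consider "?b = ?a" | "?b = Suc ?a" by linarith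
  then have "\<bar>D (2^J * ?b) - D (2^J * ?a)\<bar> \<le> E"
  proof cases
    case 1
    have "E \<ge> 0" using e(1)[of J] e(3) by linarith
    then show ?thesis using 1 by simp
  next
    case 2
    have "2^J * Suc ?a \<le> N" using ab(2) 2 by (metis order.trans times_div_less_eq_dividend)
    then show ?thesis using lev[of J ?a] e(3) 2 by simp
  qed
  then show ?thesis using 1 2 by linarith
qed

lemma geometric_le:
  assumes "0 \<le> x" "x < (1::real)"
  shows "(\<Sum>i<n. x ^ i) \<le> 1 / (1 - x)"
  unfolding sum_gp_strict using assms by (auto intro!: divide_right_mono)

lemma real_card_UN_le: "finite I \<Longrightarrow> real (card (\<Union>i\<in>I. A i)) \<le> (\<Sum>i\<in>I. real (card (A i)))"
  unfolding of_nat_sum[symmetric] by (intro of_nat_mono card_UN_le)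

abbreviation wide :: "nat list \<Rightarrow> nat \<Rightarrow> nat \<Rightarrow> real \<Rightarrow> bool" where
  "wide p n w l \<equiv> \<exists>a b. a \<le> b \<and> b \<le> n \<and> b - a \<le> w \<and> \<bar>Dv p b - Dv p a\<bar> > l"

text \<open>The thresholds at level $j$ are proportional to $(9/10)^{J-j}$: they are summable, and the union bound
  converges because $(9/10)^4 > 1/2$.\<close>
lemma chain_prob:
  assumes E: "E > 0"
  shows "real (card {p \<in> lsts (Suc n) n. wide p (Suc n) (2^J) (3 * E)})
    \<le> 2000000 * real (Suc n) * 2^J / E^4 * real (Suc n) ^ n"
proof -
  define N where "N = Suc n"
  \<comment> \<open>The factor 1/10 is \<open>1 - 9/10\<close> and makes the thresholds sum to at
    most \<open>E\<close>.\<close>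
  define e where "e j = E / 10 * (9/10) ^ (J - j)" for j
  define Ms where "Ms j = {m. 2^j * Suc m \<le> N}" for j
  define S where "S j m = {p \<in> lsts N n. \<bar>Dv p (2^j * Suc m) - Dv p (2^j * m)\<bar> > e j}" for j m
  have e0: "e j > 0" for j using E by (simp add: e_def)
  have eJ: "e J \<le> E" using E by (simp add: e_def)
  have esum: "(\<Sum>j<J. e j) \<le> E"
  proof -
    have "(\<Sum>j<J. (9/10::real) ^ (J - j)) = (\<Sum>j<J. 9/10 * (9/10) ^ (J - Suc j))"
      by (intro sum.cong refl) (simp add: Suc_diff_Suc flip: power_Suc)
    also have "\<dots> = 9/10 * (\<Sum>j<J. (9/10) ^ j)"
    proof -
      have "(\<Sum>j<J. (9/10::real) ^ (J - Suc j)) = (\<Sum>j<J. (9/10) ^ j)" by (rule sum.nat_diff_reindex)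
      then show ?thesis by (simp only: sum_distrib_left[symmetric])
    qed
    also have "\<dots> \<le> 9/10 * (1 / (1 - 9/10))" by (intro mult_left_mono geometric_le) auto
    finally have "(\<Sum>j<J. (9/10::real) ^ (J - j)) \<le> 10" by simp
    then have "E / 10 * (\<Sum>j<J. (9/10::real) ^ (J - j)) \<le> E / 10 * 10" using E by (intro mult_left_mono) auto
    then show ?thesis by (simp add: e_def sum_distrib_left)
  qed
  have Ms: "finite (Ms j)" "real (card (Ms j)) \<le> real N / 2^j" for j
  proof -
    have sub: "Ms j \<subseteq> {..<N div 2^j}"
      by (auto simp: Ms_def less_eq_div_iff_mult_less_eq Suc_le_eq[symmetric] mult.commute)
    then show "finite (Ms j)" by (rule finite_subset) simp
    have "card (Ms j) \<le> N div 2^j" using card_mono[OF _ sub] by simp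
    then have "real (card (Ms j)) \<le> real (N div 2^j)" by simp
    also have "\<dots> \<le> real N / real (2^j)" 
    proof -
      have "real (2^j) * real (N div 2^j) \<le> real N" by (metis of_nat_le_iff of_nat_mult times_div_less_eq_dividend)
      then show ?thesis by (simp add: field_simps)
    qed
    finally show "real (card (Ms j)) \<le> real N / 2^j" by simp
  qed
  have finS: "finite (S j m)" for j m by (simp add: S_def finite_lsts)
  have "{p \<in> lsts N n. wide p N (2^J) (3 * E)} \<subseteq> (\<Union>j\<in>{..J}. \<Union>m\<in>Ms j. S j m)"
  proof (rule ccontr)
    assume "\<not> ?thesis"
    then obtain p a b where p: "p \<in> lsts N n" "a \<le> b" "b \<le> N" "b - a \<le> 2^J" "\<bar>Dv p b - Dv p a\<bar> > 3 * E"
      "p \<notin> (\<Union>j\<in>{..J}. \<Union>m\<in>Ms j. S j m)" by blast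
    have "\<bar>Dv p b - Dv p a\<bar> \<le> 3 * E"
    proof (rule dyadic_modulus[OF _ less_imp_le[OF e0] esum eJ p(2-4)])
      fix j m assume "j \<le> J" "2^j * Suc m \<le> N"
      then show "\<bar>Dv p (2^j * Suc m) - Dv p (2^j * m)\<bar> \<le> e j" using p(1,6) by (force simp: Ms_def S_def)
    qed
    then show False using p(5) by simp
  qed
  then have "real (card {p \<in> lsts N n. wide p N (2^J) (3 * E)})
     \<le> real (card (\<Union>j\<in>{..J}. \<Union>m\<in>Ms j. S j m))"
    by (intro of_nat_mono card_mono) (auto simp: Ms finS)
  also have "\<dots> \<le> (\<Sum>j\<le>J. real (card (\<Union>m\<in>Ms j. S j m)))"
    by (rule real_card_UN_le) simp
  also have "\<dots> \<le> (\<Sum>j\<le>J. \<Sum>m\<in>Ms j. real (card (S j m)))"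
    by (intro sum_mono real_card_UN_le Ms)
  also have "\<dots> \<le> (\<Sum>j\<le>J. \<Sum>m\<in>Ms j. 40 * (2^j)^2 / (e j)^4 * real N ^ n)"
  proof (intro sum_mono)
    fix j m assume "m \<in> Ms j"
    then have "2^j * m \<le> 2^j * Suc m" "2^j * Suc m \<le> Suc n" by (auto simp: Ms_def N_def)
    from increment_prob[OF this e0[of j]]
    show "real (card (S j m)) \<le> 40 * (2^j)^2 / (e j)^4 * real N ^ n" by (simp add: S_def N_def)
  qed
  also have "\<dots> = (\<Sum>j\<le>J. real (card (Ms j)) * (40 * (2^j)^2 / (e j)^4 * real N ^ n))" by simp
  also have "\<dots> \<le> (\<Sum>j\<le>J. real N / 2^j * (40 * (2^j)^2 / (e j)^4 * real N ^ n))"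
    by (intro sum_mono mult_right_mono Ms) auto
  \<comment> \<open>400000 is 40 times \<open>10^4\<close>. The growth rate
    \<open>(10/9)^4 = 10000/6561\<close> is rounded up to 8/5, twice 4/5: the 2 turns
    \<open>2^j\<close> into \<open>2^J\<close>, and the powers of 4/5 sum to at most 5, whence
    2000000.\<close>
  also have "\<dots> \<le> (\<Sum>j\<le>J. 400000 * real N * 2^J / E^4 * real N ^ n * (4/5) ^ (J - j))"
  proof (intro sum_mono)
    fix j assume "j \<in> {..J}"
    then have j: "j \<le> J" by simp
    have "(1::real) / ((9/10) ^ (J - j))^4 = (10000/6561) ^ (J - j)"
    proof -
      have "(x ^ k)^4 = (x^4) ^ k" for x :: real and k by (simp flip: power_mult add: mult.commute)
      moreover have "(1::real) / (9/10)^4 = 10000/6561" by (simp add: power4_eq_xxxx)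
      moreover have "(1::real) / y ^ k = (1 / y) ^ k" for y k by (rule power_one_over[symmetric])
      ultimately show ?thesis by metis
    qed
    also have "\<dots> \<le> (8/5) ^ (J - j)" by (intro power_mono) auto
    also have "(8/5::real) ^ (J - j) = 2 ^ (J - j) * (4/5) ^ (J - j)" by (simp flip: power_mult_distrib)
    finally have h: "(1::real) / ((9/10) ^ (J - j))^4 \<le> 2 ^ (J - j) * (4/5) ^ (J - j)" .
    have "real N / 2^j * (40 * (2^j)^2 / (e j)^4 * real N ^ n) = (400000 * real N / E^4 * real N ^ n * 2^j) * (1 / ((9/10) ^ (J - j))^4)"
      using E by (simp add: e_def power_mult_distrib power_divide power2_eq_square)
    also have "\<dots> \<le> (400000 * real N / E^4 * real N ^ n * 2^j) * (2 ^ (J - j) * (4/5) ^ (J - j))"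
      using h by (intro mult_left_mono) auto
    also have "\<dots> = 400000 * real N / E^4 * real N ^ n * (2^j * 2 ^ (J - j)) * (4/5) ^ (J - j)" by simp
    also have "(2::real)^j * 2 ^ (J - j) = 2^J" using j by (simp flip: power_add)
    finally show "real N / 2^j * (40 * (2^j)^2 / (e j)^4 * real N ^ n) \<le> 400000 * real N * 2^J / E^4 * real N ^ n * (4/5) ^ (J - j)"
      by (simp add: mult_ac)
  qed
  also have "\<dots> = 400000 * real N * 2^J / E^4 * real N ^ n * (\<Sum>j<Suc J. (4/5) ^ j)"
  proof -
    have "(\<Sum>j\<le>J. (4/5::real) ^ (J - j)) = (\<Sum>j<Suc J. (4/5) ^ (Suc J - Suc j))"
      by (simp add: lessThan_Suc_atMost)
    also have "\<dots> = (\<Sum>j<Suc J. (4/5) ^ j)" by (rule sum.nat_diff_reindex)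
    finally have h: "(\<Sum>j\<le>J. (4/5::real) ^ (J - j)) = (\<Sum>j<Suc J. (4/5) ^ j)" .
    show ?thesis unfolding sum_distrib_left[symmetric] h ..
  qed
  also have "\<dots> \<le> 400000 * real N * 2^J / E^4 * real N ^ n * (1 / (1 - 4/5))"
    by (intro mult_left_mono geometric_le) auto
  also have "400000 * real N * 2^J / E^4 * real N ^ n * (1 / (1 - 4/5)) = 2000000 * real N * 2^J / E^4 * real N ^ n"
    by simp
  finally show ?thesis unfolding N_def .
qed

text \<open>The 6 is the 3 of the chaining bound times the 2 of \<open>rot_modulus\<close>.\<close>

lemma PF_modulus_prob:
  assumes E: "E > 0"
  shows "real (card {q \<in> PF n. wide q n (2^J) (6 * E)}) / real (card (PF n))
    \<le> 2000000 * real (Suc n) * 2^J / E^4"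
proof -
  let ?B = "\<lambda>p. wide p (Suc n) (2^J) (3 * E)"
  have "real (card {q \<in> PF n. wide q n (2^J) (6 * E)}) / real (card (PF n))
    \<le> real (card {p \<in> lsts (Suc n) n. ?B p}) / real (Suc n) ^ n"
  proof (rule PF_prob_le)
    fix q c assume q: "q \<in> PF n" "c \<le> n" "wide q n (2^J) (6 * E)"
    then obtain a b where ab: "a \<le> b" "b \<le> n" "b - a \<le> 2^J" "\<bar>Dv q b - Dv q a\<bar> > 6 * E" by blast
    show "?B (map (rot (Suc n) c) q)"
    proof (rule ccontr)
      assume nB: "\<not> ?B (map (rot (Suc n) c) q)"
      have "\<bar>Dv q b - Dv q a\<bar> \<le> 2 * (3 * E)"
      proof (rule rot_modulus[OF q(1,2) ab(1,2)])
        fix i j assume "i \<le> j" "j \<le> Suc n" "j - i \<le> b - a"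
        then show "\<bar>Dv (map (rot (Suc n) c) q) j - Dv (map (rot (Suc n) c) q) i\<bar> \<le> 3 * E"
          using nB ab(3) by (meson not_le order.trans)
      qed
      then show False using ab(4) by simp
    qed
  qed
  also have "\<dots> \<le> (2000000 * real (Suc n) * 2^J / E^4 * real (Suc n) ^ n) / real (Suc n) ^ n"
    by (intro divide_right_mono chain_prob E) auto
  also have "\<dots> = 2000000 * real (Suc n) * 2^J / E^4" by simp
  finally show ?thesis .
qed

section \<open>Skorokhod continuity and measurability\<close>

definition stepf :: "nat \<Rightarrow> (nat \<Rightarrow> real) \<Rightarrow> real \<Rightarrow> real" where
  "stepf m x t = (if t \<in> {0..1} then x (nat \<lfloor>real m * t\<rfloor>) else 0)"

definition discretize :: "nat \<Rightarrow> (real \<Rightarrow> real) \<Rightarrow> real \<Rightarrow> real" where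
  "discretize m f = stepf m (\<lambda>j. f (real j / real m))"

text \<open>One slope for all pieces covers both uses: \<open>c = 0\<close> for step functions and
  \<open>c = - sqrt n\<close> for \<open>PFproc\<close>.\<close>

lemma step_linear_Dsp:
  assumes n: "n \<ge> 1"
  shows "(\<lambda>t. if t \<in> {0..1} then x (nat \<lfloor>real n * t\<rfloor>) + c * t else 0) \<in> Dsp" (is "?f \<in> Dsp")
proof -
  have n0: "real n > 0" using n by simp
  have right: "(?f \<longlongrightarrow> ?f t) (at_right t)" if t: "t \<in> {0..<1}" for t
  proof -
    define k where "k = \<lfloor>real n * t\<rfloor>"
    define u where "u = min 1 ((of_int k + 1) / real n)"
    have "t < u" using t n0 by (simp add: u_def k_def field_simps) linarith
    have "?f s = x (nat k) + c * s" if "t < s" "s < u" for s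
    proof -
      have "of_int k \<le> real n * t" by (simp add: k_def)
      also have "\<dots> \<le> real n * s" using that n0 by simp
      finally have "\<lfloor>real n * s\<rfloor> = k" using that n0 by (simp add: floor_eq_iff u_def field_simps)
      then show ?thesis using that t by (simp add: u_def)
    qed
    then have "eventually (\<lambda>s. x (nat k) + c * s = ?f s) (at_right t)"
      using \<open>t < u\<close> unfolding eventually_at_right_field by metis
    moreover have "((\<lambda>s. x (nat k) + c * s) \<longlongrightarrow> x (nat k) + c * t) (at_right t)" by (intro tendsto_intros)
    ultimately have "(?f \<longlongrightarrow> x (nat k) + c * t) (at_right t)" by (rule Lim_transform_eventually[rotated])
    then show ?thesis using t by (simp add: k_def)
  qed
  have left: "\<exists>l. (?f \<longlongrightarrow> l) (at_left t)" if t: "t \<in> {0<..1}" for t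
  proof -
    \<comment> \<open>Just to the left of \<open>t\<close> the floor of \<open>n * s\<close> has
      this value, also when \<open>n * t\<close> is an integer.\<close>
    define k where "k = \<lceil>real n * t\<rceil> - 1"
    define u where "u = max 0 (of_int k / real n)"
    have "u < t" using t n0 by (simp add: u_def k_def field_simps) linarith
    have "?f s = x (nat k) + c * s" if "u < s" "s < t" for s
    proof -
      have "real n * s < real n * t" using that n0 by simp
      also have "\<dots> \<le> of_int k + 1" by (simp add: k_def)
      finally have "\<lfloor>real n * s\<rfloor> = k" using that n0 by (simp add: floor_eq_iff u_def field_simps)
      then show ?thesis using that t by (simp add: u_def)
    qed
    then have "eventually (\<lambda>s. x (nat k) + c * s = ?f s) (at_left t)"
      using \<open>u < t\<close> unfolding eventually_at_left_field by metis
    moreover have "((\<lambda>s. x (nat k) + c * s) \<longlongrightarrow> x (nat k) + c * t) (at_left t)" by (intro tendsto_intros)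
    ultimately have "(?f \<longlongrightarrow> x (nat k) + c * t) (at_left t)" by (rule Lim_transform_eventually[rotated])
    then show ?thesis by blast
  qed
  show ?thesis unfolding Dsp_def using right left by auto
qed

lemma stepf_Dsp: "m \<ge> 1 \<Longrightarrow> stepf m x \<in> Dsp"
  using step_linear_Dsp[of m x 0] by (simp add: stepf_def[abs_def] cong: if_cong)

lemma timechanges_range:
  assumes "l \<in> timechanges" "t \<in> {0..1}" shows "0 \<le> l t" "l t \<le> 1"
proof -
  have l: "mono_on {0..1} l" "l 0 = 0" "l 1 = 1"
    using assms(1) by (auto simp: timechanges_def strict_mono_on_imp_mono_on)
  show "0 \<le> l t" "l t \<le> 1"
    using mono_onD[OF l(1), of 0 t] mono_onD[OF l(1), of t 1] l assms(2) by auto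
qed

lemma sk_dist_le:
  assumes l: "l \<in> timechanges" and r: "\<And>t. t \<in> {0..1} \<Longrightarrow> \<bar>l t - t\<bar> \<le> r" "\<And>t. t \<in> {0..1} \<Longrightarrow> \<bar>f t - g (l t)\<bar> \<le> r"
  shows "sk_dist f g \<le> r"
proof -
  have "max (SUP t\<in>{0..1}. \<bar>l t - t\<bar>) (SUP t\<in>{0..1}. \<bar>f t - g (l t)\<bar>) \<le> r"
    using r by (intro max.boundedI cSUP_least) auto
  moreover have "bdd_below {max (SUP t\<in>{0..1}. \<bar>l t - t\<bar>) (SUP t\<in>{0..1}. \<bar>f t - g (l t)\<bar>) | l. l \<in> timechanges}"
  proof (rule bdd_belowI[where m=0])
    fix y assume "y \<in> {max (SUP t\<in>{0..1}. \<bar>l t - t\<bar>) (SUP t\<in>{0..1}. \<bar>f t - g (l t)\<bar>) | l. l \<in> timechanges}"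
    then obtain l where l: "l \<in> timechanges" and y: "y = max (SUP t\<in>{0..1}. \<bar>l t - t\<bar>) (SUP t\<in>{0..1}. \<bar>f t - g (l t)\<bar>)" by auto
    have "bdd_above ((\<lambda>t. \<bar>l t - t\<bar>) ` {0..1})"
      using timechanges_range[OF l] by (intro bdd_aboveI[where M=1]) (fastforce simp: abs_le_iff)
    then have "\<bar>l 0 - 0\<bar> \<le> (SUP t\<in>{0..1}. \<bar>l t - t\<bar>)" by (intro cSUP_upper) auto
    then show "0 \<le> y" unfolding y by linarith
  qed
  ultimately show ?thesis unfolding sk_dist_def using l by (intro cInf_lower2) auto
qed

lemma id_timechange: "(\<lambda>t. t) \<in> timechanges"
  by (auto simp: timechanges_def strict_mono_on_def)

lemma sk_dist_le_sup:
  assumes "r \<ge> 0" "\<And>t. t \<in> {0..1} \<Longrightarrow> \<bar>f t - g t\<bar> \<le> r" shows "sk_dist f g \<le> r"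
  using assms by (intro sk_dist_le[OF id_timechange]) auto

section \<open>Grid approximation in the Skorokhod distance\<close>

definition gridup :: "nat \<Rightarrow> real \<Rightarrow> real" where
  "gridup m a = of_int \<lceil>real m * a\<rceil> / real m"

lemma gridup_bounds:
  assumes "m \<ge> 1" shows "a \<le> gridup m a" "gridup m a < a + 1 / real m"
proof -
  have m: "real m > 0" using assms by simp
  have "real m * a \<le> of_int \<lceil>real m * a\<rceil>" by simp
  then show "a \<le> gridup m a" using m by (simp add: gridup_def field_simps)
  have "of_int \<lceil>real m * a\<rceil> < real m * a + 1" by linarith
  then show "gridup m a < a + 1 / real m" using m by (simp add: gridup_def field_simps)
qed

text \<open>The values are compared on the half-open interval only, since a cadlag path may jump at
  \<open>b\<close>, whose value belongs to the next piece. Fixing both ends at rounded points lets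
  adjacent pieces be glued.\<close>

abbreviation matching :: "(real \<Rightarrow> real) \<Rightarrow> real \<Rightarrow> nat \<Rightarrow> real \<Rightarrow> real \<Rightarrow> (real \<Rightarrow> real) \<Rightarrow> bool" where
  "matching f e m a b l \<equiv> strict_mono_on {a..b} l \<and> continuous_on {a..b} l \<and>
     l a = gridup m a \<and> l b = gridup m b \<and> (\<forall>t\<in>{a..b}. \<bar>l t - t\<bar> \<le> 1 / real m) \<and>
     (\<forall>t\<in>{a..<b}. \<bar>f t - discretize m f (l t)\<bar> \<le> e)"

text \<open>The guard makes the predicate true on intervals that leave [0,1]; the local condition of
  \<open>Bolzano\<close> tests those as well.\<close>

definition matched :: "(real \<Rightarrow> real) \<Rightarrow> real \<Rightarrow> real \<Rightarrow> real \<Rightarrow> bool" where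
  "matched f e a b \<longleftrightarrow> (0 \<le> a \<and> b \<le> 1 \<longrightarrow> (\<exists>M. \<forall>m\<ge>M. \<exists>l. matching f e m a b l))"

lemma matched_trans:
  assumes "matched f e a b" "matched f e b c" and abc: "a \<le> b" "b \<le> c"
  shows "matched f e a c"
  unfolding matched_def
proof
  assume "0 \<le> a \<and> c \<le> 1"
  then have "0 \<le> a \<and> b \<le> 1" "0 \<le> b \<and> c \<le> 1" using abc by auto
  then obtain M1 M2 where
    M1: "\<And>m. m \<ge> M1 \<Longrightarrow> \<exists>l. matching f e m a b l" and
    M2: "\<And>m. m \<ge> M2 \<Longrightarrow> \<exists>l. matching f e m b c l"
    using assms(1,2) unfolding matched_def by blast
  show "\<exists>M. \<forall>m\<ge>M. \<exists>l. matching f e m a c l"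
  proof (intro exI[of _ "max M1 M2"] allI impI)
    fix m assume "m \<ge> max M1 M2"
    then have "m \<ge> M1" "m \<ge> M2" by auto
    from M1[OF this(1)] M2[OF this(2)] obtain l1 l2 where
      l1: "strict_mono_on {a..b} l1" "continuous_on {a..b} l1" "l1 a = gridup m a" "l1 b = gridup m b"
        "\<forall>t\<in>{a..b}. \<bar>l1 t - t\<bar> \<le> 1 / real m" "\<forall>t\<in>{a..<b}. \<bar>f t - discretize m f (l1 t)\<bar> \<le> e" and
      l2: "strict_mono_on {b..c} l2" "continuous_on {b..c} l2" "l2 b = gridup m b" "l2 c = gridup m c"
        "\<forall>t\<in>{b..c}. \<bar>l2 t - t\<bar> \<le> 1 / real m" "\<forall>t\<in>{b..<c}. \<bar>f t - discretize m f (l2 t)\<bar> \<le> e"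
      by auto
    define l where "l t = (if t \<le> b then l1 t else l2 t)" for t
    have lb: "l t = l2 t" if "t \<ge> b" for t using that l1(4) l2(3) by (cases "t = b") (auto simp: l_def)
    have "strict_mono_on {a..c} l"
    proof (rule strict_mono_onI)
      fix r s assume rs: "r \<in> {a..c}" "s \<in> {a..c}" "r < s"
      consider "s \<le> b" | "b \<le> r" | "r < b" "b < s" by linarith
      then show "l r < l s"
      proof cases
        case 1
        then show ?thesis using strict_mono_onD[OF l1(1), of r s] rs by (simp add: l_def)
      next
        case 2
        then show ?thesis using strict_mono_onD[OF l2(1), of r s] rs by (simp add: lb)
      next
        case 3
        then have "l1 r < l1 b" using strict_mono_onD[OF l1(1), of r b] rs by simp
        moreover have "l2 b < l2 s" using strict_mono_onD[OF l2(1), of b s] rs 3 by simp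
        ultimately show ?thesis using 3 l1(4) l2(3) by (simp add: l_def)
      qed
    qed
    moreover have "continuous_on {a..c} l"
    proof -
      have "continuous_on ({a..b} \<union> {b..c}) l"
      proof (rule continuous_on_closed_Un)
        show "continuous_on {a..b} l" using l1(2) by (rule continuous_on_eq) (auto simp: l_def)
        show "continuous_on {b..c} l" using l2(2) by (rule continuous_on_eq) (auto simp: lb)
      qed auto
      then show ?thesis using abc by (simp add: ivl_disj_un_two_touch)
    qed
    moreover have "l a = gridup m a" using l1 abc by (simp add: l_def)
    moreover have "l c = gridup m c" using l2 abc lb by simp
    moreover have "\<forall>t\<in>{a..c}. \<bar>l t - t\<bar> \<le> 1 / real m" using l1(5) l2(5) by (auto simp: l_def)
    moreover have "\<forall>t\<in>{a..<c}. \<bar>f t - discretize m f (l t)\<bar> \<le> e"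
    proof
      fix t assume "t \<in> {a..<c}"
      then show "\<bar>f t - discretize m f (l t)\<bar> \<le> e" using l1(6) l2(6) lb by (cases "t < b") (auto simp: l_def)
    qed
    ultimately show "\<exists>l. matching f e m a c l" by blast
  qed
qed

text \<open>The time change moves $a$ and $b$ up to the next grid point, so a point and its image are
  both evaluated inside the same interval $[a,b)$.\<close>
lemma matched_oscillation:
  assumes ab: "a \<le> b" and osc: "\<And>s t. s \<in> {a..<b} \<Longrightarrow> t \<in> {a..<b} \<Longrightarrow> 0 \<le> s \<Longrightarrow> t \<le> 1 \<Longrightarrow> \<bar>f s - f t\<bar> \<le> e"
  shows "matched f e a b"
  unfolding matched_def
proof
  assume r: "0 \<le> a \<and> b \<le> 1"
  show "\<exists>M. \<forall>m\<ge>M. \<exists>l. matching f e m a b l"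
  proof (cases "a = b")
    case True
    show ?thesis
    proof (intro exI[of _ 1] allI impI)
      fix m :: nat assume m: "m \<ge> 1"
      show "\<exists>l. matching f e m a b l"
        by (rule exI[of _ "\<lambda>_. gridup m a"])
          (use True gridup_bounds[OF m, of a] in \<open>auto simp: strict_mono_on_def abs_le_iff\<close>)
    qed
  next
    case False
    then have ab': "a < b" using ab by simp
    \<comment> \<open>With a mesh below \<open>b - a\<close> the endpoints are rounded to different
      grid points, so the affine time change is strictly increasing.\<close>
    obtain M where M: "real M > 1 / (b - a)" using reals_Archimedean2 by blast
    have Mpos: "M \<ge> 1"
    proof -
      have "1 / (b - a) > 0" using ab' by simp
      with M have "real M > 0" by linarith
      then show ?thesis by simp
    qed
    show ?thesis
    proof (intro exI[of _ M] allI impI)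
      fix m assume "m \<ge> M"
      then have m: "m \<ge> 1" and mM: "real m \<ge> real M" using Mpos by auto
      have m0: "real m > 0" using m by simp
      define sa where "sa = gridup m a"
      define sb where "sb = gridup m b"
      have sa: "a \<le> sa" "sa < a + 1 / real m" and sb: "b \<le> sb" "sb < b + 1 / real m"
        using gridup_bounds[OF m] by (auto simp: sa_def sb_def)
      have "1 / (b - a) < real m" using M mM by linarith
      then have "1 / real m < b - a" using ab' m0 by (simp add: divide_less_eq mult.commute)
      then have sab: "sa < sb" using sa sb by linarith
      define q where "q = (sb - sa) / (b - a)"
      have q: "q > 0" using sab ab' by (simp add: q_def)
      define l where "l t = sa + (t - a) * q" for t
      have la: "l a = sa" by (simp add: l_def)
      have lb: "l b = sb" using ab' by (simp add: l_def q_def)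
      have mono: "l s < l t" if "s < t" for s t using that q by (simp add: l_def)
      have close: "\<bar>l t - t\<bar> \<le> 1 / real m" if t: "t \<in> {a..b}" for t
      proof -
        define \<theta> where "\<theta> = (t - a) / (b - a)"
        have \<theta>: "0 \<le> \<theta>" "\<theta> \<le> 1" using t ab' by (auto simp: \<theta>_def field_simps)
        have ta: "t - a = \<theta> * (b - a)" using ab' by (simp add: \<theta>_def)
        have "(t - a) * q = \<theta> * (sb - sa)" using ab' by (simp add: \<theta>_def q_def)
        then have "l t - t = (sa + \<theta> * (sb - sa)) - (a + \<theta> * (b - a))" using ta unfolding l_def by linarith
        \<comment> \<open>The displacement of an affine map is the convex combination of its
          displacements at the two ends, each between 0 and the mesh.\<close>
        then have "l t - t = (1 - \<theta>) * (sa - a) + \<theta> * (sb - b)" by (simp add: algebra_simps)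
        moreover have "0 \<le> (1 - \<theta>) * (sa - a)" using \<theta> sa by (intro mult_nonneg_nonneg) auto
        moreover have "(1 - \<theta>) * (sa - a) \<le> (1 - \<theta>) * (1 / real m)"
          by (rule mult_left_mono) (use \<theta> sa in linarith)+
        moreover have "0 \<le> \<theta> * (sb - b)" using \<theta> sb by (intro mult_nonneg_nonneg) auto
        moreover have "\<theta> * (sb - b) \<le> \<theta> * (1 / real m)"
          by (rule mult_left_mono) (use \<theta> sb in linarith)+
        moreover have "(1 - \<theta>) * x + \<theta> * x = x" for x by (simp add: algebra_simps)
        then have "(1 - \<theta>) * (1 / real m) + \<theta> * (1 / real m) = 1 / real m" .
        ultimately show ?thesis by linarith
      qed
      have val: "\<bar>f t - discretize m f (l t)\<bar> \<le> e" if t: "t \<in> {a..<b}" for t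
      proof -
        have lt: "sa \<le> l t" "l t < sb" using mono[of a t] mono[of t b] t la lb by (cases "t = a"; simp)+
        have "sb \<le> 1"
        proof -
          have "\<lceil>real m * b\<rceil> \<le> int m" using r m0 by (simp add: ceiling_le_iff)
          then have "real_of_int \<lceil>real m * b\<rceil> \<le> real m" by linarith
          then show ?thesis using m0 by (simp add: sb_def gridup_def)
        qed
        then have l01: "0 \<le> l t" "l t \<le> 1" using lt sa r by auto
        define k where "k = \<lfloor>real m * l t\<rfloor>"
        have k0: "k \<ge> 0" using l01 m0 by (simp add: k_def)
        have "of_int \<lceil>real m * a\<rceil> \<le> real m * l t" using lt(1) m0 by (simp add: sa_def gridup_def field_simps)
        then have ka: "\<lceil>real m * a\<rceil> \<le> k" by (simp add: k_def le_floor_iff)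
        have "real m * l t < of_int \<lceil>real m * b\<rceil>" using lt(2) m0 by (simp add: sb_def gridup_def field_simps)
        then have "k < \<lceil>real m * b\<rceil>" by (simp add: k_def floor_less_iff)
        then have "of_int k < real m * b" by (simp add: less_ceiling_iff)
        moreover have "real m * a \<le> of_int k" using ka by (simp add: ceiling_le_iff)
        ultimately have u: "of_int k / real m \<in> {a..<b}" using m0 by (simp add: field_simps)
        have "discretize m f (l t) = f (of_int k / real m)"
          using l01 k0 by (simp add: discretize_def stepf_def k_def)
        then show ?thesis using osc[OF t u] t u r by auto
      qed
      show "\<exists>l. matching f e m a b l"
      proof (intro exI[of _ l] conjI)
        show "strict_mono_on {a..b} l" using mono by (intro strict_mono_onI)
        show "continuous_on {a..b} l" unfolding l_def by (intro continuous_intros)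
      qed (use la lb close val in \<open>auto simp: sa_def sb_def\<close>)
    qed
  qed
qed

text \<open>One-sided limits give small oscillation on either side of every point, and the bisection
  lemma \<open>Bolzano\<close> turns this local property into a global matching. Near a jump the
  discretization is not uniformly close to \<open>f\<close>; the time change aligns the
  jumps.\<close>

lemma sk_dist_discretize:
  assumes f: "f \<in> Dsp"
  shows "e > 0 \<Longrightarrow> \<exists>M. \<forall>m\<ge>M. sk_dist f (discretize m f) \<le> e"
proof -
  assume e: "e > 0"
  have R: "\<And>t. t \<in> {0..<1} \<Longrightarrow> (f \<longlongrightarrow> f t) (at_right t)" and L: "\<And>t. t \<in> {0<..1} \<Longrightarrow> \<exists>l. (f \<longlongrightarrow> l) (at_left t)"
    using f by (auto simp: Dsp_def)
  have "matched f e 0 1"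
  proof (rule Bolzano[where P="matched f e"])
    show "matched f e a c" if "matched f e a b" "matched f e b c" "a \<le> b" "b \<le> c" for a b c
      using matched_trans that by blast
    fix x :: real assume x: "0 \<le> x" "x \<le> 1"
    have "\<exists>d>0. \<forall>a. a \<le> x \<and> x - a < d \<longrightarrow> matched f e a x"
    proof (cases "x = 0")
      case True
      then have "matched f e a x" if "a \<le> x" for a using that
        by (intro matched_oscillation) auto
      then show ?thesis by (intro exI[of _ 1]) auto
    next
      case False
      then obtain l where "(f \<longlongrightarrow> l) (at_left x)" using L[of x] x by auto
      then have "eventually (\<lambda>s. dist (f s) l < e / 2) (at_left x)" using e by (intro tendstoD) auto
      then obtain b where b: "b < x" "\<And>s. b < s \<Longrightarrow> s < x \<Longrightarrow> dist (f s) l < e / 2"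
        unfolding eventually_at_left_field by auto
      have "matched f e a x" if "a \<le> x" "x - a < x - b" for a
      proof (rule matched_oscillation[OF that(1)])
        fix s t assume "s \<in> {a..<x}" "t \<in> {a..<x}"
        then have "dist (f s) l < e / 2" "dist (f t) l < e / 2" using b(2) that by auto
        then show "\<bar>f s - f t\<bar> \<le> e" unfolding dist_real_def by linarith
      qed
      then show ?thesis using b(1) by (intro exI[of _ "x - b"]) auto
    qed
    then obtain d1 where d1: "d1 > 0" "\<And>a. a \<le> x \<Longrightarrow> x - a < d1 \<Longrightarrow> matched f e a x" by blast
    have "\<exists>d>0. \<forall>b. x \<le> b \<and> b - x < d \<longrightarrow> matched f e x b"
    proof (cases "x = 1")
      case True
      then have "matched f e x b" if "x \<le> b" for b
      proof (cases "b = x")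
        case True
        then show ?thesis by (intro matched_oscillation) auto
      next
        case False
        then show ?thesis using that \<open>x = 1\<close> by (simp add: matched_def)
      qed
      then show ?thesis by (intro exI[of _ 1]) auto
    next
      case False
      then have "(f \<longlongrightarrow> f x) (at_right x)" using R[of x] x by auto
      then have "eventually (\<lambda>s. dist (f s) (f x) < e / 2) (at_right x)" using e by (intro tendstoD) auto
      then obtain c where c: "x < c" "\<And>s. x < s \<Longrightarrow> s < c \<Longrightarrow> dist (f s) (f x) < e / 2"
        unfolding eventually_at_right_field by auto
      have c': "dist (f s) (f x) < e / 2" if "x \<le> s" "s < c" for s
        using c(2)[of s] that e by (cases "s = x") auto
      have "matched f e x b" if "x \<le> b" "b - x < c - x" for b
      proof (rule matched_oscillation[OF that(1)])
        fix s t assume "s \<in> {x..<b}" "t \<in> {x..<b}"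
        then have "dist (f s) (f x) < e / 2" "dist (f t) (f x) < e / 2" using c' that by auto
        then show "\<bar>f s - f t\<bar> \<le> e" unfolding dist_real_def by linarith
      qed
      then show ?thesis using c(1) by (intro exI[of _ "c - x"]) auto
    qed
    then obtain d2 where d2: "d2 > 0" "\<And>b. x \<le> b \<Longrightarrow> b - x < d2 \<Longrightarrow> matched f e x b" by blast
    show "\<exists>d>0. \<forall>a b. a \<le> x \<and> x \<le> b \<and> b - a < d \<longrightarrow> matched f e a b"
    proof (intro exI[of _ "min d1 d2"] conjI allI impI)
      fix a b assume "a \<le> x \<and> x \<le> b \<and> b - a < min d1 d2"
      then show "matched f e a b" using d1(2)[of a] d2(2)[of b] by (intro matched_trans[of f e a x b]) auto
    qed (use d1 d2 in auto)
  qed simp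
  then obtain M where M: "\<And>m. m \<ge> M \<Longrightarrow> \<exists>l. strict_mono_on {0..1} l \<and> continuous_on {0..1} l \<and>
     l 0 = gridup m 0 \<and> l 1 = gridup m 1 \<and> (\<forall>t\<in>{0..1}. \<bar>l t - t\<bar> \<le> 1 / real m) \<and>
     (\<forall>t\<in>{0..<1}. \<bar>f t - discretize m f (l t)\<bar> \<le> e)" unfolding matched_def by auto
  obtain K where K: "real K > 1 / e" using reals_Archimedean2 by blast
  show "\<exists>M. \<forall>m\<ge>M. sk_dist f (discretize m f) \<le> e"
  proof (intro exI[of _ "max 1 (max M K)"] allI impI)
    fix m assume "m \<ge> max 1 (max M K)"
    then have m: "m \<ge> 1" "m \<ge> M" "real m \<ge> real K" by auto
    have "1 / e < real m" using m K by linarith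
    then have me: "1 / real m \<le> e" using m e by (simp add: divide_less_eq divide_le_eq mult.commute)
    obtain l where l: "strict_mono_on {0..1} l" "continuous_on {0..1} l"
     "l 0 = gridup m 0" "l 1 = gridup m 1" "\<forall>t\<in>{0..1}. \<bar>l t - t\<bar> \<le> 1 / real m"
     "\<forall>t\<in>{0..<1}. \<bar>f t - discretize m f (l t)\<bar> \<le> e" using M[OF m(2)] by auto
    have g: "gridup m 0 = 0" "gridup m 1 = 1" using m(1) by (simp_all add: gridup_def)
    show "sk_dist f (discretize m f) \<le> e"
    proof (rule sk_dist_le)
      show "l \<in> timechanges" using l g by (simp add: timechanges_def)
      show "\<bar>l t - t\<bar> \<le> e" if "t \<in> {0..1}" for t using l(5) me that by force
      show "\<bar>f t - discretize m f (l t)\<bar> \<le> e" if "t \<in> {0..1}" for t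
      proof (cases "t = 1")
        case True
        have "discretize m f 1 = f 1" using m(1) by (simp add: discretize_def stepf_def)
        then show ?thesis using True l(4) g e by simp
      next
        case False
        then show ?thesis using l(6) that by auto
      qed
    qed
  qed
qed

section \<open>Continuity in the supremum norm and measurability\<close>

definition sup_continuous :: "((real \<Rightarrow> real) \<Rightarrow> real) \<Rightarrow> bool" where
  "sup_continuous h \<longleftrightarrow> (\<forall>f\<in>Dsp. \<forall>e>0. \<exists>d>0. \<forall>g\<in>Dsp. (\<forall>t\<in>{0..1}. \<bar>f t - g t\<bar> < d) \<longrightarrow> \<bar>h g - h f\<bar> < e)"

lemma sk_continuous_imp_sup: assumes "sk_continuous h" shows "sup_continuous h"
  unfolding sup_continuous_def
proof (intro ballI allI impI)
  fix f and e :: real assume "f \<in> Dsp" "e > 0"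
  then obtain d where d: "d > 0" "\<And>g. g \<in> Dsp \<Longrightarrow> sk_dist f g < d \<Longrightarrow> \<bar>h g - h f\<bar> < e"
    using assms unfolding sk_continuous_def by blast
  have "sk_dist f g < d" if "\<forall>t\<in>{0..1}. \<bar>f t - g t\<bar> < d / 2" for g
  proof -
    have "sk_dist f g \<le> d / 2" using that d(1) by (intro sk_dist_le_sup) (auto simp: less_imp_le)
    then show ?thesis using d(1) by simp
  qed
  then show "\<exists>d>0. \<forall>g\<in>Dsp. (\<forall>t\<in>{0..1}. \<bar>f t - g t\<bar> < d) \<longrightarrow> \<bar>h g - h f\<bar> < e"
    using d by (intro exI[of _ "d / 2"]) auto
qed

text \<open>On [0,1] the path \<open>stepf m x\<close> reads only the coordinates 0 to
  \<open>m\<close>, so a neighbourhood in the product topology controls the supremum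
  distance.\<close>

lemma continuous_stepf:
  assumes h: "sup_continuous h" and m: "m \<ge> 1"
  shows "continuous_on UNIV (\<lambda>x. h (stepf m x))"
proof -
  have "isCont (\<lambda>x. h (stepf m x)) x" for x
    unfolding isCont_def
  proof (rule tendstoI)
    fix e :: real assume "e > 0"
    then obtain d where d: "d > 0" "\<And>g. g \<in> Dsp \<Longrightarrow> \<forall>t\<in>{0..1}. \<bar>stepf m x t - g t\<bar> < d \<Longrightarrow> \<bar>h g - h (stepf m x)\<bar> < e"
      using h stepf_Dsp[OF m, of x] unfolding sup_continuous_def by blast
    have "\<forall>\<^sub>F y in at x. \<forall>j\<in>{..m}. \<bar>x j - y j\<bar> < d"
    proof (rule eventually_ball_finite)
      show "\<forall>j\<in>{..m}. \<forall>\<^sub>F y in at x. \<bar>x j - y j\<bar> < d"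
      proof
        fix j
        have "continuous_on UNIV (\<lambda>y::nat \<Rightarrow> real. y j)" by simp
        then have "((\<lambda>y. y j) \<longlongrightarrow> x j) (at x)" by (simp add: continuous_on_def)
        from tendstoD[OF this d(1)] show "\<forall>\<^sub>F y in at x. \<bar>x j - y j\<bar> < d"
          by (simp add: dist_real_def abs_minus_commute)
      qed
    qed simp
    then show "\<forall>\<^sub>F y in at x. dist (h (stepf m y)) (h (stepf m x)) < e"
    proof eventually_elim
      case (elim y)
      have "\<bar>stepf m x t - stepf m y t\<bar> < d" if t: "t \<in> {0..1}" for t
      proof -
        have "\<lfloor>real m * t\<rfloor> \<le> \<lfloor>real m * 1\<rfloor>" using t m by (intro floor_mono mult_left_mono) auto
        then have "nat \<lfloor>real m * t\<rfloor> \<le> m" by simp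
        then show ?thesis using elim t by (simp add: stepf_def)
      qed
      then show ?case using d(2)[OF stepf_Dsp[OF m]] by (simp add: dist_real_def)
    qed
  qed
  then show ?thesis by (simp add: continuous_at_imp_continuous_on)
qed

text \<open>\<open>h\<close> is the pointwise limit of its values on discretized paths, which are
  measurable functions of the sampled coordinates. Continuity in the supremum norm would not give
  this limit, as discretizations of a path with jumps need not converge uniformly.\<close>

lemma measurable_sk_continuous:
  assumes h: "sk_continuous h" and M: "space M = Dsp" "sets M = D_sets"
    and coord: "\<And>t. (\<lambda>f. f t) \<in> borel_measurable M"
  shows "h \<in> borel_measurable M"
proof (rule borel_measurable_LIMSEQ_real)
  fix f assume "f \<in> space M"
  then have f: "f \<in> Dsp" using M by simp
  show "(\<lambda>m. h (discretize (Suc m) f)) \<longlonglongrightarrow> h f"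
  proof (rule LIMSEQ_I)
    fix e :: real assume "e > 0"
    then obtain d where d: "d > 0" "\<And>g. g \<in> Dsp \<Longrightarrow> sk_dist f g < d \<Longrightarrow> \<bar>h g - h f\<bar> < e"
      using h f unfolding sk_continuous_def by blast
    obtain N where N: "\<And>m. m \<ge> N \<Longrightarrow> sk_dist f (discretize m f) \<le> d / 2"
      using sk_dist_discretize[OF f, of "d / 2"] d(1) by auto
    show "\<exists>no. \<forall>n\<ge>no. norm (h (discretize (Suc n) f) - h f) < e"
    proof (intro exI[of _ N] allI impI)
      fix n assume "n \<ge> N"
      then have "sk_dist f (discretize (Suc n) f) < d" using N[of "Suc n"] d(1) by simp
      moreover have "discretize (Suc n) f \<in> Dsp" unfolding discretize_def by (rule stepf_Dsp) simp
      ultimately show "norm (h (discretize (Suc n) f) - h f) < e" using d(2) by simp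
    qed
  qed
next
  fix m
  have "(\<lambda>x. h (stepf (Suc m) x)) \<in> borel_measurable borel"
    by (intro borel_measurable_continuous_onI continuous_stepf sk_continuous_imp_sup h) simp
  moreover have "(\<lambda>f j. f (real j / real (Suc m))) \<in> measurable M borel"
    by (rule measurable_coordinatewise_then_product) (rule coord)
  ultimately show "(\<lambda>f. h (discretize (Suc m) f)) \<in> borel_measurable M"
    unfolding discretize_def by (rule measurable_compose[rotated])
qed

section \<open>Convergence of the expectations\<close>

text \<open>The infimum of these values is the Pasch-Hausdorff envelope, for bounded
  \<open>h\<close> the largest minorant that is \<open>k\<close>-Lipschitz in the supremum norm.
  Letting \<open>r\<close> be any bound of the distance avoids suprema whose finiteness would have
  to be shown.\<close>

abbreviation infconv_vals :: "((real \<Rightarrow> real) \<Rightarrow> real) \<Rightarrow> real \<Rightarrow> (real \<Rightarrow> real) \<Rightarrow> real set" where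
  "infconv_vals h k f \<equiv> {h g + k * r | g r. g \<in> Dsp \<and> (\<forall>t\<in>{0..1}. \<bar>f t - g t\<bar> \<le> r)}"

definition infconv :: "((real \<Rightarrow> real) \<Rightarrow> real) \<Rightarrow> real \<Rightarrow> (real \<Rightarrow> real) \<Rightarrow> real" where
  "infconv h k f = Inf (infconv_vals h k f)"

context
  fixes h :: "(real \<Rightarrow> real) \<Rightarrow> real" and B k :: real
  assumes B: "\<And>f. f \<in> Dsp \<Longrightarrow> \<bar>h f\<bar> \<le> B" and k: "k \<ge> 0"
begin

lemma infconv_lower:
  assumes "y \<in> infconv_vals h k f" shows "- B \<le> y"
proof -
  obtain g r where g: "g \<in> Dsp" "\<forall>t\<in>{0..1}. \<bar>f t - g t\<bar> \<le> r" and y: "y = h g + k * r" using assms by auto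
  have "r \<ge> 0" using g(2) by (metis abs_ge_zero atLeastAtMost_iff order.trans zero_le_one order_refl)
  then have "k * r \<ge> 0" using k by simp
  then show ?thesis using B[OF g(1)] y by linarith
qed

lemma infconv_le:
  assumes "g \<in> Dsp" "\<And>t. t \<in> {0..1} \<Longrightarrow> \<bar>f t - g t\<bar> \<le> r" shows "infconv h k f \<le> h g + k * r"
proof -
  have "h g + k * r \<in> infconv_vals h k f" using assms by blast
  then show ?thesis unfolding infconv_def by (rule cInf_lower[OF _ bdd_belowI[OF infconv_lower]])
qed

lemma infconv_le_self: "f \<in> Dsp \<Longrightarrow> infconv h k f \<le> h f"
  using infconv_le[of f f 0] by simp

lemma infconv_ge:
  assumes "f \<in> Dsp" shows "- B \<le> infconv h k f"
  unfolding infconv_def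
proof (rule cInf_greatest)
  have "h f + k * 0 \<in> infconv_vals h k f" using assms by force
  then show "infconv_vals h k f \<noteq> {}" by blast
qed (rule infconv_lower)

lemma infconv_abs_le: "f \<in> Dsp \<Longrightarrow> \<bar>infconv h k f\<bar> \<le> B"
  using infconv_ge[of f] infconv_le_self[of f] B[of f] by linarith

lemma infconv_Lipschitz:
  assumes f: "f \<in> Dsp" and s: "\<And>t. t \<in> {0..1} \<Longrightarrow> \<bar>f t - f' t\<bar> \<le> s"
  shows "infconv h k f' \<le> infconv h k f + k * s"
proof -
  have "infconv h k f' - k * s \<le> infconv h k f"
    unfolding infconv_def[of h k f]
  proof (rule cInf_greatest)
    have "h f + k * 0 \<in> infconv_vals h k f" using f by force
    then show "infconv_vals h k f \<noteq> {}" by blast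
  next
    fix y assume "y \<in> infconv_vals h k f"
    then obtain g r where g: "g \<in> Dsp" "\<forall>t\<in>{0..1}. \<bar>f t - g t\<bar> \<le> r" and y: "y = h g + k * r" by blast
    have "infconv h k f' \<le> h g + k * (r + s)"
    proof (rule infconv_le[OF g(1)])
      fix t :: real assume t: "t \<in> {0..1}"
      show "\<bar>f' t - g t\<bar> \<le> r + s" using bspec[OF g(2) t] s[OF t] by linarith
    qed
    then show "infconv h k f' - k * s \<le> y" by (simp add: y algebra_simps)
  qed
  then show ?thesis by simp
qed

lemma infconv_sup_continuous: "sup_continuous (infconv h k)"
  unfolding sup_continuous_def
proof (intro ballI allI impI)
  fix f and e :: real assume f: "f \<in> Dsp" and e: "e > 0"
  show "\<exists>d>0. \<forall>g\<in>Dsp. (\<forall>t\<in>{0..1}. \<bar>f t - g t\<bar> < d) \<longrightarrow> \<bar>infconv h k g - infconv h k f\<bar> < e"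
  proof (intro exI[of _ "e / (k + 1)"] conjI ballI impI)
    show "e / (k + 1) > 0" using e k by simp
    fix g assume g: "g \<in> Dsp" "\<forall>t\<in>{0..1}. \<bar>f t - g t\<bar> < e / (k + 1)"
    have 1: "infconv h k g \<le> infconv h k f + k * (e / (k + 1))"
      using g(2) by (intro infconv_Lipschitz[OF f]) (auto simp: less_imp_le)
    have 2: "infconv h k f \<le> infconv h k g + k * (e / (k + 1))"
      using g(2) by (intro infconv_Lipschitz[OF g(1)]) (auto simp: less_imp_le abs_minus_commute)
    have "k * (e / (k + 1)) < e" using e k by (simp add: field_simps)
    then show "\<bar>infconv h k g - infconv h k f\<bar> < e" using 1 2 by linarith
  qed
qed

end

lemma infconv_approx:
  assumes B: "\<And>f. f \<in> Dsp \<Longrightarrow> \<bar>h f\<bar> \<le> B" and h: "sup_continuous h" and f: "f \<in> Dsp"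
  shows "(\<lambda>k. infconv h (real k) f) \<longlonglongrightarrow> h f"
proof (rule LIMSEQ_I)
  fix e :: real assume e: "e > 0"
  then have "e / 2 > 0" by simp
  then obtain d where d: "d > 0" "\<And>g. g \<in> Dsp \<Longrightarrow> \<forall>t\<in>{0..1}. \<bar>f t - g t\<bar> < d \<Longrightarrow> \<bar>h g - h f\<bar> < e / 2"
    using h f unfolding sup_continuous_def by blast
  \<comment> \<open>From here on a competitor at distance at least \<open>d\<close> pays a penalty
    above \<open>2 * B\<close>, more than \<open>h\<close> can gain; closer competitors change
    \<open>h\<close> by less than \<open>e / 2\<close>.\<close>
  obtain K where K: "real K > 2 * B / d" using reals_Archimedean2 by blast
  show "\<exists>no. \<forall>k\<ge>no. norm (infconv h (real k) f - h f) < e"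
  proof (intro exI[of _ K] allI impI)
    fix k assume "k \<ge> K"
    then have "real k > 2 * B / d" using K by linarith
    then have kd: "real k * d > 2 * B" using d(1) by (simp add: divide_less_eq)
    have "h f - e / 2 \<le> infconv h (real k) f"
      unfolding infconv_def
    proof (rule cInf_greatest)
      have "h f + real k * 0 \<in> infconv_vals h (real k) f" using f by force
      then show "infconv_vals h (real k) f \<noteq> {}" by blast
    next
      fix y assume "y \<in> infconv_vals h (real k) f"
      then obtain g r where g: "g \<in> Dsp" "\<forall>t\<in>{0..1}. \<bar>f t - g t\<bar> \<le> r" and y: "y = h g + real k * r" by auto
      have "\<bar>f 0 - g 0\<bar> \<le> r" using g(2) by simp
      then have r: "r \<ge> 0" by linarith
      show "h f - e / 2 \<le> y"
      proof (cases "r < d")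
        case True
        then have "\<bar>h g - h f\<bar> < e / 2" using g by (intro d(2)) force+
        moreover have "real k * r \<ge> 0" using r by simp
        ultimately show ?thesis using y by linarith
      next
        case False
        then have "real k * d \<le> real k * r" by (intro mult_left_mono) auto
        then show ?thesis using y B[OF g(1)] B[OF f] kd e by linarith
      qed
    qed
    moreover have "infconv h (real k) f \<le> h f" using B f by (intro infconv_le_self) auto
    ultimately show "norm (infconv h (real k) f - h f) < e" using e by simp
  qed
qed

section \<open>Paths rebuilt from finitely many squared values\<close>

definition truncl :: "real \<Rightarrow> real \<Rightarrow> real" where
  "truncl K u = sqrt (- ln (max u (exp (- K\<^sup>2))))"

lemma truncl_exp: "K \<ge> 0 \<Longrightarrow> truncl K (exp (- y\<^sup>2)) = min \<bar>y\<bar> K"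
proof -
  assume K: "K \<ge> 0"
  have "max (exp (- y\<^sup>2)) (exp (- K\<^sup>2)) = exp (- min (y\<^sup>2) (K\<^sup>2))" by (auto simp: max_def min_def)
  then have "truncl K (exp (- y\<^sup>2)) = sqrt (min (y\<^sup>2) (K\<^sup>2))" by (simp add: truncl_def)
  also have "min (y\<^sup>2) (K\<^sup>2) = (min \<bar>y\<bar> K)\<^sup>2"
  proof (cases "\<bar>y\<bar> \<le> K")
    case True
    then have "y\<^sup>2 \<le> K\<^sup>2" using abs_le_square_iff[of y K] K by simp
    then show ?thesis using True by (simp add: min_def)
  next
    case False
    then have "K\<^sup>2 \<le> y\<^sup>2" using abs_le_square_iff[of K y] K by simp
    then show ?thesis using False by (simp add: min_def)
  qed
  finally show ?thesis using K by simp
qed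

lemma continuous_truncl: "continuous_on UNIV (truncl K)"
proof -
  have "max u (exp (- K\<^sup>2)) \<noteq> 0" for u :: real using exp_gt_zero[of "- K\<^sup>2"] by (smt (verit))
  then show ?thesis unfolding truncl_def[abs_def] by (intro continuous_intros) auto
qed

text \<open>The cube carries only the interior grid times, hence the index \<open>j - 1\<close>; the
  values at indices 0 and \<open>m\<close> are set to 0, as the excursion vanishes at both ends.
  Mesh and truncation height share the single parameter \<open>m\<close>.\<close>

definition embed_grid :: "nat \<Rightarrow> (nat \<Rightarrow> real) \<Rightarrow> real \<Rightarrow> real" where
  "embed_grid m u = stepf m (\<lambda>j. if 1 \<le> j \<and> j < m then truncl (real m) (u (j - 1)) else 0)"

definition gridf :: "nat \<Rightarrow> (nat \<Rightarrow> real) \<Rightarrow> real \<Rightarrow> real" where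
  "gridf m y = stepf m (\<lambda>j. if 1 \<le> j \<and> j < m then min \<bar>y j\<bar> (real m) else 0)"

abbreviation sample :: "nat \<Rightarrow> (real \<Rightarrow> real) \<Rightarrow> real \<Rightarrow> real" where
  "sample m f \<equiv> gridf m (\<lambda>j. f (real j / real m))"

abbreviation gridproc :: "nat \<Rightarrow> nat \<Rightarrow> nat list \<Rightarrow> real \<Rightarrow> real" where
  "gridproc m n p \<equiv> gridf m (\<lambda>j. Yv n p (nat \<lfloor>real j / real m * real n\<rfloor>))"

lemma gridf_Dsp: "m \<ge> 1 \<Longrightarrow> gridf m y \<in> Dsp"
  unfolding gridf_def by (rule stepf_Dsp)

text \<open>This is \<open>fidi_convergence\<close> at the \<open>m - 1\<close> interior grid times
  for the function \<open>H\<close> after \<open>embed_grid\<close>, which is continuous because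
  \<open>H\<close> is continuous in the supremum norm; \<open>m \<ge> 2\<close> provides at least
  one such time.\<close>

lemma gridf_convergence:
  assumes M: "brownian_excursion M" and m: "m \<ge> 2" and H: "sup_continuous H"
  shows "(\<lambda>f. H (sample m f)) \<in> borel_measurable M"
    and "(\<lambda>n. PE n (\<lambda>p. H (gridproc m n p)))
      \<longlonglongrightarrow> (\<integral>f. H (sample m f) \<partial>M)"
proof -
  define t where "t i = real (Suc i) / real m" for i
  have m1: "m - 1 \<ge> 1" "m \<ge> 1" using m by auto
  have t: "\<And>i. i < m - 1 \<Longrightarrow> 0 < t i \<and> t i < 1" "\<And>i j. i < j \<Longrightarrow> j < m - 1 \<Longrightarrow> t i < t j"
    using m by (auto simp: t_def field_simps)
  have cont: "continuous_on (cube (m - 1)) (\<lambda>u. H (embed_grid m u))"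
  proof -
    have "continuous_on (cube (m - 1)) ((\<lambda>x. H (stepf m x)) \<circ> (\<lambda>u j. if 1 \<le> j \<and> j < m then truncl (real m) (u (j - 1)) else 0))"
    proof (intro continuous_on_compose continuous_on_coordinatewise_then_product)
      fix j
      have "continuous_on UNIV (\<lambda>u::nat \<Rightarrow> real. truncl (real m) (u (j - 1)))"
        by (rule continuous_on_compose2[OF continuous_truncl]) auto
      then show "continuous_on (cube (m - 1)) (\<lambda>u. if 1 \<le> j \<and> j < m then truncl (real m) (u (j - 1)) else 0)"
        by (cases "1 \<le> j \<and> j < m") (auto intro: continuous_on_subset)
      show "continuous_on ((\<lambda>u j. if 1 \<le> j \<and> j < m then truncl (real m) (u (j - 1)) else 0) ` cube (m - 1)) (\<lambda>x. H (stepf m x))"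
        using continuous_stepf[OF H m1(2)] by (rule continuous_on_subset) simp
    qed
    then show ?thesis by (simp add: embed_grid_def o_def)
  qed
  have emb: "embed_grid m (\<lambda>j. if j < m - 1 then exp (- (y (Suc j))\<^sup>2) else 0) = gridf m y" for y
    unfolding embed_grid_def gridf_def
    by (rule arg_cong[where f="stepf m"], rule ext) (auto simp: truncl_exp)
  have V: "(\<lambda>f. H (embed_grid m (\<lambda>j. if j < m - 1 then exp (- (f (t j))\<^sup>2) else 0))) = (\<lambda>f. H (sample m f))"
  proof (rule ext)
    fix f show "H (embed_grid m (\<lambda>j. if j < m - 1 then exp (- (f (t j))\<^sup>2) else 0)) = H (sample m f)"
      unfolding t_def by (simp only: emb[of "\<lambda>j. f (real j / real m)"])
  qed
  have U: "(\<lambda>p. H (embed_grid m (\<lambda>j. if j < m - 1 then exp (- (Yv n p (nat \<lfloor>t j * real n\<rfloor>))\<^sup>2) else 0)))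
     = (\<lambda>p. H (gridproc m n p))" for n
  proof (rule ext)
    fix p show "H (embed_grid m (\<lambda>j. if j < m - 1 then exp (- (Yv n p (nat \<lfloor>t j * real n\<rfloor>))\<^sup>2) else 0)) =
        H (gridproc m n p)"
      unfolding t_def by (simp only: emb[of "\<lambda>j. Yv n p (nat \<lfloor>real j / real m * real n\<rfloor>)"])
  qed
  show "(\<lambda>f. H (sample m f)) \<in> borel_measurable M"
    using fidi_convergence(1)[OF M m1(1) _ _ cont, of t] t unfolding V by blast
  show "(\<lambda>n. PE n (\<lambda>p. H (gridproc m n p)))
      \<longlonglongrightarrow> (\<integral>f. H (sample m f) \<partial>M)"
    using fidi_convergence(2)[OF M m1(1) _ _ cont, of t] t unfolding V U by blast
qed

text \<open>Uniform continuity controls the rounding of time, and an \<open>m\<close> above the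
  maximum of \<open>f\<close> switches the truncation off. Nonnegativity and the zero boundary
  values undo the absolute value and the zeros put in by \<open>gridf\<close>.\<close>

lemma gridf_close:
  assumes f: "continuous_on {0..1} f" "f 0 = 0" "f 1 = 0" "\<forall>t\<in>{0..1}. f t \<ge> 0" and e: "e > (0::real)"
  shows "\<exists>m0. \<forall>m\<ge>m0. \<forall>t\<in>{0..1}. \<bar>f t - sample m f t\<bar> \<le> e"
proof -
  have "uniformly_continuous_on {0..1} f" using f(1) by (intro compact_uniformly_continuous) auto
  then obtain d where d: "d > 0" "\<And>s t. s \<in> {0..1} \<Longrightarrow> t \<in> {0..1} \<Longrightarrow> dist t s < d \<Longrightarrow> dist (f t) (f s) < e"
    using e unfolding uniformly_continuous_on_def by blast
  have "bounded (f ` {0..1})" using f(1) by (intro compact_imp_bounded compact_continuous_image) auto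
  then obtain K where "\<forall>y\<in>f ` {0..1}. norm y \<le> K" unfolding bounded_iff by blast
  then have K: "\<bar>f t\<bar> \<le> K" if "t \<in> {0..1}" for t using that by auto
  obtain m1 where m1: "real m1 > 1 / d" using reals_Archimedean2 by blast
  obtain m2 where m2: "real m2 > K" using reals_Archimedean2 by blast
  show ?thesis
  proof (intro exI[of _ "max 1 (max m1 m2)"] allI impI ballI)
    fix m :: nat and t :: real assume "m \<ge> max 1 (max m1 m2)" and t: "t \<in> {0..1}"
    then have m: "m \<ge> 1" "real m \<ge> real m1" "real m \<ge> real m2" by auto
    have m0: "real m > 0" using m by simp
    define j where "j = nat \<lfloor>real m * t\<rfloor>"
    have j1: "real j \<le> real m * t" "real m * t < real j + 1"
      using t m0 unfolding j_def by (auto simp: of_nat_nat)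
    have jm: "j \<le> m"
    proof -
      have "real m * t \<le> real m * 1" using t m0 by (intro mult_left_mono) auto
      then have "real j \<le> real m" using j1 by linarith
      then show ?thesis by simp
    qed
    define s where "s = real j / real m"
    have s: "s \<in> {0..1}" using jm m0 by (simp add: s_def)
    have "1 / d < real m" using m1 m by linarith
    then have "1 / real m < d" using d(1) m0 by (simp add: divide_less_eq mult.commute)
    moreover have "\<bar>t - s\<bar> < 1 / real m"
    proof -
      have "t - s = (real m * t - real j) / real m" using m0 by (simp add: s_def field_simps)
      moreover have "\<bar>real m * t - real j\<bar> < 1" using j1 by linarith
      ultimately show ?thesis using m0 by (simp add: divide_strict_right_mono)
    qed
    ultimately have "dist t s < d" by (simp add: dist_real_def)
    then have "\<bar>f t - f s\<bar> < e" using d(2)[OF s t] by (simp add: dist_real_def)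
    moreover have "sample m f t = f s"
    proof -
      have "f s \<le> real m" using K[OF s] m2 m by linarith
      then have "min \<bar>f s\<bar> (real m) = f s" using f(4) s by simp
      moreover have "f s = 0" if "\<not> (1 \<le> j \<and> j < m)"
      proof -
        have "j = 0 \<or> j = m" using that jm by auto
        then show ?thesis using f(2,3) m0 by (auto simp: s_def)
      qed
      ultimately show ?thesis using t unfolding gridf_def stepf_def j_def[symmetric] s_def by auto
    qed
    ultimately show "\<bar>f t - sample m f t\<bar> \<le> e" by simp
  qed
qed

section \<open>Comparing the process with its samples\<close>

lemma Fpi_eq: "length p = n \<Longrightarrow> x \<ge> 0 \<Longrightarrow> Fpi n p x = real (cnt (nat \<lfloor>real n * x\<rfloor>) p) / real n"
proof -
  assume p: "length p = n" and x: "x \<ge> 0"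
  have "real (p ! i) \<le> real n * x \<longleftrightarrow> p ! i \<le> nat \<lfloor>real n * x\<rfloor>" for i
    using x by (simp add: le_nat_iff le_floor_iff)
  then show ?thesis using cnt_eq_card[OF p, of "nat \<lfloor>real n * x\<rfloor>"] by (simp add: Fpi_def)
qed

lemma PF_length: "p \<in> PF n \<Longrightarrow> length p = n"
  by (simp add: PF_def)

lemma PFproc_Dsp:
  assumes n: "n \<ge> 1" and p: "p \<in> PF n" shows "PFproc n p \<in> Dsp"
proof -
  have "PFproc n p = (\<lambda>t. if t \<in> {0..1} then (\<lambda>k. sqrt n * (real (cnt k p) / real n)) (nat \<lfloor>real n * t\<rfloor>) + (- sqrt n) * t else 0)"
    by (rule ext) (auto simp: PFproc_def Fpi_eq[OF PF_length[OF p]] algebra_simps)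
  then show ?thesis using step_linear_Dsp[OF n, of "\<lambda>k. sqrt n * (real (cnt k p) / real n)" "- sqrt n"] by simp
qed

text \<open>The sampled index \<open>k'\<close> lies at most \<open>n / m + 1\<close> to the left of
  the floor \<open>k\<close> of \<open>n * x\<close>, which costs \<open>e\<close>; the fractional
  part of \<open>n * x\<close> costs at most 1 before scaling, hence \<open>1 / sqrt n\<close>. The
  bound \<open>sup\<close> switches the truncation off.\<close>

lemma PFproc_close:
  assumes n: "n \<ge> 1" and m: "m \<ge> 1" and p: "p \<in> PF n"
    and mod: "\<And>a b. a \<le> b \<Longrightarrow> b \<le> n \<Longrightarrow> real (b - a) \<le> real n / real m + 1 \<Longrightarrow> \<bar>Dv p b - Dv p a\<bar> \<le> e * sqrt n"
    and sup: "\<And>b. b \<le> n \<Longrightarrow> \<bar>Dv p b\<bar> \<le> real m * sqrt n"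
    and x: "x \<in> {0..1}"
  shows "\<bar>PFproc n p x - gridproc m n p x\<bar> \<le> e + 1 / sqrt n"
proof -
  have n0: "real n > 0" "sqrt n > 0" and m0: "real m > 0" using n m by auto
  define k where "k = nat \<lfloor>real n * x\<rfloor>"
  define j where "j = nat \<lfloor>real m * x\<rfloor>"
  define k' where "k' = nat \<lfloor>real j / real m * real n\<rfloor>"
  have k: "real k \<le> real n * x" "real n * x < real k + 1"
    using x n0 unfolding k_def by (auto simp: of_nat_nat)
  have j: "real j \<le> real m * x" "real m * x < real j + 1"
    using x m0 unfolding j_def by (auto simp: of_nat_nat)
  have k': "real k' \<le> real j / real m * real n" "real j / real m * real n < real k' + 1"
    unfolding k'_def by (auto simp: of_nat_nat)
  have kn: "k \<le> n"
  proof -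
    have "real n * x \<le> real n * 1" using x n0 by (intro mult_left_mono) auto
    then have "real k \<le> real n" using k by linarith
    then show ?thesis by simp
  qed
  have jm: "j \<le> m"
  proof -
    have "real m * x \<le> real m * 1" using x m0 by (intro mult_left_mono) auto
    then have "real j \<le> real m" using j by linarith
    then show ?thesis by simp
  qed
  have jx: "real j / real m * real n \<le> real n * x" using j m0 n0 by (simp add: field_simps)
  have k'k: "k' \<le> k" unfolding k'_def k_def using jx by (intro nat_mono floor_mono)
  have "real n * x \<le> real j / real m * real n + real n / real m"
  proof -
    have "real n * (real m * x) \<le> real n * (real j + 1)" using j n0 by (intro mult_left_mono) auto
    then show ?thesis using m0 by (simp add: field_simps)
  qed
  then have "real (k - k') \<le> real n / real m + 1" using k k' k'k by (simp add: of_nat_diff)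
  then have inc: "\<bar>Dv p k - Dv p k'\<bar> \<le> e * sqrt n" using mod[OF k'k kn] by simp
  have "PFproc n p x = (Dv p k - (real n * x - real k)) / sqrt n"
  proof -
    have "PFproc n p x = sqrt n * (real (cnt k p) / real n - x)"
      using x Fpi_eq[OF PF_length[OF p], of x] by (simp add: PFproc_def k_def)
    also have "\<dots> = (real (cnt k p) - real n * x) / sqrt n"
    proof -
      have "s * (c / (s * s) - x) = (c - s * s * x) / s" if "s \<noteq> 0" for s c :: real using that by (simp add: field_simps)
      from this[of "sqrt n" "real (cnt k p)"] show ?thesis using n0 by simp
    qed
    finally show ?thesis by (simp add: Dv_def)
  qed
  moreover have "gridproc m n p x = Dv p k' / sqrt n"
  proof (cases "1 \<le> j \<and> j < m")
    case True
    have Y: "Yv n p k' = Dv p k' / sqrt n"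
      using PF_cnt_ge[OF p, of k'] k'k kn by (simp add: Yv_def Dv_def of_nat_diff)
    have nn: "Dv p k' / sqrt n \<ge> 0" using PF_cnt_ge[OF p, of k'] k'k kn n0 by (simp add: Dv_def)
    have "Dv p k' \<le> real m * sqrt n" using sup[of k'] k'k kn by simp
    then have "Dv p k' / sqrt n \<le> real m" using n0 by (simp add: divide_le_eq)
    then have "min \<bar>Yv n p k'\<bar> (real m) = Dv p k' / sqrt n" unfolding Y abs_of_nonneg[OF nn] by (rule min_absorb1)
    then show ?thesis using True x unfolding gridf_def stepf_def j_def[symmetric] k'_def by simp
  next
    case False
    \<comment> \<open>In these two cases \<open>gridf\<close> returns 0 by definition, in agreement
      with \<open>Dv p 0 = 0\<close> and \<open>Dv p n = 0\<close>.\<close>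
    then have "j = 0 \<or> j = m" using jm by auto
    then have "k' = 0 \<or> k' = n" using m0 by (auto simp: k'_def)
    moreover have "Dv p 0 = 0"
    proof -
      have "filter (\<lambda>x. x \<le> 0) p = []" using p by (auto simp: PF_def filter_empty_conv)
      then show ?thesis by (simp add: Dv_def cnt_def)
    qed
    moreover have "Dv p n = 0" using cnt_top[OF PF_lsts(1)[OF p], of n] by (simp add: Dv_def)
    ultimately have "Dv p k' = 0" by auto
    then show ?thesis using False x unfolding gridf_def stepf_def j_def[symmetric] by auto
  qed
  ultimately have "PFproc n p x - gridproc m n p x
     = (Dv p k - Dv p k' - (real n * x - real k)) / sqrt n" by (simp add: diff_divide_distrib)
  also have "\<bar>\<dots>\<bar> \<le> (e * sqrt n + 1) / sqrt n"
  proof -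
    have "\<bar>Dv p k - Dv p k' - (real n * x - real k)\<bar> \<le> e * sqrt n + 1" using inc k by linarith
    then show ?thesis using n0 by (simp add: abs_divide divide_right_mono)
  qed
  also have "\<dots> = e + 1 / sqrt n" using n0 by (simp add: field_simps)
  finally show ?thesis .
qed

lemma dyadic_between:
  assumes "x \<ge> (1::real)" obtains J :: nat where "x \<le> 2 ^ J" "2 ^ J \<le> 2 * x"
proof -
  obtain N :: nat where "x < 2 ^ N" using real_arch_pow[of 2 x] by auto
  then have ex: "\<exists>J. x \<le> 2 ^ J" by (auto intro: less_imp_le)
  define J where "J = (LEAST J. x \<le> 2 ^ J)"
  have J: "x \<le> 2 ^ J" unfolding J_def using ex by (rule LeastI_ex)
  have "2 ^ J \<le> 2 * x"
  proof (cases J)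
    case 0 then show ?thesis using assms by simp
  next
    case (Suc i)
    then have "\<not> x \<le> 2 ^ i" using not_less_Least[of i "\<lambda>J. x \<le> 2 ^ J"] by (simp add: J_def)
    then show ?thesis using Suc by simp
  qed
  with J that show ?thesis by blast
qed

definition badset :: "nat \<Rightarrow> nat \<Rightarrow> real \<Rightarrow> nat list set" where
  "badset m n e = {p \<in> PF n. \<exists>x\<in>{0..1}. \<bar>PFproc n p x - gridproc m n p x\<bar> > e + 1 / sqrt n}"

abbreviation wideset :: "nat \<Rightarrow> real \<Rightarrow> real \<Rightarrow> nat list set" where
  "wideset n w e \<equiv> {q \<in> PF n. \<exists>a b. a \<le> b \<and> b \<le> n \<and> real (b - a) \<le> w \<and> \<bar>Dv q b - Dv q a\<bar> > e * sqrt n}"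

text \<open>The constant is 2000000 times 2 for \<open>Suc n \<le> 2 * n\<close>, times 2 for
  rounding \<open>w\<close> up to a power of two, times \<open>6^4\<close> from
  \<open>E = e * sqrt n / 6\<close>.\<close>

lemma PF_modulus_prob':
  assumes n: "n \<ge> 1" and e: "e > 0" and w: "1 \<le> w"
  shows "real (card (wideset n w e)) / real (card (PF n))
    \<le> 10368000000 * w / (e^4 * real n)"
proof -
  obtain J :: nat where J: "w \<le> 2 ^ J" "2 ^ J \<le> 2 * w" using dyadic_between[OF w] .
  define E where "E = e * sqrt n / 6"
  have E: "E > 0" using e n by (simp add: E_def)
  have E4: "E^4 = e^4 * real n ^ 2 / 1296"
  proof -
    have "sqrt (real n) ^ 4 = (sqrt (real n) * sqrt (real n)) ^ 2"
      by (simp only: power2_eq_square power4_eq_xxxx mult.assoc)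
    then show ?thesis by (simp add: E_def power_mult_distrib power_divide)
  qed
  have "real (card (wideset n w e))
     \<le> real (card {q \<in> PF n. wide q n (2^J) (6 * E)})"
  proof (intro of_nat_mono card_mono)
    show "finite {q \<in> PF n. wide q n (2^J) (6 * E)}" using finite_PF by simp
    have E6: "6 * E = e * sqrt n" by (simp add: E_def)
    show "wideset n w e
      \<subseteq> {q \<in> PF n. wide q n (2^J) (6 * E)}"
    proof
      fix q assume "q \<in> wideset n w e"
      then obtain a b where ab: "q \<in> PF n" "a \<le> b" "b \<le> n" "real (b - a) \<le> w" "\<bar>Dv q b - Dv q a\<bar> > e * sqrt n" by blast
      have "real (b - a) \<le> 2^J" using ab(4) J(1) by linarith
      also have "2^J = real (2^J)" by (simp only: of_nat_power of_nat_numeral)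
      finally have "b - a \<le> 2^J" by (simp only: of_nat_le_iff)
      then show "q \<in> {q \<in> PF n. wide q n (2^J) (6 * E)}"
        unfolding E6 using ab by blast
    qed
  qed
  then have "real (card (wideset n w e)) / real (card (PF n))
     \<le> real (card {q \<in> PF n. wide q n (2^J) (6 * E)}) / real (card (PF n))"
    by (intro divide_right_mono) auto
  also have "\<dots> \<le> 2000000 * real (Suc n) * 2^J / E^4" by (rule PF_modulus_prob[OF E])
  also have "\<dots> \<le> 2000000 * (2 * real n) * (2 * w) / E^4"
    using n J w E by (intro divide_right_mono mult_mono) auto
  also have "\<dots> = 10368000000 * w / (e^4 * real n)"
    unfolding E4 using n e by (simp add: field_simps power2_eq_square)
  finally show ?thesis .
qed

text \<open>By \<open>PFproc_close\<close> a bad path has either a large increment over a window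
  \<open>n / m + 1\<close> or a value beyond the truncation height, which is a large increment from
  0 over the window \<open>n\<close>. The probabilities are of order \<open>1 / (e^4 * m)\<close>
  and \<open>1 / m^4\<close>, uniformly in \<open>n \<ge> m\<close>; here
  \<open>n / m + 1 \<le> 2 * n / m\<close> doubles the constant.\<close>

lemma badset_prob:
  assumes m: "m \<ge> 1" and n: "n \<ge> m" and e: "e > 0"
  shows "real (card (badset m n e)) / real (card (PF n)) \<le> 20736000000 * (1 / e^4 + 1) / real m"
proof -
  have n1: "n \<ge> 1" and m0: "real m > 0" using m n by auto
  let ?w = "real n / real m + 1"
  have "badset m n e \<subseteq> wideset n ?w e \<union> wideset n (real n) (real m)"
  proof (rule ccontr)
    assume "\<not> ?thesis"
    then obtain p where p: "p \<in> badset m n e" "p \<notin> wideset n ?w e" "p \<notin> wideset n (real n) (real m)" by blast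
    have pP: "p \<in> PF n" using p(1) by (simp add: badset_def)
    have D0: "Dv p 0 = 0"
    proof -
      have "filter (\<lambda>x. x \<le> 0) p = []" using pP by (auto simp: PF_def filter_empty_conv)
      then show ?thesis by (simp add: Dv_def cnt_def)
    qed
    have "\<bar>PFproc n p x - gridproc m n p x\<bar> \<le> e + 1 / sqrt n"
      if "x \<in> {0..1}" for x
    proof (rule PFproc_close[OF n1 m pP _ _ that])
      show "\<bar>Dv p b - Dv p a\<bar> \<le> e * sqrt n" if "a \<le> b" "b \<le> n" "real (b - a) \<le> real n / real m + 1" for a b
      proof -
        have "\<not> (\<bar>Dv p b - Dv p a\<bar> > e * sqrt n)" using p(2) pP that by blast
        then show ?thesis by simp
      qed
      show "\<bar>Dv p b\<bar> \<le> real m * sqrt n" if "b \<le> n" for b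
      proof -
        have "\<not> (\<bar>Dv p b - Dv p 0\<bar> > real m * sqrt n)"
        proof
          assume c: "\<bar>Dv p b - Dv p 0\<bar> > real m * sqrt n"
          have "real (b - 0) \<le> real n" using that by simp
          then show False using p(3) pP that c le0[of b] by blast
        qed
        then show ?thesis using D0 by simp
      qed
    qed
    then show False using p(1) by (auto simp: badset_def not_less[symmetric])
  qed
  then have "card (badset m n e) \<le> card (wideset n ?w e \<union> wideset n (real n) (real m))"
    by (intro card_mono) (auto simp: finite_PF)
  also have "\<dots> \<le> card (wideset n ?w e) + card (wideset n (real n) (real m))" by (rule card_Un_le)
  finally have "real (card (badset m n e)) \<le> real (card (wideset n ?w e)) + real (card (wideset n (real n) (real m)))" by linarith
  then have "real (card (badset m n e)) / real (card (PF n)) \<le> real (card (wideset n ?w e)) / real (card (PF n)) + real (card (wideset n (real n) (real m))) / real (card (PF n))"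
    by (simp add: divide_right_mono flip: add_divide_distrib)
  also have "\<dots> \<le> 10368000000 * ?w / (e^4 * real n) + 10368000000 * real n / ((real m)^4 * real n)"
    using n1 e m0 by (intro add_mono PF_modulus_prob') auto
  also have "10368000000 * ?w / (e^4 * real n) \<le> 10368000000 * (2 * real n / real m) / (e^4 * real n)"
  proof -
    have "real n / real m \<ge> 1" using n m0 by simp
    then show ?thesis using e by (intro divide_right_mono mult_left_mono) auto
  qed
  also have "10368000000 * (2 * real n / real m) / (e^4 * real n) = 20736000000 * (1 / e^4) / real m"
    using n1 m0 by simp
  also have "10368000000 * real n / ((real m)^4 * real n) \<le> 20736000000 / real m"
  proof -
    have "real m ^ 1 \<le> real m ^ 4" using m by (intro power_increasing) auto
    then have "1 / real m ^ 4 \<le> 1 / real m" using m0 by (intro divide_left_mono) auto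
    moreover have "1 / real m \<ge> 0" by simp
    ultimately have "10368000000 * (1 / real m ^ 4) \<le> 20736000000 * (1 / real m)" by linarith
    then show ?thesis using n1 by simp
  qed
  finally show ?thesis by (simp add: add_divide_distrib distrib_left)
qed

lemma PE_mono: "(\<And>p. p \<in> PF n \<Longrightarrow> f p \<le> g p) \<Longrightarrow> PE n f \<le> PE n g"
  unfolding PE_def by (intro divide_right_mono sum_mono) auto

lemma PE_const: "PE n (\<lambda>_. c) = c"
  using card_PF_pos[of n] by (simp add: PE_def)

lemma PE_indicator: "A \<subseteq> PF n \<Longrightarrow> PE n (indicator A) = real (card A) / real (card (PF n))"
  unfolding PE_def using finite_PF[of n] by (simp add: indicator_def sum.If_cases Int_absorb1)

text \<open>Off the bad set the Lipschitz property costs \<open>k * (e + 1 / sqrt n)\<close> and the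
  envelope lies below \<open>h\<close>; on it both values lie between \<open>- B\<close> and
  \<open>B\<close>.\<close>

lemma PE_lower:
  assumes B: "\<And>f. f \<in> Dsp \<Longrightarrow> \<bar>h f\<bar> \<le> B" and k: "k \<ge> 0" and n: "n \<ge> 1" and m: "m \<ge> 1" and e: "e > 0"
  shows "PE n (\<lambda>p. infconv h k (gridproc m n p)) - k * (e + 1 / sqrt n)
    - 2 * B * (real (card (badset m n e)) / real (card (PF n))) \<le> PE n (\<lambda>p. h (PFproc n p))"
proof -
  let ?G = "\<lambda>p. gridproc m n p"
  have B0: "B \<ge> 0" using B[OF gridf_Dsp[OF m]] by (meson abs_ge_zero order.trans)
  have "PE n (\<lambda>p. infconv h k (?G p)) \<le> PE n (\<lambda>p. h (PFproc n p) + (k * (e + 1 / sqrt n) + 2 * B * indicator (badset m n e) p))"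
  proof (rule PE_mono)
    fix p assume p: "p \<in> PF n"
    have D: "PFproc n p \<in> Dsp" by (rule PFproc_Dsp[OF n p])
    have G: "?G p \<in> Dsp" by (rule gridf_Dsp[OF m])
    have ks: "k * (e + 1 / sqrt n) \<ge> 0" using k e by simp
    show "infconv h k (?G p) \<le> h (PFproc n p) + (k * (e + 1 / sqrt n) + 2 * B * indicator (badset m n e) p)"
    proof (cases "p \<in> badset m n e")
      case True
      have "infconv h k (?G p) \<le> B" "- B \<le> h (PFproc n p)"
        using infconv_abs_le[of h B k "?G p"] B k G B[OF D] by (auto simp: abs_le_iff)
      then show ?thesis using True ks by simp
    next
      case False
      then have "\<And>x. x \<in> {0..1} \<Longrightarrow> \<bar>PFproc n p x - ?G p x\<bar> \<le> e + 1 / sqrt n"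
        using p by (auto simp: badset_def not_less)
      then have "infconv h k (?G p) \<le> infconv h k (PFproc n p) + k * (e + 1 / sqrt n)"
        using B k D by (intro infconv_Lipschitz) auto
      moreover have "infconv h k (PFproc n p) \<le> h (PFproc n p)" using B k D by (intro infconv_le_self) auto
      ultimately show ?thesis using False by simp
    qed
  qed
  also have "\<dots> = PE n (\<lambda>p. h (PFproc n p)) + (k * (e + 1 / sqrt n) + 2 * B * (real (card (badset m n e)) / real (card (PF n))))"
    unfolding PE_add PE_const PE_cmult by (subst PE_indicator) (auto simp: badset_def)
  finally show ?thesis by simp
qed

text \<open>Two dominated convergences in succession: \<open>k\<close> is chosen first, so that the
  envelope has nearly the integral of \<open>h\<close>, and only then the sampling parameter
  \<open>m\<close>.\<close>

lemma excursion_infconv: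
  assumes M: "brownian_excursion M" and B: "\<And>f. f \<in> Dsp \<Longrightarrow> \<bar>h f\<bar> \<le> B" and h: "sk_continuous h" and e: "e > 0"
  obtains k :: nat and m0 where "\<And>m. m \<ge> m0 \<Longrightarrow> (\<integral>f. infconv h (real k) (sample m f) \<partial>M) \<ge> (\<integral>f. h f \<partial>M) - e"
proof -
  interpret prob_space M using brownian_excursionD[OF M] by simp
  have sp: "space M = Dsp" "sets M = D_sets" using brownian_excursionD[OF M] by auto
  have coord: "(\<lambda>f. f t) \<in> borel_measurable M" for t using measurable_coord[OF sp] .
  have hm: "h \<in> borel_measurable M" using measurable_sk_continuous[OF h sp coord] .
  have hs: "sup_continuous h" using sk_continuous_imp_sup[OF h] .
  define g where "g k m f = infconv h (real k) (sample (m + 2) f)" for k m :: nat and f :: "real \<Rightarrow> real"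
  have sc: "sup_continuous (infconv h (real k))" for k using B by (intro infconv_sup_continuous) auto
  have gm: "g k m \<in> borel_measurable M" for k m
    unfolding g_def using gridf_convergence(1)[OF M _ sc[of k], of "m + 2"] by simp
  have gB: "\<bar>g k m f\<bar> \<le> B" for k m f
    unfolding g_def using B by (intro infconv_abs_le gridf_Dsp) auto
  define u where "u k f = lim (\<lambda>m. g k m f)" for k f
  have um: "u k \<in> borel_measurable M" for k
    unfolding u_def[abs_def] by (rule borel_measurable_lim_metric) (rule gm)
  have AE_g: "AE f in M. f \<in> Dsp \<and> (\<forall>k. (\<lambda>m. g k m f) \<longlonglongrightarrow> infconv h (real k) f)"
    using excursion_nonneg[OF M] AE_space
  proof eventually_elim
    case (elim f)
    then have f: "f \<in> Dsp" using sp by simp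
    have "(\<lambda>m. g k m f) \<longlonglongrightarrow> infconv h (real k) f" for k
    proof (rule LIMSEQ_I)
      fix r :: real assume r: "r > 0"
      define s where "s = r / (2 * (real k + 1))"
      have s: "s > 0" using r by (simp add: s_def)
      have ks: "real k * s < r"
      proof -
        have "real k * s \<le> (real k + 1) * s" using s by (intro mult_right_mono) auto
        also have "\<dots> = r / 2"
        proof -
          have "c * (r / (2 * c)) = r / 2" if "c \<noteq> 0" for c using that by simp
          from this[of "real k + 1"] show ?thesis unfolding s_def by linarith
        qed
        finally show ?thesis using r by simp
      qed
      obtain m0 where m0: "\<And>m. m \<ge> m0 \<Longrightarrow> \<forall>t\<in>{0..1}. \<bar>f t - sample m f t\<bar> \<le> s"
        using gridf_close[of f s] elim s by auto
      show "\<exists>no. \<forall>m\<ge>no. norm (g k m f - infconv h (real k) f) < r"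
      proof (intro exI[of _ m0] allI impI)
        fix m assume "m \<ge> m0"
        then have c: "\<And>t. t \<in> {0..1} \<Longrightarrow> \<bar>f t - sample (m + 2) f t\<bar> \<le> s"
          using m0[of "m + 2"] by auto
        have "g k m f \<le> infconv h (real k) f + real k * s"
          unfolding g_def using B f c by (intro infconv_Lipschitz) auto
        moreover have "infconv h (real k) f \<le> g k m f + real k * s"
          unfolding g_def
        proof (rule infconv_Lipschitz[OF B])
          show "sample (m + 2) f \<in> Dsp" by (rule gridf_Dsp) simp
          show "\<bar>sample (m + 2) f t - f t\<bar> \<le> s" if "t \<in> {0..1}" for t
            using c[OF that] by (simp only: abs_minus_commute)
        qed auto
        ultimately show "norm (g k m f - infconv h (real k) f) < r" using ks by (simp add: abs_less_iff)
      qed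
    qed
    then show ?case using f by simp
  qed
  have AE_u: "AE f in M. f \<in> Dsp \<and> (\<forall>k. u k f = infconv h (real k) f)"
    using AE_g by eventually_elim (auto simp: u_def limI)
  have "(\<lambda>k. \<integral>f. u k f \<partial>M) \<longlonglongrightarrow> (\<integral>f. h f \<partial>M)"
  proof (rule integral_dominated_convergence[where w="\<lambda>_. B"])
    show "AE f in M. (\<lambda>k. u k f) \<longlonglongrightarrow> h f"
      using AE_u
    proof eventually_elim
      case (elim f)
      then show ?case using infconv_approx[of h B f] B hs by simp
    qed
    show "AE f in M. norm (u k f) \<le> B" for k
      using AE_u
    proof eventually_elim
      case (elim f)
      then show ?case using infconv_abs_le[of h B "real k" f] B by simp
    qed
  qed (use um hm in auto)
  then have "\<forall>\<^sub>F k in sequentially. dist (\<integral>f. u k f \<partial>M) (\<integral>f. h f \<partial>M) < e / 2" using e by (intro tendstoD) auto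
  then obtain k where k: "dist (\<integral>f. u k f \<partial>M) (\<integral>f. h f \<partial>M) < e / 2" unfolding eventually_sequentially by blast
  have "(\<lambda>m. \<integral>f. g k m f \<partial>M) \<longlonglongrightarrow> (\<integral>f. u k f \<partial>M)"
  proof (rule integral_dominated_convergence[where w="\<lambda>_. B"])
    show "AE f in M. (\<lambda>m. g k m f) \<longlonglongrightarrow> u k f"
      using AE_u AE_g by eventually_elim simp
  qed (use um gm gB in auto)
  then have "\<forall>\<^sub>F m in sequentially. dist (\<integral>f. g k m f \<partial>M) (\<integral>f. u k f \<partial>M) < e / 2" using e by (intro tendstoD) auto
  then obtain m1 where m1: "\<And>m. m \<ge> m1 \<Longrightarrow> dist (\<integral>f. g k m f \<partial>M) (\<integral>f. u k f \<partial>M) < e / 2"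
    unfolding eventually_sequentially by blast
  show thesis
  proof (rule that[of "m1 + 2" k])
    fix m assume m: "m \<ge> m1 + 2"
    then have mm: "m - 2 + 2 = m" by simp
    have "dist (\<integral>f. g k (m - 2) f \<partial>M) (\<integral>f. u k f \<partial>M) < e / 2" using m by (intro m1) auto
    then have "(\<integral>f. g k (m - 2) f \<partial>M) \<ge> (\<integral>f. h f \<partial>M) - e" using k unfolding dist_real_def by linarith
    then show "(\<integral>f. infconv h (real k) (sample m f) \<partial>M) \<ge> (\<integral>f. h f \<partial>M) - e"
      unfolding g_def mm .
  qed
qed

text \<open>The parameters are fixed in the order \<open>k\<close>, tolerance \<open>d\<close>,
  sampling parameter \<open>m\<close>, and last \<open>n\<close>. The five shares
  \<open>e / 5\<close> pay for \<open>excursion_infconv\<close>, the convergence in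
  \<open>n\<close>, the term \<open>k * d\<close>, the term \<open>k / sqrt n\<close>, and the bad
  set.\<close>

lemma PE_liminf:
  assumes M: "brownian_excursion M" and B: "\<And>f. f \<in> Dsp \<Longrightarrow> \<bar>h f\<bar> \<le> B" and h: "sk_continuous h" and e: "e > 0"
  shows "\<forall>\<^sub>F n in sequentially. PE n (\<lambda>p. h (PFproc n p)) > (\<integral>f. h f \<partial>M) - e"
proof -
  have "e / 5 > 0" using e by simp
  obtain k :: nat and m0 where km: "\<And>m. m \<ge> m0 \<Longrightarrow> (\<integral>f. infconv h (real k) (sample m f) \<partial>M) \<ge> (\<integral>f. h f \<partial>M) - e / 5"
    using excursion_infconv[OF M B h \<open>e / 5 > 0\<close>] by blast
  have B0: "B \<ge> 0" using B[OF stepf_Dsp[of 1]] by (meson abs_ge_zero order.trans le_refl)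
  define d where "d = e / (5 * (real k + 1))"
  have d: "d > 0" using e by (simp add: d_def)
  have kd: "real k * d \<le> e / 5"
  proof -
    have "real k * d \<le> (real k + 1) * d" using d by (intro mult_right_mono) auto
    also have "\<dots> = e / 5"
    proof -
      have "c * (e / (5 * c)) = e / 5" if "c \<noteq> 0" for c using that by simp
      from this[of "real k + 1"] show ?thesis unfolding d_def by linarith
    qed
    finally show ?thesis .
  qed
  define C where "C = 2 * B * (20736000000 * (1 / d^4 + 1))"
  obtain m2 where m2: "real m2 > C / (e / 5)" using reals_Archimedean2 by blast
  define m where "m = max 2 (max m0 m2)"
  have m: "m \<ge> 2" "m \<ge> m0" "real m \<ge> real m2" by (auto simp: m_def)
  have Cm: "C / real m \<le> e / 5"
  proof -
    have "C / (e / 5) < real m" using m2 m by linarith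
    then have "C < real m * (e / 5)" using e by (simp add: divide_less_eq)
    then show ?thesis using m by (simp add: divide_le_eq mult.commute)
  qed
  have sc: "sup_continuous (infconv h (real k))" using B by (intro infconv_sup_continuous) auto
  let ?P = "\<lambda>n. PE n (\<lambda>p. infconv h (real k) (gridproc m n p))"
  have "?P \<longlonglongrightarrow> (\<integral>f. infconv h (real k) (sample m f) \<partial>M)"
    by (rule gridf_convergence(2)[OF M m(1) sc])
  from order_tendstoD(1)[OF this, of "(\<integral>f. h f \<partial>M) - 2 * (e / 5)"]
  have ev1: "\<forall>\<^sub>F n in sequentially. ?P n > (\<integral>f. h f \<partial>M) - 2 * (e / 5)" using km[OF m(2)] e by simp
  have "(\<lambda>n. real k * (1 / sqrt (real n))) \<longlonglongrightarrow> real k * 0"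
    by (intro tendsto_mult tendsto_const) real_asymp
  from order_tendstoD(2)[OF this, of "e / 5"]
  have ev2: "\<forall>\<^sub>F n in sequentially. real k * (1 / sqrt (real n)) < e / 5" using e by simp
  show ?thesis using ev1 ev2 eventually_ge_at_top[of m]
  proof eventually_elim
    case (elim n)
    have "2 * B * (real (card (badset m n d)) / real (card (PF n))) \<le> 2 * B * (20736000000 * (1 / d^4 + 1) / real m)"
      using B0 m elim d by (intro mult_left_mono badset_prob) auto
    also have "\<dots> \<le> e / 5" using Cm by (simp add: C_def)
    finally have b: "2 * B * (real (card (badset m n d)) / real (card (PF n))) \<le> e / 5" .
    have "?P n - real k * (d + 1 / sqrt n) - 2 * B * (real (card (badset m n d)) / real (card (PF n))) \<le> PE n (\<lambda>p. h (PFproc n p))"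
      using B m elim d by (intro PE_lower) auto
    moreover have "real k * (d + 1 / sqrt n) = real k * d + real k * (1 / sqrt n)" by (rule distrib_left)
    ultimately show ?case using b elim kd by linarith
  qed
qed

theorem theorem14:
  fixes M :: "(real \<Rightarrow> real) measure"
  assumes "brownian_excursion M"
  shows "\<forall>h. (\<exists>B. \<forall>f\<in>Dsp. \<bar>h f\<bar> \<le> B) \<and> sk_continuous h \<longrightarrow>
           (\<lambda>n. (\<Sum>p\<in>PF n. h (PFproc n p)) / real (card (PF n)))
             \<longlonglongrightarrow> (\<integral>f. h f \<partial>M)"
proof (intro allI impI)
  fix h :: "(real \<Rightarrow> real) \<Rightarrow> real"
  assume "(\<exists>B. \<forall>f\<in>Dsp. \<bar>h f\<bar> \<le> B) \<and> sk_continuous h"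
  then obtain B where B: "\<And>f. f \<in> Dsp \<Longrightarrow> \<bar>h f\<bar> \<le> B" and h: "sk_continuous h" by auto
  have h': "sk_continuous (\<lambda>f. - h f)"
    using h unfolding sk_continuous_def by (simp add: abs_minus_commute)
  have "(\<lambda>n. PE n (\<lambda>p. h (PFproc n p))) \<longlonglongrightarrow> (\<integral>f. h f \<partial>M)"
  proof (rule order_tendstoI)
    fix a assume "a < (\<integral>f. h f \<partial>M)"
    then show "\<forall>\<^sub>F n in sequentially. a < PE n (\<lambda>p. h (PFproc n p))"
      using PE_liminf[OF assms B h, of "(\<integral>f. h f \<partial>M) - a"] by simp
  next
    fix a assume a: "(\<integral>f. h f \<partial>M) < a"
    have "PE n (\<lambda>p. - h (PFproc n p)) = - PE n (\<lambda>p. h (PFproc n p))" for n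
      using PE_cmult[of n "-1" "\<lambda>p. h (PFproc n p)"] by simp
    then show "\<forall>\<^sub>F n in sequentially. PE n (\<lambda>p. h (PFproc n p)) < a"
      using PE_liminf[OF assms _ h', of B "a - (\<integral>f. h f \<partial>M)"] B a by simp
  qed
  then show "(\<lambda>n. (\<Sum>p\<in>PF n. h (PFproc n p)) / real (card (PF n))) \<longlonglongrightarrow> (\<integral>f. h f \<partial>M)"
    by (simp add: PE_def)
qed

end
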